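(* Let $\gamma,\beta\in(0,1)$, $0<b<\lambda_1/\sqrt2$, $s\in[0,1/2]$, $d\in(0,\pi/4)$, and let $N$ be a positive integer. Set $k=\sqrt{\frac{\pi d}{\beta N}}$. Then there exists a constant $C$ independent of $k$, $N$, $t$ and $h$ such that for every $t>0$ and every $g_h\in\dot H_h^{2s}$ $$\|(E_h(t)-Q_{h,k}^N(t))g_h\|_{\dot H_h^{2s}}\le C\,t^{-\gamma}e^{-\sqrt{\pi d\beta N}}\,\|g_h\|_{\dot H_h^{2s}},$$ where $E_h(t):=e_{\gamma,1}(-t^\gamma L_h^\beta)$ and $Q_{h,k}^N(t)$ is its sinc quadrature approximation defined in the context.
   Context: Domain and operator. $\Omega\subset\mathbb R^n$ is a bounded polygonal domain with Lipschitz boundary; $L^2=L^2(\Omega)$ and $H^1_0=H^1_0(\Omega)$ are spaces of complex-valued functions, $(v,w)=\int_\Omega v\overline w\,dx$. $a(\cdot,\cdot)$ is a Hermitian, coercive, bounded sesquilinear form on $H^1_0\times H^1_0$. $L$ is the associated unbounded operator on $L^2$ (the inverse of $T|_{L^2}$, where $T:H^{-1}\to H_0^1$ satisfies $a(TF,\theta)=\langle F,\theta\rangle$ for all $\theta\in H^1_0$), and $\lambda_1>0$ is the smallest eigenvalue of $L$. Finite elements. $\{\mathcal T_h\}_{h>0}$ is a globally shape regular and quasi-uniform family of conforming simplicial subdivisions of $\Omega$. $\mathbb V_h\subset H^1_0$ is the space of continuous piecewise linear functions on $\mathcal T_h$, and $L_h:\mathbb V_h\to\mathbb V_h$ is defined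 by $(L_hv_h,\phi_h)=a(v_h,\phi_h)$ for all $\phi_h\in\mathbb V_h$. $L_h$ has $L^2$-orthonormal eigenfunctions $\psi_{j,h}$ with eigenvalues $\lambda_{j,h}>0$, $j=1,\dots,M_h=\dim\mathbb V_h$. $\dot H_h^r$ is $\mathbb V_h$ with the norm $\|v_h\|_{\dot H_h^r}=\big(\sum_{j=1}^{M_h}\lambda_{j,h}^r|(v_h,\psi_{j,h})|^2\big)^{1/2}$. Functions and quadrature. $e_{\gamma,\mu}(z)=\sum_{m\ge0}z^m/\Gamma(m\gamma+\mu)$ is the Mittag-Leffler function and $e_{\gamma,1}(-t^\gamma L_h^\beta)g_h=\sum_{j=1}^{M_h}e_{\gamma,1}(-t^\gamma\lambda_{j,h}^\beta)(g_h,\psi_{j,h})\psi_{j,h}$. Put $z(y)=b(\cosh y+i\sinh y)$, and $z^\beta=e^{\beta\ln z}$ with the branch cut of $\ln$ along the negative real axis. With $y_j=jk$, $$Q_{h,k}^N(t)g_h:=\frac{k}{2\pi i}\sum_{j=-N}^{N}e_{\gamma,1}(-t^\gamma z(y_j)^\beta)\,z'(y_j)\,(z(y_j)I-L_h)^{-1}g_h .$$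
   Formalization: The quadrature Q is taken with prefactor −k/(2πi) instead of k/(2πi): the contour z(y) runs clockwise around the spectrum, so with the printed sign Q tends to −E_h(t) and the bound fails for every nonzero g_h as N grows. *)

theory Defs
  imports "HOL-Analysis.Analysis" "HOL-Library.Function_Algebras"
begin

text \<open>
  Functions on the domain are total functions on the ambient space, read on the domain only;
  elements of Lebesgue and Sobolev spaces are representatives, so their norms are seminorms.
\<close>

type_synonym 'n cfun = "real^'n \<Rightarrow> complex"

definition cscale :: "complex \<Rightarrow> 'n::finite cfun \<Rightarrow> 'n cfun" where
  "cscale c v = (\<lambda>x. c * v x)"


subsection \<open>The domain\<close>

definition polygonal :: "(real^'n::finite) set \<Rightarrow> bool" where
  "polygonal \<Omega> \<longleftrightarrow> (\<exists>P. finite P \<and> (\<forall>K\<in>P. polytope K) \<and> closure \<Omega> = \<Union>P)"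

text \<open>Near each boundary point the domain is the strict epigraph, in some direction \<open>\<nu>\<close>, of a
  Lipschitz function of the component orthogonal to \<open>\<nu>\<close>.\<close>

definition lipschitz_boundary :: "(real^'n::finite) set \<Rightarrow> bool" where
  "lipschitz_boundary \<Omega> \<longleftrightarrow>
     (\<forall>p\<in>frontier \<Omega>. \<exists>U \<nu> \<phi> K. open U \<and> p \<in> U \<and> norm \<nu> = 1 \<and> K-lipschitz_on UNIV \<phi> \<and>
        \<Omega> \<inter> U = {x\<in>U. \<phi> (x - (x \<bullet> \<nu>) *\<^sub>R \<nu>) < x \<bullet> \<nu>})"

definition polygonal_lipschitz_domain :: "(real^'n::finite) set \<Rightarrow> bool" where
  "polygonal_lipschitz_domain \<Omega> \<longleftrightarrow>
     open \<Omega> \<and> connected \<Omega> \<and> \<Omega> \<noteq> {} \<and> bounded \<Omega> \<and> polygonal \<Omega> \<and> lipschitz_boundary \<Omega>"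


subsection \<open>Function spaces\<close>

definition L2 :: "(real^'n::finite) set \<Rightarrow> 'n cfun set" where
  "L2 \<Omega> = {v. v \<in> borel_measurable (lebesgue_on \<Omega>) \<and>
                integrable (lebesgue_on \<Omega>) (\<lambda>x. (cmod (v x))\<^sup>2)}"

definition L2_inner :: "(real^'n::finite) set \<Rightarrow> 'n cfun \<Rightarrow> 'n cfun \<Rightarrow> complex" where
  "L2_inner \<Omega> v w = integral\<^sup>L (lebesgue_on \<Omega>) (\<lambda>x. v x * cnj (w x))"

definition L2_norm :: "(real^'n::finite) set \<Rightarrow> 'n cfun \<Rightarrow> real" where
  "L2_norm \<Omega> v = sqrt (integral\<^sup>L (lebesgue_on \<Omega>) (\<lambda>x. (cmod (v x))\<^sup>2))"

definition partial_deriv :: "'n::finite \<Rightarrow> 'n cfun \<Rightarrow> 'n cfun" where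
  "partial_deriv i v = (\<lambda>x. frechet_derivative v (at x) (axis i 1))"

primrec C_k :: "nat \<Rightarrow> 'n::finite cfun \<Rightarrow> bool" where
  "C_k 0 v \<longleftrightarrow> continuous_on UNIV v"
| "C_k (Suc k) v \<longleftrightarrow> (\<forall>x. v differentiable (at x)) \<and> (\<forall>i. C_k k (partial_deriv i v))"

definition test_functions :: "(real^'n::finite) set \<Rightarrow> 'n cfun set" where
  "test_functions \<Omega> =
     {\<phi>. (\<forall>k. C_k k \<phi>) \<and> (\<exists>K. compact K \<and> K \<subseteq> \<Omega> \<and> (\<forall>x. x \<notin> K \<longrightarrow> \<phi> x = 0))}"

definition is_weak_deriv :: "(real^'n::finite) set \<Rightarrow> 'n \<Rightarrow> 'n cfun \<Rightarrow> 'n cfun \<Rightarrow> bool" where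
  "is_weak_deriv \<Omega> i v g \<longleftrightarrow> g \<in> L2 \<Omega> \<and>
     (\<forall>\<phi>\<in>test_functions \<Omega>.
        integral\<^sup>L (lebesgue_on \<Omega>) (\<lambda>x. v x * partial_deriv i \<phi> x) =
        - integral\<^sup>L (lebesgue_on \<Omega>) (\<lambda>x. g x * \<phi> x))"

definition weak_deriv :: "(real^'n::finite) set \<Rightarrow> 'n \<Rightarrow> 'n cfun \<Rightarrow> 'n cfun" where
  "weak_deriv \<Omega> i v = (SOME g. is_weak_deriv \<Omega> i v g)"

definition H1 :: "(real^'n::finite) set \<Rightarrow> 'n cfun set" where
  "H1 \<Omega> = {v \<in> L2 \<Omega>. \<forall>i. \<exists>g. is_weak_deriv \<Omega> i v g}"

definition H1_norm :: "(real^'n::finite) set \<Rightarrow> 'n cfun \<Rightarrow> real" where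
  "H1_norm \<Omega> v = sqrt ((L2_norm \<Omega> v)\<^sup>2 + (\<Sum>i\<in>UNIV. (L2_norm \<Omega> (weak_deriv \<Omega> i v))\<^sup>2))"

definition H10 :: "(real^'n::finite) set \<Rightarrow> 'n cfun set" where
  "H10 \<Omega> = {v \<in> H1 \<Omega>. \<exists>\<phi>. (\<forall>m. \<phi> m \<in> test_functions \<Omega>) \<and>
                          (\<lambda>m::nat. H1_norm \<Omega> (\<phi> m - v)) \<longlonglongrightarrow> 0}"


subsection \<open>The form and the operator\<close>

definition sesquilinear_on :: "'n::finite cfun set \<Rightarrow> ('n cfun \<Rightarrow> 'n cfun \<Rightarrow> complex) \<Rightarrow> bool" where
  "sesquilinear_on V a \<longleftrightarrow>
     (\<forall>u\<in>V. \<forall>v\<in>V. \<forall>w\<in>V. a (u + v) w = a u w + a v w \<and> a w (u + v) = a w u + a w v) \<and>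
     (\<forall>c. \<forall>v\<in>V. \<forall>w\<in>V. a (cscale c v) w = c * a v w \<and> a v (cscale c w) = cnj c * a v w)"

definition hermitian_on :: "'n::finite cfun set \<Rightarrow> ('n cfun \<Rightarrow> 'n cfun \<Rightarrow> complex) \<Rightarrow> bool" where
  "hermitian_on V a \<longleftrightarrow> (\<forall>v\<in>V. \<forall>w\<in>V. a v w = cnj (a w v))"

definition bounded_form :: "(real^'n::finite) set \<Rightarrow> ('n cfun \<Rightarrow> 'n cfun \<Rightarrow> complex) \<Rightarrow> bool" where
  "bounded_form \<Omega> a \<longleftrightarrow>
     (\<exists>c. \<forall>v\<in>H10 \<Omega>. \<forall>w\<in>H10 \<Omega>. cmod (a v w) \<le> c * H1_norm \<Omega> v * H1_norm \<Omega> w)"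

definition coercive_form :: "(real^'n::finite) set \<Rightarrow> ('n cfun \<Rightarrow> 'n cfun \<Rightarrow> complex) \<Rightarrow> bool" where
  "coercive_form \<Omega> a \<longleftrightarrow> (\<exists>c>0. \<forall>v\<in>H10 \<Omega>. c * (H1_norm \<Omega> v)\<^sup>2 \<le> Re (a v v))"

text \<open>\<open>is_T \<Omega> a F v\<close> says \<open>v = T F\<close>, for a bounded antilinear functional \<open>F\<close> on \<open>H10 \<Omega>\<close>.
  A function \<open>f \<in> L2 \<Omega>\<close> acts as the functional \<open>\<theta> \<mapsto> (f, \<theta>)\<close>, and \<open>is_L \<Omega> a u f\<close> says that
  \<open>u\<close> is in the domain of \<open>L\<close> with \<open>L u = f\<close>, that is \<open>T f = u\<close>.\<close>

definition is_T :: "(real^'n::finite) set \<Rightarrow> ('n cfun \<Rightarrow> 'n cfun \<Rightarrow> complex) \<Rightarrow>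
    ('n cfun \<Rightarrow> complex) \<Rightarrow> 'n cfun \<Rightarrow> bool" where
  "is_T \<Omega> a F v \<longleftrightarrow> v \<in> H10 \<Omega> \<and> (\<forall>\<theta>\<in>H10 \<Omega>. a v \<theta> = F \<theta>)"

definition is_L :: "(real^'n::finite) set \<Rightarrow> ('n cfun \<Rightarrow> 'n cfun \<Rightarrow> complex) \<Rightarrow>
    'n cfun \<Rightarrow> 'n cfun \<Rightarrow> bool" where
  "is_L \<Omega> a u f \<longleftrightarrow> f \<in> L2 \<Omega> \<and> is_T \<Omega> a (\<lambda>\<theta>. L2_inner \<Omega> f \<theta>) u"

definition eigenvalue_L :: "(real^'n::finite) set \<Rightarrow> ('n cfun \<Rightarrow> 'n cfun \<Rightarrow> complex) \<Rightarrow>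
    complex \<Rightarrow> bool" where
  "eigenvalue_L \<Omega> a \<mu> \<longleftrightarrow>
     (\<exists>u. is_L \<Omega> a u (cscale \<mu> u) \<and> \<not> (AE x in lebesgue_on \<Omega>. u x = 0))"

text \<open>All eigenvalues are real because the form is Hermitian.\<close>

definition smallest_eigenvalue_L :: "(real^'n::finite) set \<Rightarrow>
    ('n cfun \<Rightarrow> 'n cfun \<Rightarrow> complex) \<Rightarrow> real \<Rightarrow> bool" where
  "smallest_eigenvalue_L \<Omega> a lam \<longleftrightarrow>
     eigenvalue_L \<Omega> a (of_real lam) \<and> (\<forall>\<mu>::real. eigenvalue_L \<Omega> a (of_real \<mu>) \<longrightarrow> lam \<le> \<mu>)"


subsection \<open>Finite elements\<close>

definition conforming_subdivision :: "(real^'n::finite) set \<Rightarrow> (real^'n) set set \<Rightarrow> bool" where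
  "conforming_subdivision \<Omega> \<T> \<longleftrightarrow>
     triangulation \<T> \<and> (\<forall>K\<in>\<T>. int CARD('n) simplex K) \<and> \<Union>\<T> = closure \<Omega>"

definition inradius :: "(real^'n::finite) set \<Rightarrow> real" where
  "inradius K = Sup {r. 0 < r \<and> (\<exists>x. cball x r \<subseteq> K)}"

text \<open>The parameter \<open>h\<close> is only an index; it is not tied to the mesh size.\<close>

definition regular_mesh_family :: "(real^'n::finite) set \<Rightarrow> (real \<Rightarrow> (real^'n) set set) \<Rightarrow> bool" where
  "regular_mesh_family \<Omega> \<T> \<longleftrightarrow>
     (\<forall>h>0. conforming_subdivision \<Omega> (\<T> h)) \<and>
     (\<exists>c. \<forall>h>0. \<forall>K\<in>\<T> h. diameter K \<le> c * inradius K) \<and>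
     (\<exists>\<rho>. \<forall>h>0. \<forall>K\<in>\<T> h. \<forall>K'\<in>\<T> h. diameter K \<le> \<rho> * diameter K')"

text \<open>Vanishing outside \<open>\<Omega>\<close> selects one representative of each finite element function, so that the
  space is finite-dimensional and its \<open>L2\<close> norm is a norm.\<close>

definition fe_space :: "(real^'n::finite) set \<Rightarrow> (real^'n) set set \<Rightarrow> 'n cfun set" where
  "fe_space \<Omega> \<T> = {v \<in> H10 \<Omega>. continuous_on (closure \<Omega>) v \<and> (\<forall>x. x \<notin> \<Omega> \<longrightarrow> v x = 0) \<and>
     (\<forall>K\<in>\<T>. \<exists>A c. linear A \<and> (\<forall>x\<in>K. v x = A x + c))}"

lemma vector_space_cscale: "vector_space (cscale :: complex \<Rightarrow> 'n::finite cfun \<Rightarrow> 'n cfun)"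
  by unfold_locales (auto simp: cscale_def fun_eq_iff algebra_simps)

definition fe_dim :: "(real^'n::finite) set \<Rightarrow> (real^'n) set set \<Rightarrow> nat" where
  "fe_dim \<Omega> \<T> = vector_space.dim cscale (fe_space \<Omega> \<T>)"

definition L_h :: "(real^'n::finite) set \<Rightarrow> (real^'n) set set \<Rightarrow>
    ('n cfun \<Rightarrow> 'n cfun \<Rightarrow> complex) \<Rightarrow> 'n cfun \<Rightarrow> 'n cfun" where
  "L_h \<Omega> \<T> a v = (THE w. w \<in> fe_space \<Omega> \<T> \<and> (\<forall>\<phi>\<in>fe_space \<Omega> \<T>. L2_inner \<Omega> w \<phi> = a v \<phi>))"

definition orthonormal_eigenfunctions :: "(real^'n::finite) set \<Rightarrow> (real^'n) set set \<Rightarrow>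
    ('n cfun \<Rightarrow> 'n cfun \<Rightarrow> complex) \<Rightarrow> (nat \<Rightarrow> 'n cfun) \<Rightarrow> (nat \<Rightarrow> real) \<Rightarrow> bool" where
  "orthonormal_eigenfunctions \<Omega> \<T> a \<psi> lam \<longleftrightarrow>
     (\<forall>j\<in>{1..fe_dim \<Omega> \<T>}.
        \<psi> j \<in> fe_space \<Omega> \<T> \<and> 0 < lam j \<and> L_h \<Omega> \<T> a (\<psi> j) = cscale (of_real (lam j)) (\<psi> j)) \<and>
     (\<forall>i\<in>{1..fe_dim \<Omega> \<T>}. \<forall>j\<in>{1..fe_dim \<Omega> \<T>}.
        L2_inner \<Omega> (\<psi> i) (\<psi> j) = (if i = j then 1 else 0))"

definition Hdot_norm :: "(real^'n::finite) set \<Rightarrow> (real^'n) set set \<Rightarrow>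
    (nat \<Rightarrow> 'n cfun) \<Rightarrow> (nat \<Rightarrow> real) \<Rightarrow> real \<Rightarrow> 'n cfun \<Rightarrow> real" where
  "Hdot_norm \<Omega> \<T> \<psi> lam r v =
     sqrt (\<Sum>j=1..fe_dim \<Omega> \<T>. lam j powr r * (cmod (L2_inner \<Omega> v (\<psi> j)))\<^sup>2)"


subsection \<open>The discrete solution operator and its quadrature\<close>

definition mittag_leffler :: "real \<Rightarrow> real \<Rightarrow> complex \<Rightarrow> complex" where
  "mittag_leffler \<gamma> \<mu> z = (\<Sum>m. z ^ m / of_real (Gamma (real m * \<gamma> + \<mu>)))"

definition E_h :: "(real^'n::finite) set \<Rightarrow> (real^'n) set set \<Rightarrow>
    (nat \<Rightarrow> 'n cfun) \<Rightarrow> (nat \<Rightarrow> real) \<Rightarrow> real \<Rightarrow> real \<Rightarrow> real \<Rightarrow> 'n cfun \<Rightarrow> 'n cfun" where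
  "E_h \<Omega> \<T> \<psi> lam \<gamma> \<beta> t g =
     (\<Sum>j=1..fe_dim \<Omega> \<T>.
        cscale (mittag_leffler \<gamma> 1 (of_real (- (t powr \<gamma> * lam j powr \<beta>))) * L2_inner \<Omega> g (\<psi> j)) (\<psi> j))"

definition sinc_contour :: "real \<Rightarrow> real \<Rightarrow> complex" where
  "sinc_contour b y = of_real b * (of_real (cosh y) + \<i> * of_real (sinh y))"

text \<open>\<open>resolvent_h \<Omega> \<T> a z\<close> is the inverse of \<open>z I - L_h\<close> on the finite element space.\<close>

definition resolvent_h :: "(real^'n::finite) set \<Rightarrow> (real^'n) set set \<Rightarrow>
    ('n cfun \<Rightarrow> 'n cfun \<Rightarrow> complex) \<Rightarrow> complex \<Rightarrow> 'n cfun \<Rightarrow> 'n cfun" where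
  "resolvent_h \<Omega> \<T> a z = inv_into (fe_space \<Omega> \<T>) (\<lambda>w. cscale z w - L_h \<Omega> \<T> a w)"

text \<open>
  The contour is traversed upwards and leaves the spectrum on its right, so it winds around each
  eigenvalue clockwise: with \<open>(z I - L_h)\<^sup>-\<^sup>1\<close> in the integrand, Cauchy's formula for
  \<open>e_{\<gamma>,1} (- t^\<gamma> L_h^\<beta>)\<close> carries the factor \<open>- 1 / (2 \<pi> i)\<close>. The formula commonly printed with
  \<open>k / (2 \<pi> i)\<close> presupposes a counterclockwise contour; taken literally with this
  parametrization it would approximate \<open>- E_h\<close>. Hence the minus sign below. The power
  \<open>z powr \<beta>\<close> is the one given by the principal logarithm.
\<close>

definition Q_hk :: "(real^'n::finite) set \<Rightarrow> (real^'n) set set \<Rightarrow> ('n cfun \<Rightarrow> 'n cfun \<Rightarrow> complex) \<Rightarrow>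
    real \<Rightarrow> real \<Rightarrow> real \<Rightarrow> real \<Rightarrow> nat \<Rightarrow> real \<Rightarrow> 'n cfun \<Rightarrow> 'n cfun" where
  "Q_hk \<Omega> \<T> a \<gamma> \<beta> b k N t g =
     cscale (- (of_real k / (2 * of_real pi * \<i>)))
       (\<Sum>j\<in>{- int N..int N}.
          let y = of_int j * k; z = sinc_contour b y in
          cscale (mittag_leffler \<gamma> 1 (- (of_real (t powr \<gamma>) * z powr of_real \<beta>)) *
                  vector_derivative (sinc_contour b) (at y))
            (resolvent_h \<Omega> \<T> a z g))"

end

theory Submission
  imports Defs "HOL-Complex_Analysis.Complex_Analysis"
begin

text \<open>
  In the eigenbasis of \<open>L_h\<close> both \<open>E_h(t)\<close> and \<open>Q_hk\<close> are diagonal, so the error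
  in the weighted norm is at most the largest error of the scalar quadrature
  \<open>f(l) \<approx> - k / (2 \<pi> i) \<Sum>\<^sub>j f(z(y\<^sub>j)) z'(y\<^sub>j) / (z(y\<^sub>j) - l)\<close>
  with \<open>f(z) = e\<^sub>\<gamma>\<^sub>,\<^sub>1(- t\<^sup>\<gamma> z\<^sup>\<beta>)\<close> over the discrete eigenvalues \<open>l\<close> (\<open>Hdot_error\<close>). A bound
  that is uniform in \<open>l \<ge> lam1\<close> therefore suffices, once every discrete eigenvalue is known to
  be at least \<open>lam1\<close>.

  The scalar bound (\<open>scalar_quadrature_error\<close>) has three ingredients.
  First, \<open>|e\<^sub>\<gamma>\<^sub>,\<^sub>1(- w)| \<le> \<Gamma>(\<gamma> + 1) / Re w\<close> in the right half plane
  (\<open>mittag_leffler_bound\<close>); it gives \<open>|f(z)| \<le> A |z|\<^sup>-\<^sup>\<beta>\<close> with \<open>A\<close> proportional to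
  \<open>t\<^sup>-\<^sup>\<gamma>\<close>. The bound is proved for the backward Euler discretisation of the fractional
  relaxation equation, where it is an elementary statement about the coefficients of a power
  series, and passes to the limit of vanishing step size. Second, the contour is the line
  \<open>Im Y = \<pi>/4\<close> seen through \<open>z = c cosh Y\<close> with \<open>c = \<surd>2 b < lam1\<close>. In the variable \<open>Y\<close> the
  Cauchy integrand is odd and has its poles at \<open>\<plusminus>arcosh(l/c)\<close>, so the residue theorem between
  the lines \<open>Im Y = \<plusminus>\<pi>/4\<close> shows that the integral equals \<open>f(l)\<close> (\<open>contour_formula\<close>).
  Third, the integrand is holomorphic and decays like \<open>exp(- \<beta>|x|)\<close> in the strip of half width
  \<open>d < \<pi>/4\<close> around the line, uniformly in \<open>l\<close> (\<open>contour_kernel_bound\<close>); the trapezoid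
  rule then has an error of order \<open>exp(- 2 \<pi> d/k)\<close> and cutting it off at \<open>N\<close> costs
  \<open>exp(- \<beta> k N)\<close>. The prescribed \<open>k\<close> makes the latter equal to \<open>exp(- \<surd>(\<pi> d \<beta> N))\<close> and the
  former its square.

  The inequality \<open>lam1 \<le> lam h j\<close> is the Rayleigh bound
  \<open>lam1 \<parallel>v\<parallel>\<^sup>2 \<le> a(v, v)\<close> on \<open>H10\<close> (\<open>Rayleigh_lower_bound\<close>), applied to discrete
  eigenfunctions. The number \<open>lam1\<close> is only given as the smallest eigenvalue, so the infimum
  \<open>\<mu>\<close> of the Rayleigh quotient has to be shown to be an eigenvalue. A minimising sequence of
  test functions has a subsequence that converges in \<open>L2\<close> (\<open>Rellich\<close>), hence in
  \<open>H1\<close> by coercivity and the parallelogram law, and its limit satisfies the eigenvalue equation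
  because the Cauchy--Schwarz inequality for the semidefinite form \<open>a - \<mu> (\<cdot>, \<cdot>)\<close> makes it a null
  vector of that form. Compactness is obtained from cell averages on a cubic grid, with the
  deviation from the averages controlled by the translation estimate for the gradient.
\<close>

section \<open>The Mittag-Leffler function in the right half plane\<close>

text \<open>The power series of \<open>(1 - X)\<^sup>-\<^sup>c\<close>.\<close>

definition fps_negbin :: "'a::field_char_0 \<Rightarrow> 'a fps" where
  "fps_negbin c = Abs_fps (\<lambda>n. pochhammer c n / fact n)"

lemma fps_negbin_nth [simp]: "fps_nth (fps_negbin c) n = pochhammer c n / fact n"
  by (simp add: fps_negbin_def)

text \<open>Up to signs, the coefficients are binomial coefficients with upper entry \<open>-c\<close>, so the law of exponents
  is Vandermonde's convolution.\<close>

lemma fps_negbin_add: "fps_negbin (c + d) = fps_negbin c * fps_negbin d"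
proof (rule fps_ext)
  fix n
  have P: "pochhammer c k / fact k = (-1) ^ k * ((-c) gchoose k)" for c :: 'a and k
    by (simp add: gbinomial_pochhammer flip: power_mult_distrib)
  have "fps_nth (fps_negbin c * fps_negbin d) n =
      (\<Sum>i=0..n. ((-1) ^ i * ((-c) gchoose i)) * ((-1) ^ (n - i) * ((-d) gchoose (n - i))))"
    by (simp only: fps_mult_nth fps_negbin_nth P)
  also have "\<dots> = (\<Sum>i=0..n. (-1) ^ n * (((-c) gchoose i) * ((-d) gchoose (n - i))))"
  proof (rule sum.cong[OF refl])
    fix i assume "i \<in> {0..n}"
    then have "(-1) ^ i * (-1) ^ (n - i) = ((-1) ^ n :: 'a)"
      by (simp flip: power_add)
    then show "((-1) ^ i * ((-c) gchoose i)) * ((-1) ^ (n - i) * ((-d) gchoose (n - i))) =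
               (-1) ^ n * (((-c) gchoose i) * ((-d) gchoose (n - i)))"
      by (metis (no_types, lifting) mult.assoc mult.left_commute)
  qed
  also have "\<dots> = (-1) ^ n * ((-c + -d) gchoose n)"
    by (simp only: sum_distrib_left[symmetric] gbinomial_Vandermonde)
  also have "\<dots> = fps_nth (fps_negbin (c + d)) n"
    using P[of "c + d" n] by simp
  finally show "fps_nth (fps_negbin (c + d)) n = fps_nth (fps_negbin c * fps_negbin d) n" by simp
qed

lemma fps_negbin_0: "fps_negbin 0 = 1"
  by (rule fps_ext) (simp add: pochhammer_0_left)

lemma fps_negbin_1_nth: "fps_nth (fps_negbin 1) n = 1"
  by (simp add: pochhammer_fact[symmetric])

lemma fps_negbin_minus_1: "fps_negbin (-1) = 1 - fps_X"
proof (rule fps_ext)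
  fix n show "fps_nth (fps_negbin (-1)) n = fps_nth (1 - fps_X) n"
    by (cases n rule: nat.exhaust; cases "n - 1")
       (auto simp: pochhammer_rec pochhammer_0_left)
qed

lemma fps_negbin_sum: "(\<Sum>k\<le>n. pochhammer c k / fact k) = pochhammer (c + 1) n / (fact n :: 'a::field_char_0)"
proof -
  have "pochhammer (c + 1) n / (fact n :: 'a) = fps_nth (fps_negbin c * fps_negbin 1) n"
    by (simp flip: fps_negbin_add)
  also have "\<dots> = (\<Sum>k\<le>n. pochhammer c k / fact k)"
    by (simp add: fps_mult_nth fps_negbin_1_nth atLeast0AtMost del: fps_negbin_nth(1)) 
       (simp)
  finally show ?thesis by simp
qed

lemma pochhammer_nonneg': "0 \<le> (x::real) \<Longrightarrow> 0 \<le> pochhammer x n"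
  by (cases "x = 0") (auto simp: pochhammer_0_left intro!: pochhammer_nonneg)

text \<open>The series of \<open>(1 - r)\<^sup>-\<^sup>x\<close> has nonnegative terms, so its value bounds the partial sum up to \<open>n\<close>,
  and there each \<open>r\<^sup>k\<close> may be lowered to \<open>r\<^sup>n\<close>.\<close>

lemma negbin_le:
  fixes x r :: real
  assumes "0 \<le> x" "0 < r" "r < 1"
  shows "pochhammer (x + 1) n / fact n \<le> 1 / (r ^ n * (1 - r) powr x)"
proof -
  have s: "(\<lambda>k. pochhammer x k / fact k * r ^ k) sums (1 - r) powr (-x)"
    using gen_binomial_real[of "-r" "-x"] assms
    by (simp add: gbinomial_pochhammer mult.assoc flip: power_mult_distrib)
       (simp add: mult_ac flip: power_mult_distrib)
  have "pochhammer (x + 1) n / fact n * r ^ n = (\<Sum>k\<le>n. pochhammer x k / fact k * r ^ n)"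
    by (simp add: sum_distrib_right flip: fps_negbin_sum)
  also have "\<dots> \<le> (\<Sum>k\<le>n. pochhammer x k / fact k * r ^ k)"
    using assms by (intro sum_mono mult_left_mono power_decreasing divide_nonneg_nonneg pochhammer_nonneg') auto
  also have "\<dots> \<le> (\<Sum>k. pochhammer x k / fact k * r ^ k)"
    using assms s by (intro sum_le_suminf) (auto simp: sums_iff intro!: mult_nonneg_nonneg divide_nonneg_nonneg pochhammer_nonneg')
  also have "\<dots> = (1 - r) powr (-x)" using s by (simp add: sums_iff)
  finally show ?thesis using assms by (simp add: powr_minus field_simps)
qed

text \<open>The power series of \<open>1 / (v + (1 - X)\<^sup>g)\<close>.\<close>

definition ml_resolvent_fps :: "'a::field_char_0 \<Rightarrow> 'a \<Rightarrow> 'a fps" where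
  "ml_resolvent_fps g v = inverse (fps_const v + fps_negbin (-g))"

lemma ml_resolvent_fps_mult:
  assumes "v \<noteq> -1"
  shows "(fps_const v + fps_negbin (-g)) * ml_resolvent_fps g v = 1"
  unfolding ml_resolvent_fps_def
  by (rule inverse_mult_eq_1') (use assms in \<open>simp add: eq_neg_iff_add_eq_0 add.commute\<close>)

lemma ml_resolvent_fps_rec:
  assumes "v \<noteq> -1"
  shows "(v + 1) * fps_nth (ml_resolvent_fps g v) n =
    (if n = 0 then 1 else 0) + (\<Sum>i=1..n. - (pochhammer (-g) i / fact i) * fps_nth (ml_resolvent_fps g v) (n - i))"
proof -
  have "fps_nth ((fps_const v + fps_negbin (-g)) * ml_resolvent_fps g v) n = (if n = 0 then 1 else 0)"
    by (simp add: ml_resolvent_fps_mult[OF assms])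
  moreover have "fps_nth ((fps_const v + fps_negbin (-g)) * ml_resolvent_fps g v) n =
     (v + 1) * fps_nth (ml_resolvent_fps g v) n +
      (\<Sum>i=1..n. (pochhammer (-g) i / fact i) * fps_nth (ml_resolvent_fps g v) (n - i))"
    unfolding fps_mult_nth
    by (subst sum.atLeast_Suc_atMost) (auto intro!: sum.cong)
  ultimately show ?thesis
    by (simp add: sum_negf algebra_simps)
qed

text \<open>Apart from the constant term, all coefficients of \<open>(1 - X)\<^sup>g\<close> are nonpositive; this makes the
  recursion of the resolvent coefficients a positive one.\<close>

lemma pochhammer_neg_nonneg:
  assumes "0 < (g::real)" "g < 1" "1 \<le> i"
  shows "0 \<le> - (pochhammer (-g) i / fact i)"
proof -
  obtain j where "i = Suc j" using assms(3) by (cases i) auto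
  then have "- pochhammer (-g) i = g * pochhammer (1 - g) j"
    by (simp add: pochhammer_rec)
  moreover have "0 \<le> g * pochhammer (1 - g) j" using assms by (intro mult_nonneg_nonneg pochhammer_nonneg') auto
  ultimately show ?thesis by (simp add: divide_nonpos_pos)
qed

text \<open>In the recursion the earlier coefficients enter with nonnegative weights, so taking absolute values
  loses nothing but the factor \<open>|v + 1| \<ge> Re v + 1\<close> on the left.\<close>

lemma ml_resolvent_fps_dominated:
  assumes g: "0 < g" "g < 1" and v: "0 \<le> Re v"
  shows "cmod (fps_nth (ml_resolvent_fps (of_real g) v) n) \<le> fps_nth (ml_resolvent_fps g (Re v)) n"
proof (induction n rule: less_induct)
  case (less n)
  let ?q = "fps_nth (ml_resolvent_fps (of_real g) v)" and ?r = "fps_nth (ml_resolvent_fps g (Re v))"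
  let ?p = "\<lambda>i. - (pochhammer (-g) i / fact i)"
  have ne: "v \<noteq> -1" "Re v \<noteq> -1" using v by auto
  have "(Re v + 1) * cmod (?q n) \<le> cmod (v + 1) * cmod (?q n)"
    using complex_Re_le_cmod[of "v + 1"] by (intro mult_right_mono) auto
  also have "\<dots> = cmod ((v + 1) * ?q n)" by (simp add: norm_mult)
  also have "(v + 1) * ?q n = (if n = 0 then 1 else 0) + (\<Sum>i=1..n. of_real (?p i) * ?q (n - i))"
    unfolding ml_resolvent_fps_rec[OF ne(1)] using pochhammer_of_real[of "-g", where 'a=complex] by simp
  also have "cmod \<dots> \<le> cmod (if n = 0 then 1 else 0) + (\<Sum>i=1..n. cmod (of_real (?p i) * ?q (n - i)))"
    by (intro order.trans[OF norm_triangle_ineq] add_mono norm_sum order.refl)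
  also have "\<dots> \<le> (if n = 0 then 1 else 0) + (\<Sum>i=1..n. ?p i * ?r (n - i))"
  proof (intro add_mono sum_mono)
    fix i assume i: "i \<in> {1..n}"
    have "cmod (of_real (?p i) * ?q (n - i)) = ?p i * cmod (?q (n - i))"
      using pochhammer_neg_nonneg[OF g, of i] i by (simp only: norm_mult norm_of_real abs_of_nonneg atLeastAtMost_iff)
    also have "\<dots> \<le> ?p i * ?r (n - i)"
      using i by (intro mult_left_mono less pochhammer_neg_nonneg g) auto
    finally show "cmod (of_real (?p i) * ?q (n - i)) \<le> ?p i * ?r (n - i)" .
  qed auto
  also have "\<dots> = (Re v + 1) * ?r n"
    unfolding ml_resolvent_fps_rec[OF ne(2)] by simp
  finally show ?case using v by simp
qed

text \<open>The power series of \<open>(1 - X)\<^sup>g\<^sup>-\<^sup>1 / (v + (1 - X)\<^sup>g)\<close>. Its coefficients are the values at the steps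
  \<open>n = 0, 1, \<dots>\<close> of the backward Euler (Gruenwald--Letnikov) approximation to the equation
  \<open>D\<^sup>g u = - v u\<close>, \<open>u(0) = 1\<close>, whose solution is \<open>e\<^sub>g\<^sub>,\<^sub>1(- v s\<^sup>g)\<close>.\<close>

definition ml_scheme :: "'a::field_char_0 \<Rightarrow> 'a \<Rightarrow> 'a fps" where
  "ml_scheme g v = fps_negbin (1 - g) * ml_resolvent_fps g v"

lemma ml_scheme_dominated:
  assumes g: "0 < g" "g < 1" and v: "0 \<le> Re v"
  shows "cmod (fps_nth (ml_scheme (of_real g) v) n) \<le> fps_nth (ml_scheme g (Re v)) n"
proof -
  have p: "pochhammer (1 - complex_of_real g) i / fact i = of_real (pochhammer (1 - g) i / fact i)" for i
    using pochhammer_of_real[of "1 - g" i, where 'a=complex] by simp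
  show ?thesis
    unfolding ml_scheme_def fps_mult_nth fps_negbin_nth p
  proof (intro sum_norm_le)
    fix i assume "i \<in> {0..n}"
    have "0 \<le> pochhammer (1 - g) i / fact i"
      using g by (intro divide_nonneg_nonneg pochhammer_nonneg') auto
    then show "cmod (of_real (pochhammer (1 - g) i / fact i) * fps_nth (ml_resolvent_fps (of_real g) v) (n - i))
        \<le> pochhammer (1 - g) i / fact i * fps_nth (ml_resolvent_fps g (Re v)) (n - i)"
      unfolding norm_mult norm_of_real
      by (intro mult_mono ml_resolvent_fps_dominated g v) auto
  qed
qed

text \<open>For \<open>r > 0\<close> the coefficients \<open>U\<^sub>n\<close> are nonnegative and decrease, because \<open>(1 - X) U = 1 - r Q\<close> with
  \<open>Q\<close> nonnegative. They also solve the integral equation \<open>U + r (1 - X)\<^sup>-\<^sup>g U = 1 / (1 - X)\<close>. Replacing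
  every earlier value in the convolution by the smaller \<open>U\<^sub>n\<close> leaves the partial sum of the
  weights, which is the coefficient of \<open>(1 - X)\<^sup>-\<^sup>g\<^sup>-\<^sup>1\<close>.\<close>

lemma ml_scheme_bound_real:
  assumes g: "0 < (g::real)" "g < 1" and r: "0 < r"
  shows "fps_nth (ml_scheme g r) n \<le> 1 / (r * (pochhammer (g + 1) n / fact n))"
proof -
  let ?U = "ml_scheme g r" and ?Q = "ml_resolvent_fps g r"
  have ne: "r \<noteq> -1" using r by simp
  have Q0: "0 \<le> fps_nth ?Q n" for n
  proof -
    have "0 \<le> cmod (fps_nth (ml_resolvent_fps (of_real g) (of_real r)) n)" by simp
    also have "\<dots> \<le> fps_nth ?Q n" using ml_resolvent_fps_dominated[OF g, of "of_real r" n] r by simp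
    finally show ?thesis .
  qed
  have U0: "0 \<le> fps_nth ?U n" for n
    unfolding ml_scheme_def fps_mult_nth using g by (auto intro!: sum_nonneg mult_nonneg_nonneg Q0 divide_nonneg_nonneg pochhammer_nonneg')
  have "(1 - fps_X) * ?U = fps_negbin (-g) * ?Q"
    unfolding ml_scheme_def fps_negbin_minus_1[symmetric] mult.assoc[symmetric] fps_negbin_add[symmetric] by simp
  also have "\<dots> = 1 - fps_const r * ?Q"
    using ml_resolvent_fps_mult[OF ne, of g] by (simp add: algebra_simps)
  finally have D: "(1 - fps_X) * ?U = 1 - fps_const r * ?Q" .
  have "fps_nth ?U (Suc n) \<le> fps_nth ?U n" for n
  proof -
    have "fps_nth ((1 - fps_X) * ?U) (Suc n) = - r * fps_nth ?Q (Suc n)"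
      unfolding D by simp
    then have "fps_nth ?U (Suc n) - fps_nth ?U n = - r * fps_nth ?Q (Suc n)"
      by (simp add: algebra_simps)
    then show ?thesis using mult_nonneg_nonneg[OF less_imp_le[OF r] Q0[of "Suc n"]] by simp
  qed
  then have dec: "decseq (fps_nth ?U)" by (simp add: decseq_Suc_iff)
  have "?U + fps_const r * (fps_negbin g * ?U) = fps_negbin g * (fps_negbin (-g) + fps_const r) * ?U"
    using fps_negbin_add[of g "-g"] by (simp add: algebra_simps fps_negbin_0)
  also have "\<dots> = (fps_negbin g * fps_negbin (1 - g)) * ((fps_const r + fps_negbin (-g)) * ?Q)"
    unfolding ml_scheme_def add.commute[of "fps_negbin (-g)"] by (simp only: mult_ac)
  also have "\<dots> = fps_negbin 1"
    unfolding ml_resolvent_fps_mult[OF ne] by (simp flip: fps_negbin_add)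
  finally have "fps_nth ?U n + r * fps_nth (fps_negbin g * ?U) n = 1"
    by (metis fps_add_nth fps_mult_left_const_nth fps_negbin_1_nth)
  then have "r * fps_nth (fps_negbin g * ?U) n \<le> 1" using U0[of n] by linarith
  moreover have "pochhammer (g + 1) n / fact n * fps_nth ?U n \<le> fps_nth (fps_negbin g * ?U) n"
    unfolding fps_mult_nth fps_negbin_sum[symmetric] sum_distrib_right atLeast0AtMost fps_negbin_nth using g
    by (intro sum_mono mult_left_mono decseqD[OF dec] divide_nonneg_nonneg pochhammer_nonneg') auto
  ultimately have "r * (pochhammer (g + 1) n / fact n * fps_nth ?U n) \<le> 1"
    using r by (meson mult_left_mono less_imp_le order.trans)
  moreover have "0 < r * (pochhammer (g + 1) n / fact n)" using r g by (intro mult_pos_pos divide_pos_pos pochhammer_pos) auto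
  ultimately show ?thesis by (simp add: field_simps)
qed

lemma ml_scheme_bound:
  assumes g: "0 < g" "g < 1" and v: "0 < Re v"
  shows "cmod (fps_nth (ml_scheme (of_real g) v) n) \<le> 1 / (Re v * (pochhammer (g + 1) n / fact n))"
  using ml_scheme_dominated[OF g, of v n] ml_scheme_bound_real[OF g v, of n] v by linarith

lemma scaled_pochhammer_tendsto:
  assumes "0 \<le> (x::real)"
  shows "(\<lambda>n. real n powr (-x) * (pochhammer (x + 1) n / fact n)) \<longlonglongrightarrow> 1 / Gamma (x + 1)"
proof -
  have "(\<lambda>n. rGamma_series (x + 1) n / ((x + 1) / real n + 1)) \<longlonglongrightarrow> rGamma (x + 1) / (0 + 1)"
    by (intro tendsto_intros lim_const_over_n) auto
  moreover have "eventually (\<lambda>n. rGamma_series (x + 1) n / ((x + 1) / real n + 1) =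
      real n powr (-x) * (pochhammer (x + 1) n / fact n)) sequentially"
    using eventually_gt_at_top[of 0]
  proof eventually_elim
    case (elim n)
    have 1: "exp ((x + 1) * ln (real n)) = real n powr x * real n"
      using elim by (simp add: powr_def exp_add algebra_simps)
    have 2: "pochhammer (x + 1) (n + 1) = pochhammer (x + 1) n * ((x + 1) + real n)"
      by (simp add: pochhammer_Suc)
    have 3: "(x + 1) / real n + 1 = ((x + 1) + real n) / real n"
      using elim by (simp add: field_simps)
    have 4: "rGamma_series (x + 1) n =
        (pochhammer (x + 1) n * ((x + 1) + real n)) / (fact n * (real n powr x * real n))"
      by (simp only: rGamma_series_def 2 of_real_eq_id id_apply 1)
    have 5: "(p * s) / (F * (R * N)) / (s / N) = inverse R * (p / F)"
      if "0 < s" "0 < N" "0 < F" "0 < R" for p s F R N :: real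
      using that by (simp add: field_simps)
    show ?case
      unfolding 4 3 powr_minus by (rule 5) (use elim assms in auto)
  qed
  ultimately have "(\<lambda>n. real n powr (-x) * (pochhammer (x + 1) n / fact n)) \<longlonglongrightarrow> rGamma (x + 1) / (0 + 1)"
    by (rule Lim_transform_eventually)
  then show ?thesis by (simp add: rGamma_inverse_Gamma inverse_eq_divide)
qed

text \<open>The bound \<open>negbin_le\<close> with \<open>r = 1 - B/n\<close>. It is uniform in \<open>n\<close> and leaves \<open>B\<close> free, which allows
  geometric decay in \<open>m\<close> when \<open>x = m g\<close>.\<close>

lemma scaled_pochhammer_le:
  assumes "0 \<le> (x::real)" "0 < B" "2 * B \<le> real n"
  shows "real n powr (-x) * (pochhammer (x + 1) n / fact n) \<le> exp (2 * B) * B powr (-x)"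
proof -
  have n: "0 < real n" using assms by linarith
  define y where "y = B / real n"
  have y: "0 < y" "y \<le> 1/2" using assms n by (auto simp: y_def field_simps)
  have "- 2 * y \<le> - y - 2 * y\<^sup>2"
    using mult_left_mono[OF y(2), of "2 * y"] y by (simp add: power2_eq_square)
  also have "\<dots> \<le> ln (1 - y)" using ln_one_minus_pos_lower_bound[of y] y by simp
  finally have "exp (-2 * y) \<le> 1 - y" using y by (simp add: ln_ge_iff)
  then have "exp (-2 * y) ^ n \<le> (1 - y) ^ n" by (intro power_mono) auto
  moreover have "exp (-2 * y) ^ n = exp (- 2 * B)"
    using n by (simp add: y_def flip: exp_of_nat_mult)
  ultimately have e: "exp (- 2 * B) \<le> (1 - y) ^ n" by simp
  have "pochhammer (x + 1) n / fact n \<le> 1 / ((1 - y) ^ n * y powr x)"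
    using negbin_le[of x "1 - y" n] assms y by simp
  also have "\<dots> \<le> 1 / (exp (- 2 * B) * y powr x)"
    using e y by (intro divide_left_mono mult_right_mono mult_pos_pos) auto
  also have "y powr x = B powr x / real n powr x"
    using assms n by (simp add: y_def powr_divide)
  finally show ?thesis using n assms
    by (simp add: powr_minus exp_minus field_simps)
qed

lemma ml_coeff_le:
  assumes "0 \<le> (x::real)" "0 < B"
  shows "1 / Gamma (x + 1) \<le> exp (2 * B) * B powr (-x)"
proof (rule tendsto_upperbound[OF scaled_pochhammer_tendsto[OF assms(1)]])
  show "eventually (\<lambda>n. real n powr (-x) * (pochhammer (x + 1) n / fact n) \<le> exp (2 * B) * B powr (-x)) sequentially"
    using eventually_ge_at_top[of "nat \<lceil>2 * B\<rceil>"]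
    by eventually_elim (use assms in \<open>intro scaled_pochhammer_le, auto simp: nat_ceiling_le_eq\<close>)
qed auto

text \<open>The choice \<open>B = (2 r)\<^sup>1\<^sup>/\<^sup>g\<close> in the previous bounds compensates the growth of \<open>r\<^sup>m\<close>.\<close>

lemma powr_half_geometric:
  assumes "0 < (g::real)" "0 < r"
  shows "r ^ m * ((2 * r) powr (1 / g)) powr (- (real m * g)) = (1 / 2) ^ m"
proof -
  have "((2 * r) powr (1 / g)) powr (- (real m * g)) = (2 * r) powr (- real m)"
    using assms by (simp add: powr_powr)
  also have "\<dots> = 1 / (2 * r) ^ m" using assms by (simp add: powr_minus powr_realpow divide_inverse)
  finally show ?thesis using assms by (simp add: power_mult_distrib power_one_over)
qed

lemma mittag_leffler_summable:
  assumes "0 < g"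
  shows "summable (\<lambda>m. norm (z ^ m / of_real (Gamma (real m * g + 1)) :: complex))"
proof -
  define r where "r = cmod z + 1"
  have r: "0 < r" "cmod z \<le> r" by (auto simp: r_def add_nonneg_pos)
  define B where "B = (2 * r) powr (1 / g)"
  have B: "0 < B" using r by (simp add: B_def)
  show ?thesis
  proof (rule summable_comparison_test')
    show "summable (\<lambda>m. exp (2 * B) * (1 / 2) ^ m)" by (intro summable_mult summable_geometric) auto
    fix m :: nat
    have G: "0 < Gamma (real m * g + 1)" using assms by (intro Gamma_real_pos) (auto intro: add_nonneg_pos)
    have "norm (z ^ m / of_real (Gamma (real m * g + 1))) = cmod z ^ m * (1 / Gamma (real m * g + 1))"
      using G by (simp add: norm_divide norm_power)
    also have "\<dots> \<le> r ^ m * (exp (2 * B) * B powr (- (real m * g)))"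
      using assms r B G by (intro mult_mono power_mono ml_coeff_le) auto
    also have "\<dots> = exp (2 * B) * (1 / 2) ^ m"
      using powr_half_geometric[OF assms r(1), of m] by (simp add: B_def mult_ac)
    finally show "norm (norm (z ^ m / of_real (Gamma (real m * g + 1)))) \<le> exp (2 * B) * (1 / 2) ^ m" by simp
  qed
qed

lemma mittag_leffler_holomorphic:
  assumes "0 < g"
  shows "mittag_leffler g 1 holomorphic_on A"
proof -
  define c where "c = (\<lambda>m. 1 / complex_of_real (Gamma (real m * g + 1)))"
  have s: "summable (\<lambda>m. c m * z ^ m)" for z
    using summable_norm_cancel[OF mittag_leffler_summable[OF assms, of z]] by (simp add: c_def)
  have "((\<lambda>z. \<Sum>m. c m * z ^ m) has_field_derivative (\<Sum>m. diffs c m * z ^ m)) (at z)" for z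
    by (rule termdiffs_strong_converges_everywhere) (rule s)
  then have "(\<lambda>z. \<Sum>m. c m * z ^ m) holomorphic_on A"
    unfolding holomorphic_on_def field_differentiable_def
    by (blast intro: has_field_derivative_at_within)
  also have "(\<lambda>z. \<Sum>m. c m * z ^ m) = mittag_leffler g 1"
    by (simp add: mittag_leffler_def c_def fun_eq_iff)
  finally show ?thesis .
qed

text \<open>Formally \<open>(1 - X)\<^sup>g\<^sup>-\<^sup>1 / (v + (1 - X)\<^sup>g)\<close> is the geometric series of the terms \<open>(- v)\<^sup>m (1 - X)\<^sup>-\<^sup>m\<^sup>g\<^sup>-\<^sup>1\<close>.
  The coefficientwise sums converge for small \<open>v\<close>; multiplying them by \<open>(1 - X)\<^sup>g\<close> shifts the index \<open>m\<close>
  by one, which yields the equation that defines the scheme.\<close>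

lemma ml_scheme_sums:
  assumes g: "0 < g" "g < 1" and v: "cmod v < 1/2"
  shows "fps_nth (ml_scheme (of_real g) v) n =
           (\<Sum>m. (- v) ^ m * of_real (pochhammer (real m * g + 1) n / fact n))"
proof -
  define P where "P = (\<lambda>m n. pochhammer (real m * g + 1) n / fact n)"
  have P0: "0 \<le> P m n" for m n unfolding P_def using g by (intro divide_nonneg_nonneg pochhammer_nonneg') auto
  have summ: "summable (\<lambda>m. (- v) ^ m * of_real (P m n))" for n
  proof (rule summable_comparison_test')
    have "cmod v * 2 powr g < 1"
    proof -
      have "cmod v * 2 powr g \<le> cmod v * 2 powr 1" using g by (intro mult_left_mono powr_mono) auto
      then show ?thesis using v by simp
    qed
    then show "summable (\<lambda>m. 2 ^ n * (cmod v * 2 powr g) ^ m)"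
      by (intro summable_mult summable_geometric) (simp add: abs_mult)
    fix m :: nat
    have "P m n \<le> 1 / ((1/2) ^ n * (1 - 1/2) powr (real m * g))"
      unfolding P_def using g by (intro negbin_le) auto
    also have "\<dots> = 2 ^ n * (2 powr g) ^ m"
      by (simp add: powr_divide power_divide powr_powr[symmetric] powr_realpow mult.commute[of "real m"])
    finally have "P m n \<le> 2 ^ n * (2 powr g) ^ m" .
    then have "cmod v ^ m * P m n \<le> cmod v ^ m * (2 ^ n * (2 powr g) ^ m)"
      by (intro mult_left_mono) auto
    then show "cmod ((- v) ^ m * of_real (P m n)) \<le> 2 ^ n * (cmod v * 2 powr g) ^ m"
      using P0[of m n] by (simp add: norm_mult norm_power power_mult_distrib mult_ac)
  qed
  define S where "S = Abs_fps (\<lambda>n. \<Sum>m. (- v) ^ m * of_real (P m n))"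
  define A where "A = fps_negbin (- complex_of_real g)"
  have A: "fps_nth (fps_negbin (of_real (real m * g + 1))) n = complex_of_real (P m n)" for m n
    using pochhammer_of_real[of "real m * g + 1" n, where 'a=complex] by (simp add: P_def)
  have "S * (fps_const v + A) = fps_negbin (1 - of_real g)"
  proof (rule fps_ext)
    fix n
    have "fps_nth (S * A) n = (\<Sum>i=0..n. (\<Sum>m. (- v) ^ m * of_real (P m i) * fps_nth A (n - i)))"
      unfolding fps_mult_nth S_def fps_nth_Abs_fps
      by (intro sum.cong refl suminf_mult2 summ)
    also have "\<dots> = (\<Sum>m. \<Sum>i=0..n. (- v) ^ m * of_real (P m i) * fps_nth A (n - i))"
      by (intro suminf_sum[symmetric] summable_mult2 summ)
    also have "\<dots> = (\<Sum>m. (- v) ^ m * fps_nth (fps_negbin (of_real (real m * g + 1)) * A) n)"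
      by (simp only: fps_mult_nth A sum_distrib_left mult.assoc)
    also have "\<dots> = (\<Sum>m. (- v) ^ m * fps_nth (fps_negbin (of_real (real m * g + 1 - g))) n)"
      unfolding A_def by (simp flip: fps_negbin_add del: fps_negbin_nth)
    finally have 1: "fps_nth (S * A) n = (\<Sum>m. (- v) ^ m * fps_nth (fps_negbin (of_real (real m * g + 1 - g))) n)" .
    have 2: "(- v) ^ Suc m * fps_nth (fps_negbin (of_real (real (Suc m) * g + 1 - g))) n =
        (- v) * ((- v) ^ m * of_real (P m n))" for m
      unfolding A[symmetric] by (simp add: algebra_simps del: fps_negbin_nth)
    have "summable (\<lambda>m. (- v) ^ Suc m * fps_nth (fps_negbin (of_real (real (Suc m) * g + 1 - g))) n)"
      unfolding 2 by (intro summable_mult summ)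
    then have "summable (\<lambda>m. (- v) ^ m * fps_nth (fps_negbin (of_real (real m * g + 1 - g))) n)"
      by (subst (asm) summable_Suc_iff)
    from suminf_split_head[OF this]
    have "fps_nth (S * A) n = fps_nth (fps_negbin (1 - of_real g)) n + (\<Sum>m. (- v) * ((- v) ^ m * of_real (P m n)))"
      unfolding 1 2 by (simp del: fps_negbin_nth)
    also have "(\<Sum>m. (- v) * ((- v) ^ m * of_real (P m n))) = - v * fps_nth S n"
      unfolding S_def fps_nth_Abs_fps by (rule suminf_mult[OF summ])
    finally show "fps_nth (S * (fps_const v + A)) n = fps_nth (fps_negbin (1 - of_real g)) n"
      by (simp add: distrib_left mult.commute del: fps_negbin_nth)
  qed
  then have "ml_scheme (of_real g) v = S * ((fps_const v + A) * ml_resolvent_fps (of_real g) v)"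
    unfolding ml_scheme_def by (simp add: mult.assoc)
  also have "v \<noteq> -1" using v by auto
  then have "(fps_const v + A) * ml_resolvent_fps (of_real g) v = 1"
    unfolding A_def by (rule ml_resolvent_fps_mult)
  finally show ?thesis by (simp add: S_def P_def)
qed

text \<open>With \<open>n\<close> steps of length \<open>1/n\<close>, that is \<open>v = w n\<^sup>-\<^sup>g\<close>, the \<open>n\<close>-th coefficient of the scheme converges to
  \<open>e\<^sub>g\<^sub>,\<^sub>1(- w)\<close> by dominated convergence of series, and its bound \<open>ml_scheme_bound\<close> converges to
  the right-hand side.\<close>

theorem mittag_leffler_bound:
  assumes g: "0 < g" "g < 1" and w: "0 < Re w"
  shows "cmod (mittag_leffler g 1 (- w)) \<le> Gamma (g + 1) / Re w"
proof -
  define P where "P = (\<lambda>x n. pochhammer (x + 1) n / (fact n :: real))"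
  define r where "r = cmod w"
  have r: "0 < r" using w by (auto simp: r_def)
  define B where "B = (2 * r) powr (1 / g)"
  have B: "0 < B" using r by (simp add: B_def)
  define f where "f = (\<lambda>m n. (- w) ^ m * of_real (real n powr (- (real m * g)) * P (real m * g) n))"
  define U where "U = (\<lambda>n. fps_nth (ml_scheme (of_real g) (w * of_real (real n powr - g))) n)"
  have ev: "eventually (\<lambda>n. 0 < n \<and> 2 * B \<le> real n) sequentially"
    using eventually_ge_at_top[of "nat \<lceil>2 * B\<rceil>"] eventually_gt_at_top[of 0]
    by eventually_elim (auto simp: nat_ceiling_le_eq)
  have "(\<lambda>n. \<Sum>m. f m n) \<longlonglongrightarrow> (\<Sum>m. (- w) ^ m / of_real (Gamma (real m * g + 1)))"
  proof (rule tannerys_theorem[THEN conjunct2, THEN conjunct2])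
    show "(f m \<longlongrightarrow> (- w) ^ m / of_real (Gamma (real m * g + 1))) sequentially" for m
    proof -
      have "(\<lambda>n. (- w) ^ m * of_real (real n powr (- (real m * g)) * P (real m * g) n)) \<longlonglongrightarrow> 
              (- w) ^ m * of_real (1 / Gamma (real m * g + 1))"
        unfolding P_def using g by (intro tendsto_intros scaled_pochhammer_tendsto) auto
      then show ?thesis by (simp add: f_def)
    qed
    show "\<forall>\<^sub>F (m, n) in at_top \<times>\<^sub>F sequentially. norm (f m n) \<le> exp (2 * B) * (1/2) ^ m"
    proof -
      have "\<forall>\<^sub>F n in sequentially. \<forall>m. norm (f m n) \<le> exp (2 * B) * (1/2) ^ m"
        using ev
      proof eventually_elim
        case (elim n)
        show ?case
        proof
          fix m
          have "0 \<le> P (real m * g) n" unfolding P_def using g by (intro divide_nonneg_nonneg pochhammer_nonneg') auto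
          then have "norm (f m n) = r ^ m * (real n powr (- (real m * g)) * P (real m * g) n)"
            by (simp add: f_def norm_mult norm_power r_def)
          also have "\<dots> \<le> r ^ m * (exp (2 * B) * B powr (- (real m * g)))"
            unfolding P_def using g B elim r by (intro mult_left_mono scaled_pochhammer_le) auto
          also have "\<dots> = exp (2 * B) * (1/2) ^ m"
            using powr_half_geometric[OF g(1) r, of m] by (simp add: B_def mult_ac)
          finally show "norm (f m n) \<le> exp (2 * B) * (1/2) ^ m" .
        qed
      qed
      then show ?thesis
        by (subst eventually_prod_filter) (auto intro!: exI[of _ "\<lambda>_. True"] exI[of _ "\<lambda>n. \<forall>m. norm (f m n) \<le> exp (2 * B) * (1/2) ^ m"])
    qed
    show "summable (\<lambda>m. exp (2 * B) * (1/2) ^ m)" by (intro summable_mult summable_geometric) auto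
  qed auto
  then have lim: "(\<lambda>n. \<Sum>m. f m n) \<longlonglongrightarrow> mittag_leffler g 1 (- w)"
    by (simp add: mittag_leffler_def)
  have small: "(\<lambda>n. r * real n powr (- g)) \<longlonglongrightarrow> r * 0"
    using g by (intro tendsto_intros tendsto_neg_powr filterlim_real_sequentially) auto
  have "eventually (\<lambda>n. r * real n powr (- g) < 1/2) sequentially"
    using order_tendstoD(2)[OF small, of "1/2"] by simp
  then have "eventually (\<lambda>n. cmod (\<Sum>m. f m n) \<le> 1 / (Re w * (real n powr (-g) * P g n))) sequentially"
    using eventually_gt_at_top[of 0]
  proof eventually_elim
    case (elim n)
    let ?v = "w * of_real (real n powr - g)"
    have "cmod ?v < 1/2" using elim by (simp add: norm_mult r_def)
    note ml_scheme_sums[OF g this, of n]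
    moreover have "(- ?v) ^ m = (- w) ^ m * of_real (real n powr (- (real m * g)))" for m
    proof -
      have "(real n powr - g) ^ m = real n powr (- (real m * g))"
        using elim by (simp add: powr_realpow[symmetric] powr_powr mult.commute)
      then show ?thesis by (metis mult_minus_left of_real_power power_mult_distrib)
    qed
    ultimately have "(\<Sum>m. f m n) = fps_nth (ml_scheme (of_real g) ?v) n"
      by (simp add: f_def P_def mult.assoc)
    moreover have "0 < Re ?v" using w elim by simp
    from ml_scheme_bound[OF g this, of n]
    have "cmod (fps_nth (ml_scheme (of_real g) ?v) n) \<le> 1 / (Re w * (real n powr (-g) * P g n))"
      by (simp add: P_def mult.assoc)
    ultimately show ?case by simp
  qed
  moreover have "(\<lambda>n. 1 / (Re w * (real n powr (-g) * P g n))) \<longlonglongrightarrow> 1 / (Re w * (1 / Gamma (g + 1)))"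
    unfolding P_def using g w Gamma_real_pos[of "g + 1"] less_irrefl[of "0 :: real"]
    by (intro tendsto_intros scaled_pochhammer_tendsto) (auto simp: Gamma_eq_zero_iff elim!: nonpos_Ints_cases)
  ultimately have "cmod (mittag_leffler g 1 (- w)) \<le> 1 / (Re w * (1 / Gamma (g + 1)))"
    using lim by (intro tendsto_le[OF sequentially_bot _ tendsto_norm[OF lim]])
  then show ?thesis by simp
qed

section \<open>Rectangle contours and the trapezoid rule\<close>

text \<open>The integrals over the sides of a rectangle, taken with respect to the real parameter; a vertical
  side contributes \<open>\<i>\<close> times its \<open>vline\<close> to the contour integral.\<close>

definition hline :: "(complex \<Rightarrow> complex) \<Rightarrow> real \<Rightarrow> real \<Rightarrow> complex" where
  "hline f y R = integral {-R..R} (\<lambda>x. f (Complex x y))"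

definition vline :: "(complex \<Rightarrow> complex) \<Rightarrow> real \<Rightarrow> real \<Rightarrow> real \<Rightarrow> complex" where
  "vline f x p q = integral {p..q} (\<lambda>y. f (Complex x y))"

lemma residue_simple_quotient:
  assumes s: "open s" "z \<in> s" and f: "f holomorphic_on s" and g: "g holomorphic_on s"
    and nz: "\<And>w. w \<in> s \<Longrightarrow> w \<noteq> z \<Longrightarrow> g w \<noteq> 0" and gz: "g z = 0"
    and g': "(g has_field_derivative g') (at z)" "g' \<noteq> 0"
  shows "residue (\<lambda>w. f w / g w) z = f z / g'"
proof (rule residue_simple'[OF s])
  show "(\<lambda>w. f w / g w) holomorphic_on s - {z}"
    by (intro holomorphic_on_divide holomorphic_on_subset[OF f] holomorphic_on_subset[OF g]) (use nz in auto)
  have "((\<lambda>w. (g w - g z) / (w - z)) \<longlongrightarrow> g') (at z)"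
    using g'(1) by (simp add: has_field_derivative_iff)
  moreover have "(f \<longlongrightarrow> f z) (at z)"
    using f s by (meson continuous_on_eq_continuous_at holomorphic_on_imp_continuous_on isCont_def)
  ultimately have "((\<lambda>w. f w / ((g w - g z) / (w - z))) \<longlongrightarrow> f z / g') (at z)"
    using g'(2) by (intro tendsto_divide)
  then show "((\<lambda>w. f w / g w * (w - z)) \<longlongrightarrow> f z / g') (at z)"
    by (simp add: gz)
qed

text \<open>A rotation by a right angle turns the segment into a vertical one.\<close>

lemma contour_integral_linepath_horizontal:
  assumes "a < b"
  shows "contour_integral (linepath (Complex a y) (Complex b y)) f = integral {a..b} (\<lambda>x. f (Complex x y))"
proof -
  have "contour_integral (linepath (\<i> * Complex a y) (\<i> * Complex b y)) (\<lambda>w. f (-\<i> * w)) =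
      \<i> * integral {a..b} (\<lambda>x. f (-\<i> * Complex (-y) x))"
    using assms by (intro contour_integral_linepath_same_Re) auto
  moreover have "-\<i> * Complex (-y) x = Complex x y" for x by (simp add: complex_eq_iff)
  moreover have "contour_integral (linepath (\<i> * Complex a y) (\<i> * Complex b y)) (\<lambda>w. f (-\<i> * w)) =
      \<i> * contour_integral (linepath (Complex a y) (Complex b y)) f"
  proof -
    have "linepath (\<i> * Complex a y) (\<i> * Complex b y) t = \<i> * linepath (Complex a y) (Complex b y) t" for t
      by (simp add: linepath_def algebra_simps scaleR_conv_of_real)
    then show ?thesis
      by (simp add: contour_integral_integral flip: integral_mult_right)
         (simp add: algebra_simps)
  qed
  ultimately show ?thesis by simp
qed

lemma rectangle_residue:
  assumes R: "0 < R" and pq: "p < q" and S: "open S" "convex S"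
    and sub: "cbox (Complex (-R) p) (Complex R q) \<subseteq> S"
    and P: "finite P" "P \<subseteq> box (Complex (-R) p) (Complex R q)"
    and f: "f holomorphic_on S - P"
  shows "hline f p R - hline f q R + \<i> * (vline f R p q - vline f (-R) p q)
           = 2 * pi * \<i> * (\<Sum>w\<in>P. residue f w)"
proof -
  let ?a1 = "Complex (-R) p" and ?a2 = "Complex R p" and ?a3 = "Complex R q" and ?a4 = "Complex (-R) q"
  have img: "path_image (rectpath ?a1 ?a3) = cbox ?a1 ?a3 - box ?a1 ?a3"
    using R pq by (intro path_image_rectpath_cbox_minus_box) auto
  then have img': "path_image (rectpath ?a1 ?a3) \<subseteq> S - P" using sub P by blast
  have "contour_integral (rectpath ?a1 ?a3) f = 2 * pi * \<i> * (\<Sum>w\<in>P. winding_number (rectpath ?a1 ?a3) w * residue f w)"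
  proof (rule Residue_theorem[OF S(1) _ P(1) f])
    show "connected S" using S by (simp add: convex_connected)
    show "\<forall>z. z \<notin> S \<longrightarrow> winding_number (rectpath ?a1 ?a3) z = 0"
      using sub R pq by (intro allI impI winding_number_rectpath_outside) auto
  qed (use img' in auto)
  also have "(\<Sum>w\<in>P. winding_number (rectpath ?a1 ?a3) w * residue f w) = (\<Sum>w\<in>P. residue f w)"
    using P by (intro sum.cong refl) (subst winding_number_rectpath, auto)
  finally have 1: "contour_integral (rectpath ?a1 ?a3) f = 2 * pi * \<i> * (\<Sum>w\<in>P. residue f w)" .
  have cont: "continuous_on (S - P) f" using f by (rule holomorphic_on_imp_continuous_on)
  have segs: "closed_segment ?a1 ?a2 \<subseteq> S - P" "closed_segment ?a2 ?a3 \<subseteq> S - P"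
       "closed_segment ?a3 ?a4 \<subseteq> S - P" "closed_segment ?a4 ?a1 \<subseteq> S - P"
    using img' by (auto simp: rectpath_def Let_def path_image_join)
  have ci: "f contour_integrable_on linepath ?a1 ?a2" "f contour_integrable_on linepath ?a2 ?a3"
       "f contour_integrable_on linepath ?a3 ?a4" "f contour_integrable_on linepath ?a4 ?a1"
    by (intro contour_integrable_continuous_linepath continuous_on_subset[OF cont] segs)+
  have "contour_integral (rectpath ?a1 ?a3) f = contour_integral (linepath ?a1 ?a2) f +
      (contour_integral (linepath ?a2 ?a3) f + (contour_integral (linepath ?a3 ?a4) f + contour_integral (linepath ?a4 ?a1) f))"
    unfolding rectpath_def Let_def using ci
    by (simp add: contour_integrable_joinI valid_path_join)
  also have "contour_integral (linepath ?a3 ?a4) f = - contour_integral (linepath ?a4 ?a3) f"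
    using contour_integral_reversepath[of "linepath ?a4 ?a3" f] by simp
  also have "contour_integral (linepath ?a4 ?a1) f = - contour_integral (linepath ?a1 ?a4) f"
    using contour_integral_reversepath[of "linepath ?a1 ?a4" f] by simp
  also have "contour_integral (linepath ?a1 ?a2) f = hline f p R"
    unfolding hline_def using R by (intro contour_integral_linepath_horizontal) auto
  also have "contour_integral (linepath ?a4 ?a3) f = hline f q R"
    unfolding hline_def using R by (intro contour_integral_linepath_horizontal) auto
  also have "contour_integral (linepath ?a2 ?a3) f = \<i> * vline f R p q"
    unfolding vline_def using pq by (intro contour_integral_linepath_same_Re) auto
  also have "contour_integral (linepath ?a1 ?a4) f = \<i> * vline f (-R) p q"
    unfolding vline_def using pq by (intro contour_integral_linepath_same_Re) auto
  finally show ?thesis using 1 by (simp add: algebra_simps)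
qed

lemma vline_bound:
  assumes "p \<le> q" "continuous_on {p..q} (\<lambda>y. f (Complex x y))"
    and "\<And>y. y \<in> {p..q} \<Longrightarrow> cmod (f (Complex x y)) \<le> B"
  shows "cmod (vline f x p q) \<le> B * (q - p)"
  unfolding vline_def using integral_bound[OF assms] by simp

lemma exp_abs_integral:
  assumes "0 < c" "0 \<le> R"
  shows "(\<lambda>x::real. exp (- c * \<bar>x\<bar>)) integrable_on {-R..R}" "integral {-R..R} (\<lambda>x. exp (- c * \<bar>x\<bar>)) \<le> 2 / c"
proof -
  have 1: "((\<lambda>x. exp (- c * \<bar>x\<bar>)) has_integral (- exp (- c * R) / c - - exp (- c * 0) / c)) {0..R}"
  proof (rule fundamental_theorem_of_calculus)
    fix x assume "x \<in> {0..R}"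
    then show "((\<lambda>x. - exp (- c * x) / c) has_vector_derivative exp (- c * \<bar>x\<bar>)) (at x within {0..R})"
      using assms by (auto intro!: derivative_eq_intros simp flip: has_real_derivative_iff_has_vector_derivative)
  qed (use assms in auto)
  have 2: "((\<lambda>x. exp (- c * \<bar>x\<bar>)) has_integral (exp (c * 0) / c - exp (c * (-R)) / c)) {-R..0}"
  proof (rule fundamental_theorem_of_calculus)
    fix x assume "x \<in> {-R..0}"
    then show "((\<lambda>x. exp (c * x) / c) has_vector_derivative exp (- c * \<bar>x\<bar>)) (at x within {-R..0})"
      using assms by (auto intro!: derivative_eq_intros simp flip: has_real_derivative_iff_has_vector_derivative)
  qed (use assms in auto)
  have "((\<lambda>x. exp (- c * \<bar>x\<bar>)) has_integral ((exp (c * 0) / c - exp (c * (-R)) / c) + (- exp (- c * R) / c - - exp (- c * 0) / c))) {-R..R}"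
    by (rule has_integral_combine[OF _ _ 2 1]) (use assms in auto)
  then show "(\<lambda>x::real. exp (- c * \<bar>x\<bar>)) integrable_on {-R..R}" "integral {-R..R} (\<lambda>x. exp (- c * \<bar>x\<bar>)) \<le> 2 / c"
    using assms by (auto simp: integrable_on_def integral_unique field_simps)
qed

lemma hline_bound:
  assumes c: "0 < c" "0 \<le> R" and cont: "continuous_on {-R..R} (\<lambda>x. f (Complex x y))"
    and bd: "\<And>x. x \<in> {-R..R} \<Longrightarrow> cmod (f (Complex x y)) \<le> M * exp (- c * \<bar>x\<bar>)" and "0 \<le> M"
  shows "cmod (hline f y R) \<le> 2 * M / c"
proof -
  have "cmod (hline f y R) \<le> integral {-R..R} (\<lambda>x. M * exp (- c * \<bar>x\<bar>))"
    unfolding hline_def using bd exp_abs_integral(1)[OF c] integrable_continuous_interval[OF cont]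
    by (intro integral_norm_bound_integral integrable_on_mult_right) auto
  also have "\<dots> = M * integral {-R..R} (\<lambda>x. exp (- c * \<bar>x\<bar>))" by simp
  also have "\<dots> \<le> M * (2 / c)" by (intro mult_left_mono exp_abs_integral c \<open>0 \<le> M\<close>)
  finally show ?thesis by (simp add: mult.commute)
qed

lemma continuous_on_line:
  assumes "continuous_on S f" "\<And>x. x \<in> A \<Longrightarrow> Complex (u x) (v x) \<in> S" "continuous_on A u" "continuous_on A v"
  shows "continuous_on A (\<lambda>x. f (Complex (u x) (v x)))"
  by (rule continuous_on_compose2[OF assms(1)]) (use assms in \<open>auto intro!: continuous_on_Complex\<close>)

definition hstrip :: "real \<Rightarrow> complex set" where "hstrip D = {z. \<bar>Im z\<bar> < D}"

lemma open_hstrip: "open (hstrip D)"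
  unfolding hstrip_def by (intro open_Collect_less continuous_intros)

lemma convex_hstrip: "convex (hstrip D)"
proof -
  have "hstrip D = {z. Im z < D} \<inter> {z. Im z > - D}" by (auto simp: hstrip_def)
  then show ?thesis by (simp add: convex_Int convex_halfspace_Im_lt convex_halfspace_Im_gt)
qed

lemma norm_exp_2pi_i:
  "cmod (exp (2 * pi * \<i> * Complex x y / of_real k)) = exp (- (2 * pi * y / k))"
proof -
  have "Re (2 * pi * \<i> * Complex x y / of_real k) = - (2 * pi * y / k)"
    by (cases "k = 0") (auto simp: Re_divide_of_real)
  then show ?thesis by (simp only: norm_exp_eq_Re)
qed

lemma exp_2pi_i_eq_1_iff:
  assumes "0 < k"
  shows "exp (2 * pi * \<i> * w / of_real k) = 1 \<longleftrightarrow> (\<exists>j::int. w = of_real (of_int j * k))"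
proof -
  define u where "u = 2 * pi * \<i> * w / of_real k"
  have u: "Re u = - (2 * pi * Im w / k)" "Im u = 2 * pi * Re w / k"
    by (auto simp: u_def Re_divide_of_real Im_divide_of_real)
  have "exp u = 1 \<longleftrightarrow> Im w = 0 \<and> (\<exists>j::int. Re w = of_int j * k)"
    unfolding exp_eq_1 u using assms by (auto simp: field_simps)
  also have "\<dots> \<longleftrightarrow> (\<exists>j::int. w = of_real (of_int j * k))"
    by (auto simp: complex_eq_iff)
  finally show ?thesis by (simp add: u_def)
qed

text \<open>The function \<open>F(w) / (exp(2 \<pi> i w/k) - 1)\<close> has residue \<open>k F(jk) / (2 \<pi> i)\<close> at each node, so its integral
  around the rectangle \<open>|Re w| \<le> R\<^sub>n\<close>, \<open>|Im w| \<le> d\<close> is the trapezoid sum. The quotient is of relative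
  size \<open>\<epsilon> / (1 - \<epsilon>)\<close> on the lower side. On the upper side it differs by an equally small term from
  \<open>-F\<close>, whose integral moves to the real axis by Cauchy's theorem. The vertical sides run halfway
  between two nodes, where the exponential is negative and the denominator has modulus at least 1.\<close>

lemma trapezoid_finite_rectangle:
  fixes F :: "complex \<Rightarrow> complex"
  assumes F: "F holomorphic_on hstrip D" and d: "0 < d" "d < D" and k: "0 < k" and c: "0 < c" and M: "0 \<le> M"
    and bd: "\<And>x y. \<bar>y\<bar> \<le> d \<Longrightarrow> cmod (F (Complex x y)) \<le> M * exp (- c * \<bar>x\<bar>)"
  defines "\<epsilon> \<equiv> exp (- (2 * pi * d / k))" and "R \<equiv> \<lambda>n. (real n + 1/2) * k"
  shows "cmod (of_real k * (\<Sum>j\<in>{-int n..int n}. F (of_real (of_int j * k))) - hline F 0 (R n))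
    \<le> (4 * M / c) * (\<epsilon> / (1 - \<epsilon>)) + 6 * d * (M * exp (- c * R n))"
proof -
  define E where "E = (\<lambda>w. exp (2 * pi * \<i> * w / of_real k))"
  have nE: "cmod (E (Complex x y)) = exp (- (2 * pi * y / k))" for x y
    unfolding E_def by (rule norm_exp_2pi_i)
  have e: "0 < \<epsilon>" "\<epsilon> < 1" using d k by (auto simp: \<epsilon>_def)
  define Rn where "Rn = R n"
  have R: "0 < Rn" using k by (auto simp: Rn_def R_def intro: add_nonneg_pos)
  define X where "X = (real n + 1) * k"
  have X: "Rn < X" using k by (auto simp: Rn_def R_def X_def)
  define S where "S = hstrip D \<inter> {w. \<bar>Re w\<bar> < X}"
  define P where "P = (\<lambda>j::int. complex_of_real (of_int j * k)) ` {-int n..int n}"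
  have inj: "inj_on (\<lambda>j::int. complex_of_real (of_int j * k)) {-int n..int n}"
    using k by (auto simp: inj_on_def)
  have Sopen: "open S" unfolding S_def
    by (intro open_Int open_hstrip open_Collect_less continuous_intros)
  have "{w. \<bar>Re w\<bar> < X} = {w. Re w < X} \<inter> {w. Re w > - X}" by auto
  then have Sconv: "convex S" unfolding S_def
    by (metis convex_Int convex_halfspace_Re_lt convex_halfspace_Re_gt convex_hstrip)
  have ivl: "\<bar>of_int j * k\<bar> < X \<longleftrightarrow> j \<in> {-int n..int n}" for j :: int
  proof -
    have "\<bar>of_int j * k\<bar> < X \<longleftrightarrow> \<bar>real_of_int j\<bar> * k < (real n + 1) * k" using k by (simp add: X_def abs_mult)
    also have "\<dots> \<longleftrightarrow> real_of_int \<bar>j\<bar> < of_int (int n + 1)" using k by simp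
    also have "\<dots> \<longleftrightarrow> j \<in> {-int n..int n}" unfolding of_int_less_iff by auto
    finally show ?thesis .
  qed
  have E1: "E w - 1 \<noteq> 0" if "w \<in> S - P" for w
  proof
    assume "E w - 1 = 0"
    then have "E w = 1" by simp
    then obtain j :: int where j: "w = of_real (of_int j * k)" using exp_2pi_i_eq_1_iff[OF k] by (auto simp: E_def)
    then have "\<bar>of_int j * k\<bar> < X" using that by (simp add: S_def)
    then show False using that j unfolding ivl by (auto simp: P_def)
  qed
  have EP: "E w - 1 = 0" if "w \<in> P" for w
    using that exp_2pi_i_eq_1_iff[OF k, of w] by (auto simp: P_def E_def)
  have Ehol: "(\<lambda>w. E w - 1) holomorphic_on A" for A unfolding E_def by (intro holomorphic_intros) (use k in auto)
  have FS: "F holomorphic_on S" by (rule holomorphic_on_subset[OF F]) (auto simp: S_def)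
  have hol: "(\<lambda>w. F w / (E w - 1)) holomorphic_on S - P"
    by (intro holomorphic_on_divide Ehol holomorphic_on_subset[OF FS]) (use E1 in auto)
  have res: "residue (\<lambda>w. F w / (E w - 1)) p = F p * of_real k / (2 * pi * \<i>)" if p: "p \<in> P" for p
  proof -
    have pS: "p \<in> S" using p d unfolding P_def S_def hstrip_def using ivl by auto
    have o: "open (S - (P - {p}))" by (intro open_Diff Sopen finite_imp_closed) (simp add: P_def)
    have "residue (\<lambda>w. F w / (E w - 1)) p = F p / (E p * (2 * pi * \<i> / of_real k))"
    proof (rule residue_simple_quotient[OF o])
      show "((\<lambda>w. E w - 1) has_field_derivative E p * (2 * pi * \<i> / of_real k)) (at p)"
        unfolding E_def using k by (auto intro!: derivative_eq_intros)
      show "F holomorphic_on S - (P - {p})" by (rule holomorphic_on_subset[OF FS]) auto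
      show "E w - 1 \<noteq> 0" if "w \<in> S - (P - {p})" "w \<noteq> p" for w using E1[of w] that by auto
      show "E p * (2 * pi * \<i> / of_real k) \<noteq> 0" using k by (simp add: E_def)
    qed (use pS EP[OF p] Ehol in auto)
    also have "E p = 1" using EP[OF p] by simp
    finally show ?thesis by (simp add: field_simps)
  qed
  have box: "cbox (Complex (-Rn) y) (Complex Rn d) \<subseteq> S" if "-d \<le> y" for y
    using d X that by (auto simp: in_cbox_complex_iff S_def hstrip_def)
  have Pbox: "P \<subseteq> box (Complex (-Rn) (-d)) (Complex Rn d)"
  proof
    fix w assume "w \<in> P"
    then obtain j :: int where j: "w = of_real (of_int j * k)" "j \<in> {-int n..int n}" unfolding P_def by blast
    have "\<bar>of_int j * k\<bar> = real_of_int \<bar>j\<bar> * k" using k by (simp add: abs_mult)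
    also have "\<dots> \<le> real n * k" using j k by (intro mult_right_mono) auto
    also have "\<dots> < Rn" using k by (simp add: Rn_def R_def)
    finally show "w \<in> box (Complex (-Rn) (-d)) (Complex Rn d)" using j d by (auto simp: in_box_complex_iff)
  qed
  let ?g = "\<lambda>w. F w / (E w - 1)"
  have eq1: "hline ?g (-d) Rn - hline ?g d Rn + \<i> * (vline ?g Rn (-d) d - vline ?g (-Rn) (-d) d) =
     of_real k * (\<Sum>j\<in>{-int n..int n}. F (of_real (of_int j * k)))"
  proof -
    have "hline ?g (-d) Rn - hline ?g d Rn + \<i> * (vline ?g Rn (-d) d - vline ?g (-Rn) (-d) d) =
        2 * pi * \<i> * (\<Sum>w\<in>P. residue ?g w)"
      by (rule rectangle_residue[OF R _ Sopen Sconv box _ Pbox hol]) (use d in \<open>auto simp: P_def\<close>)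
    also have "(\<Sum>w\<in>P. residue ?g w) = (\<Sum>w\<in>P. F w) * of_real k / (2 * pi * \<i>)"
      by (simp add: res sum_divide_distrib sum_distrib_right)
    also have "(\<Sum>w\<in>P. F w) = (\<Sum>j\<in>{-int n..int n}. F (of_real (of_int j * k)))"
      unfolding P_def by (subst sum.reindex[OF inj]) simp
    finally show ?thesis by simp
  qed
  have eq2: "hline F 0 Rn - hline F d Rn + \<i> * (vline F Rn 0 d - vline F (-Rn) 0 d) = 0"
  proof -
    have "hline F 0 Rn - hline F d Rn + \<i> * (vline F Rn 0 d - vline F (-Rn) 0 d) =
        2 * pi * \<i> * (\<Sum>w\<in>{}. residue F w)"
      by (rule rectangle_residue[OF R _ Sopen Sconv box]) (use d FS in auto)
    then show ?thesis by simp
  qed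
  have bd': "cmod (F (Complex x y)) \<le> M * exp (- c * Rn)" if "\<bar>y\<bar> \<le> d" "\<bar>x\<bar> = Rn" for x y
    using bd[OF that(1), of x] that by simp
  have cF: "continuous_on (hstrip D) F" using F by (rule holomorphic_on_imp_continuous_on)
  have cg: "continuous_on (S - P) ?g" using hol by (rule holomorphic_on_imp_continuous_on)
  have mem: "Complex x y \<in> S - P" if "\<bar>x\<bar> \<le> Rn" "\<bar>y\<bar> \<le> d" "y \<noteq> 0 \<or> \<bar>x\<bar> = Rn" for x y
  proof -
    have "Complex x y \<in> S" using that d X by (auto simp: S_def hstrip_def)
    moreover have "Complex x y \<notin> P"
    proof
      assume "Complex x y \<in> P"
      moreover have "Im w = 0" if "w \<in> P" for w using that by (auto simp: P_def)
      ultimately have "y = 0" "- Rn < x \<and> x < Rn"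
        using subsetD[OF Pbox, of "Complex x y"] by (fastforce, auto simp: in_box_complex_iff)
      then show False using that by auto
    qed
    ultimately show ?thesis by blast
  qed
  have Ebig: "1 / cmod (E (Complex x (-d)) - 1) \<le> \<epsilon> / (1 - \<epsilon>)" for x
  proof -
    have "1 / \<epsilon> - 1 \<le> cmod (E (Complex x (-d)) - 1)"
      using norm_triangle_ineq2[of "E (Complex x (-d))" 1] by (simp add: nE \<epsilon>_def exp_minus divide_inverse)
    moreover have "0 < 1 / \<epsilon> - 1" using e by simp
    ultimately have "1 / cmod (E (Complex x (-d)) - 1) \<le> 1 / (1 / \<epsilon> - 1)"
      by (intro divide_left_mono mult_pos_pos) auto
    also have "\<dots> = \<epsilon> / (1 - \<epsilon>)" using e by (simp add: field_simps)
    finally show ?thesis .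
  qed
  have b1: "cmod (hline ?g (-d) Rn) \<le> 2 * (M * (\<epsilon> / (1 - \<epsilon>))) / c"
  proof (rule hline_bound)
    show "continuous_on {- Rn..Rn} (\<lambda>x. ?g (Complex x (- d)))"
      by (rule continuous_on_line[OF cg], rule mem) (use d in \<open>auto intro!: continuous_intros\<close>)
    fix x assume "x \<in> {-Rn..Rn}"
    have "cmod (?g (Complex x (-d))) = cmod (F (Complex x (-d))) * (1 / cmod (E (Complex x (-d)) - 1))"
      by (simp add: norm_divide)
    also have "\<dots> \<le> (M * exp (- c * \<bar>x\<bar>)) * (\<epsilon> / (1 - \<epsilon>))"
      using d Ebig bd[of "-d" x] M by (intro mult_mono) auto
    finally show "cmod (?g (Complex x (-d))) \<le> M * (\<epsilon> / (1 - \<epsilon>)) * exp (- c * \<bar>x\<bar>)" by (simp add: mult_ac)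
  qed (use c R M e in \<open>auto intro!: mult_nonneg_nonneg\<close>)
  have Esmall: "cmod (E (Complex x d) / (E (Complex x d) - 1)) \<le> \<epsilon> / (1 - \<epsilon>)" for x
  proof -
    have "1 - \<epsilon> \<le> cmod (E (Complex x d) - 1)"
      using norm_triangle_ineq3[of "E (Complex x d)" 1] by (simp add: nE \<epsilon>_def)
    then have "\<epsilon> / cmod (E (Complex x d) - 1) \<le> \<epsilon> / (1 - \<epsilon>)"
      using e by (intro divide_left_mono mult_pos_pos) auto
    then show ?thesis by (simp add: norm_divide nE \<epsilon>_def)
  qed
  let ?r = "\<lambda>w. F w * (E w / (E w - 1))"
  have cr: "continuous_on (S - P) ?r"
    using E1 unfolding E_def
    by (intro continuous_intros continuous_on_subset[OF cF]) (auto simp: S_def k order_less_imp_not_eq2)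
  have b2: "cmod (hline ?r d Rn) \<le> 2 * (M * (\<epsilon> / (1 - \<epsilon>))) / c"
  proof (rule hline_bound)
    show "continuous_on {- Rn..Rn} (\<lambda>x. ?r (Complex x d))"
      by (rule continuous_on_line[OF cr], rule mem) (use d in \<open>auto intro!: continuous_intros\<close>)
    fix x assume "x \<in> {-Rn..Rn}"
    have "cmod (?r (Complex x d)) = cmod (F (Complex x d)) * cmod (E (Complex x d) / (E (Complex x d) - 1))"
      by (rule norm_mult)
    also have "\<dots> \<le> (M * exp (- c * \<bar>x\<bar>)) * (\<epsilon> / (1 - \<epsilon>))"
      using d Esmall bd[of d x] M by (intro mult_mono) auto
    finally show "cmod (?r (Complex x d)) \<le> M * (\<epsilon> / (1 - \<epsilon>)) * exp (- c * \<bar>x\<bar>)" by (simp add: mult_ac)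
  qed (use c R M e in \<open>auto intro!: mult_nonneg_nonneg\<close>)
  have top: "hline ?g d Rn = hline ?r d Rn - hline F d Rn"
  proof -
    have "?g (Complex x d) = ?r (Complex x d) - F (Complex x d)" if "x \<in> {-Rn..Rn}" for x
    proof -
      have "E (Complex x d) - 1 \<noteq> 0" by (rule E1[OF mem]) (use that d in auto)
      then show ?thesis by (simp add: field_simps)
    qed
    then have "hline ?g d Rn = integral {-Rn..Rn} (\<lambda>x. ?r (Complex x d) - F (Complex x d))"
      unfolding hline_def by (intro integral_cong) auto
    also have "\<dots> = hline ?r d Rn - hline F d Rn"
      unfolding hline_def
      by (intro integral_diff integrable_continuous_interval continuous_on_line[OF cr] continuous_on_line[OF cF] mem)
         (use d in \<open>auto intro!: continuous_intros simp: hstrip_def\<close>)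
    finally show ?thesis .
  qed
  \<comment> \<open>At half-integral multiples of \<open>k\<close> the exponential is negative real.\<close>
  have Evert: "cmod (1 / (E (Complex x y) - 1)) \<le> 1" if "\<bar>x\<bar> = Rn" for x y
  proof -
    have "E (Complex x y) = - of_real (exp (- (2 * pi * y / k)))"
    proof -
      have "2 * pi * \<i> * Complex x y / of_real k = of_real (- (2 * pi * y / k)) + \<i> * of_real (2 * pi * x / k)"
        using k by (simp add: complex_eq_iff Re_divide_of_real Im_divide_of_real)
      then have "E (Complex x y) = of_real (exp (- (2 * pi * y / k))) * exp (\<i> * of_real (2 * pi * x / k))"
        unfolding E_def by (simp only: exp_add exp_of_real)
      moreover have "exp (\<i> * of_real (2 * pi * x / k)) = -1"
      proof -
        have "2 * pi * Rn / k = of_nat (2 * n + 1) * pi" using k by (simp add: Rn_def R_def field_simps)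
        then have x: "2 * pi * x / k = of_nat (2 * n + 1) * pi \<or> 2 * pi * x / k = - (of_nat (2 * n + 1) * pi)"
          using that by (cases "x \<ge> 0") auto
        have "cos (of_nat (2 * n + 1) * pi) = -1" "sin (of_nat (2 * n + 1) * pi) = 0"
          by (simp_all only: cos_npi sin_npi) simp
        then show ?thesis using x by (auto simp only: exp_eq_polar complex_eq_iff Re_exp Im_exp) auto
      qed
      ultimately show ?thesis by simp
    qed
    then have "E (Complex x y) - 1 = - of_real (exp (- (2 * pi * y / k)) + 1)" by simp
    then have "cmod (E (Complex x y) - 1) = exp (- (2 * pi * y / k)) + 1" 
      by (simp only: norm_minus_cancel norm_of_real abs_of_pos add_pos_pos exp_gt_zero zero_less_one)
    then show ?thesis by (simp add: norm_divide divide_le_eq_1 add_pos_pos)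
  qed
  have bv: "cmod (vline ?g x (-d) d) \<le> (M * exp (- c * Rn)) * (d - (-d))" if x: "\<bar>x\<bar> = Rn" for x
  proof (rule vline_bound)
    show "continuous_on {- d..d} (\<lambda>y. ?g (Complex x y))"
      by (rule continuous_on_line[OF cg], rule mem) (use d x in \<open>auto intro!: continuous_intros\<close>)
    fix y assume y: "y \<in> {-d..d}"
    have "cmod (?g (Complex x y)) = cmod (F (Complex x y)) * cmod (1 / (E (Complex x y) - 1))"
      by (simp add: norm_divide)
    also have "\<dots> \<le> M * exp (- c * Rn) * 1"
      using M Evert[OF x] bd'[of y x] x y by (intro mult_mono) auto
    finally show "cmod (?g (Complex x y)) \<le> M * exp (- c * Rn)" by simp
  qed (use d in auto)
  have bv': "cmod (vline F x 0 d) \<le> (M * exp (- c * Rn)) * (d - 0)" if x: "\<bar>x\<bar> = Rn" for x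
  proof (rule vline_bound)
    show "continuous_on {0..d} (\<lambda>y. F (Complex x y))"
      by (rule continuous_on_line[OF cF]) (use d x in \<open>auto intro!: continuous_intros simp: hstrip_def\<close>)
  qed (use d x bd' in auto)
  have alg: "S - m = gb + \<i> * v1 - \<i> * v2 + \<i> * u1 - \<i> * u2 + (- r)"
    if "gb - gt + \<i> * (v1 - v2) = S" "m - t + \<i> * (u1 - u2) = 0" "gt = r - t" for S m gb gt v1 v2 u1 u2 r t :: complex
  proof -
    have "t = m + \<i> * (u1 - u2)" using that(2) by (simp add: algebra_simps)
    then show ?thesis unfolding that(1)[symmetric] that(3) by (simp add: algebra_simps)
  qed
  have "cmod (a + b - c + e - f + g) \<le> cmod a + cmod b + cmod c + cmod e + cmod f + cmod g" for a b c e f g :: complex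
    by (smt (verit) norm_triangle_ineq norm_triangle_ineq4)
  then have tri: "x = a + b - c + e - f + g \<Longrightarrow> cmod x \<le> cmod a + cmod b + cmod c + cmod e + cmod f + cmod g" for x a b c e f g :: complex
    by blast
  have "of_real k * (\<Sum>j\<in>{-int n..int n}. F (of_real (of_int j * k))) - hline F 0 Rn =
      hline ?g (-d) Rn + (\<i> * vline ?g Rn (-d) d) - (\<i> * vline ?g (-Rn) (-d) d)
      + \<i> * vline F Rn 0 d - \<i> * vline F (-Rn) 0 d + (- hline ?r d Rn)"
    by (rule alg[OF eq1 eq2 top])
  then have "cmod (of_real k * (\<Sum>j\<in>{-int n..int n}. F (of_real (of_int j * k))) - hline F 0 Rn) \<le>
     cmod (hline ?g (-d) Rn) + cmod (\<i> * vline ?g Rn (-d) d) + cmod (\<i> * vline ?g (-Rn) (-d) d)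
      + cmod (\<i> * vline F Rn 0 d) + cmod (\<i> * vline F (-Rn) 0 d) + cmod (- hline ?r d Rn)"
    by (rule tri)
  also have "\<dots> \<le> 2 * (M * (\<epsilon> / (1 - \<epsilon>))) / c + (M * exp (- c * Rn)) * (d - (-d)) + (M * exp (- c * Rn)) * (d - (-d))
      + (M * exp (- c * Rn)) * (d - 0) + (M * exp (- c * Rn)) * (d - 0) + 2 * (M * (\<epsilon> / (1 - \<epsilon>))) / c"
    unfolding norm_mult norm_ii mult_1 norm_minus_cancel
    using b1 b2 bv[of Rn] bv[of "-Rn"] bv'[of Rn] bv'[of "-Rn"] R by (intro add_mono) auto
  also have "\<dots> = (4 * M / c) * (\<epsilon> / (1 - \<epsilon>)) + 6 * d * (M * exp (- c * Rn))"
    by (simp add: algebra_simps add_divide_distrib)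
  finally show ?thesis by (simp add: Rn_def)
qed

section \<open>Quadrature of the Cauchy integral along the hyperbola\<close>

text \<open>The map that sends the line \<open>Im Y = \<pi>/4\<close> to the hyperbola \<open>sinc_contour b\<close> when \<open>c = \<surd>2 b\<close>,
  and the strip \<open>|Im Y| < \<pi>/2\<close> to the right half plane.\<close>

definition cosh_path :: "real \<Rightarrow> complex \<Rightarrow> complex" where
  "cosh_path c Y = of_real c * (exp Y + exp (- Y)) / 2"

definition cosh_path' :: "real \<Rightarrow> complex \<Rightarrow> complex" where
  "cosh_path' c Y = of_real c * (exp Y - exp (- Y)) / 2"

lemma cosh_path_deriv: "(cosh_path c has_field_derivative cosh_path' c Y) (at Y)"
  unfolding cosh_path_def cosh_path'_def by (auto intro!: derivative_eq_intros)

lemma cosh_path_holomorphic: "cosh_path c holomorphic_on A" "cosh_path' c holomorphic_on A"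
  unfolding cosh_path_def cosh_path'_def by (auto intro!: holomorphic_intros)

lemma cosh_path_parts:
  "Re (cosh_path c (Complex x y)) = c * cosh x * cos y"
  "Im (cosh_path c (Complex x y)) = c * sinh x * sin y"
  "Re (cosh_path' c (Complex x y)) = c * sinh x * cos y"
  "Im (cosh_path' c (Complex x y)) = c * cosh x * sin y"
  by (simp_all add: cosh_path_def cosh_path'_def Re_exp Im_exp cosh_def sinh_def algebra_simps add_divide_distrib diff_divide_distrib)

lemma cosh_path_minus: "cosh_path c (- Y) = cosh_path c Y" "cosh_path' c (- Y) = - cosh_path' c Y"
  by (simp_all add: cosh_path_def cosh_path'_def field_simps)

lemma sinc_contour_eq_cosh_path:
  "sinc_contour b x = cosh_path (sqrt 2 * b) (Complex x (pi / 4))"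
  "(sinc_contour b has_vector_derivative cosh_path' (sqrt 2 * b) (Complex x (pi / 4))) (at x)"
proof -
  show "sinc_contour b x = cosh_path (sqrt 2 * b) (Complex x (pi / 4))"
    by (simp add: complex_eq_iff cosh_path_parts sinc_contour_def cos_45 sin_45)
  have 1: "cosh_path' (sqrt 2 * b) (Complex x (pi / 4)) = of_real b * (of_real (sinh x) + \<i> * of_real (cosh x))"
    by (simp add: complex_eq_iff cosh_path_parts cos_45 sin_45)
  show "(sinc_contour b has_vector_derivative cosh_path' (sqrt 2 * b) (Complex x (pi / 4))) (at x)"
    unfolding 1 sinc_contour_def
    by (auto intro!: derivative_eq_intros has_vector_derivative_of_real simp flip: has_real_derivative_iff_has_vector_derivative)
qed

lemma cosh_path_norm:
  "(cmod (cosh_path c (Complex x y)))\<^sup>2 = c\<^sup>2 * ((sinh x)\<^sup>2 + (cos y)\<^sup>2)"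
  "(cmod (cosh_path' c (Complex x y)))\<^sup>2 = c\<^sup>2 * ((cosh x)\<^sup>2 - (cos y)\<^sup>2)"
proof -
  have h: "(cosh x)\<^sup>2 = (sinh x)\<^sup>2 + 1" using cosh_square_eq[of x] by simp
  have t: "(sin y)\<^sup>2 = 1 - (cos y)\<^sup>2" by (simp add: sin_squared_eq)
  show "(cmod (cosh_path c (Complex x y)))\<^sup>2 = c\<^sup>2 * ((sinh x)\<^sup>2 + (cos y)\<^sup>2)"
    "(cmod (cosh_path' c (Complex x y)))\<^sup>2 = c\<^sup>2 * ((cosh x)\<^sup>2 - (cos y)\<^sup>2)"
    unfolding cmod_power2 cosh_path_parts power_mult_distrib h t by (simp_all add: algebra_simps)
qed

lemma cosh_path_norm_ge: "0 \<le> c \<Longrightarrow> c * \<bar>sinh x\<bar> \<le> cmod (cosh_path c (Complex x y))"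
  by (rule power2_le_imp_le) (auto simp: cosh_path_norm power_mult_distrib mult_left_mono)

lemma cosh_path'_norm_le: "0 \<le> c \<Longrightarrow> cmod (cosh_path' c (Complex x y)) \<le> c * cosh x"
  by (rule power2_le_imp_le) (auto simp: cosh_path_norm power_mult_distrib mult_left_mono)

lemma cosh_path_Re_pos: "0 < c \<Longrightarrow> \<bar>y\<bar> < pi / 2 \<Longrightarrow> 0 < Re (cosh_path c (Complex x y))"
  by (auto simp: cosh_path_parts intro!: mult_pos_pos cos_gt_zero_pi)

lemma cosh_path_eq_real_iff:
  assumes "0 < c" "c < l" "\<bar>y\<bar> < pi / 2"
  shows "cosh_path c (Complex x y) = of_real l \<longleftrightarrow> y = 0 \<and> \<bar>x\<bar> = arcosh (l / c)"
proof
  assume e: "cosh_path c (Complex x y) = of_real l"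
  have Im: "c * sinh x * sin y = 0" and Re: "c * cosh x * cos y = l"
    using arg_cong[OF e, of Im] arg_cong[OF e, of Re] by (auto simp: cosh_path_parts)
  have "x \<noteq> 0"
  proof
    assume "x = 0"
    then have "c * cos y = l" using Re by simp
    then show False using assms mult_left_mono[OF cos_le_one[of y], of c] by simp
  qed
  then have "sin y = 0" using Im assms by simp
  moreover have "\<bar>y\<bar> < pi" using assms(3) pi_gt_zero by linarith
  ultimately have y: "y = 0" by (simp add: sin_zero_pi_iff)
  then have "cosh \<bar>x\<bar> = l / c" using Re assms by (simp add: field_simps)
  then show "y = 0 \<and> \<bar>x\<bar> = arcosh (l / c)" using y by (metis abs_ge_zero arcosh_cosh_real)
next
  assume a: "y = 0 \<and> \<bar>x\<bar> = arcosh (l / c)"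
  have "cosh x = cosh \<bar>x\<bar>" by simp
  also have "\<dots> = l / c" using a assms by (simp add: cosh_arcosh_real)
  finally show "cosh_path c (Complex x y) = of_real l" using a assms by (simp add: complex_eq_iff cosh_path_parts)
qed

text \<open>The integrand of Cauchy's formula for \<open>f(l)\<close> after the substitution \<open>z = c cosh Y\<close>; the minus sign
  accounts for the clockwise orientation of the hyperbola around \<open>l\<close>.\<close>

definition contour_kernel :: "(complex \<Rightarrow> complex) \<Rightarrow> real \<Rightarrow> real \<Rightarrow> complex \<Rightarrow> complex" where
  "contour_kernel f c l Y = (- (f (cosh_path c Y) * cosh_path' c Y) / (2 * pi * \<i>)) / (cosh_path c Y - of_real l)"

lemma contour_kernel_holomorphic:
  assumes f: "f holomorphic_on {z. 0 < Re z}" and c: "0 < c" "c < l" and A: "A \<subseteq> hstrip (pi / 2)"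
    "\<And>Y. Y \<in> A \<Longrightarrow> cosh_path c Y \<noteq> of_real l"
  shows "(\<lambda>Y. - (f (cosh_path c Y) * cosh_path' c Y) / (2 * pi * \<i>)) holomorphic_on hstrip (pi / 2)"
    "contour_kernel f c l holomorphic_on A"
proof -
  have "(\<lambda>Y. f (cosh_path c Y)) holomorphic_on hstrip (pi / 2)"
  proof (rule holomorphic_on_compose_gen[unfolded o_def, OF cosh_path_holomorphic(1) f])
    show "cosh_path c ` hstrip (pi / 2) \<subseteq> {z. 0 < Re z}"
      using cosh_path_Re_pos[OF c(1)] by (auto simp: hstrip_def) (metis complex.collapse)
  qed
  then show n: "(\<lambda>Y. - (f (cosh_path c Y) * cosh_path' c Y) / (2 * pi * \<i>)) holomorphic_on hstrip (pi / 2)"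
    by (intro holomorphic_intros cosh_path_holomorphic) auto
  show "contour_kernel f c l holomorphic_on A"
    unfolding contour_kernel_def
    by (intro holomorphic_on_divide holomorphic_on_subset[OF n A(1)] holomorphic_intros cosh_path_holomorphic)
       (use A(2) in auto)
qed

lemma contour_kernel_minus: "contour_kernel f c l (- Y) = - contour_kernel f c l Y"
  by (simp add: contour_kernel_def cosh_path_minus)

lemma hline_odd:
  assumes "\<And>Y. f (- Y) = - f Y"
  shows "hline f (- q) R = - hline f q R"
proof -
  have "hline f (-q) R = integral {-R..R} (\<lambda>x. f (Complex x (-q)))" by (simp add: hline_def)
  also have "\<dots> = integral {-R..R} (\<lambda>x. f (Complex (- x) (-q)))"
    using Henstock_Kurzweil_Integration.integral_reflect_real[of R "-R" "\<lambda>x. f (Complex x (-q))"] by simp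
  also have "(\<lambda>x. f (Complex (-x) (-q))) = (\<lambda>x. - f (Complex x q))"
  proof
    fix x have "Complex (-x) (-q) = - Complex x q" by (simp add: complex_eq_iff)
    then show "f (Complex (-x) (-q)) = - f (Complex x q)" using assms by simp
  qed
  finally show ?thesis by (simp add: hline_def)
qed

text \<open>The only poles in the strip \<open>|Im Y| \<le> \<pi>/4\<close> are the two points with \<open>c cosh Y = l\<close>, both with residue
  \<open>- f(l) / (2 \<pi> i)\<close>. The kernel is odd, so the lines at heights \<open>\<plusminus>\<pi>/4\<close> contribute opposite values
  and each carries half of the sum of the residues.\<close>

lemma contour_formula:
  assumes f: "f holomorphic_on {z. 0 < Re z}" and fb: "\<And>z. 0 < Re z \<Longrightarrow> cmod (f z) \<le> A * cmod z powr (- \<beta>)"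
    and A: "0 \<le> A" and \<beta>: "0 < \<beta>" and c: "0 < c" "c < l"
  shows "((\<lambda>R. hline (contour_kernel f c l) (pi / 4) R) \<longlongrightarrow> f (of_real l)) at_top"
proof -
  let ?G = "contour_kernel f c l"
  define Y0 where "Y0 = arcosh (l / c)"
  have Y0: "0 < Y0" using c by (simp add: Y0_def)
  define P where "P = {complex_of_real Y0, - complex_of_real Y0}"
  have zero: "cosh_path c Y = of_real l \<longleftrightarrow> Y \<in> P" if "Y \<in> hstrip (pi / 2)" for Y
    using cosh_path_eq_real_iff[OF c, of "Im Y" "Re Y"] that Y0
    by (auto simp: hstrip_def P_def Y0_def[symmetric] complex_eq_iff abs_if split: if_splits)
  have Psub: "P \<subseteq> hstrip (pi / 2)" by (auto simp: P_def hstrip_def)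
  have hol: "?G holomorphic_on hstrip (pi / 2) - P"
    by (rule contour_kernel_holomorphic[OF f c]) (use zero in auto)
  have num: "(\<lambda>Y. - (f (cosh_path c Y) * cosh_path' c Y) / (2 * pi * \<i>)) holomorphic_on hstrip (pi / 2)"
    by (rule contour_kernel_holomorphic(1)[OF f c, of "{}"]) auto
  have res: "residue ?G p = - f (of_real l) / (2 * pi * \<i>)" if p: "p \<in> P" for p
  proof -
    have o: "open (hstrip (pi / 2) - (P - {p}))" by (intro open_Diff open_hstrip finite_imp_closed) (simp add: P_def)
    have zp: "cosh_path c p = of_real l" using zero Psub p by blast
    have nz: "cosh_path' c p \<noteq> 0"
    proof
      have "p = Complex Y0 0 \<or> p = Complex (-Y0) 0" using p by (auto simp: P_def complex_eq_iff)
      moreover assume "cosh_path' c p = 0"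
      ultimately show False using cosh_path_parts(3)[of c Y0 0] cosh_path_parts(3)[of c "-Y0" 0] c Y0 by auto
    qed
    have "residue ?G p = (- (f (cosh_path c p) * cosh_path' c p) / (2 * pi * \<i>)) / cosh_path' c p"
      unfolding contour_kernel_def
    proof (rule residue_simple_quotient[OF o])
      show "((\<lambda>Y. cosh_path c Y - of_real l) has_field_derivative cosh_path' c p) (at p)"
        by (auto intro!: derivative_eq_intros cosh_path_deriv)
      show "(\<lambda>Y. - (f (cosh_path c Y) * cosh_path' c Y) / (2 * pi * \<i>)) holomorphic_on hstrip (pi / 2) - (P - {p})"
        by (rule holomorphic_on_subset[OF num]) auto
    qed (use p Psub zp nz zero in \<open>auto intro!: holomorphic_intros cosh_path_holomorphic\<close>)
    then show ?thesis using nz zp by simp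
  qed
  define B where "B = (\<lambda>R. (2 / pi) * A * (c * sinh R) powr (- \<beta>))"
  have sinh_top: "filterlim (\<lambda>R. c * sinh R) at_top at_top"
    by (rule filterlim_tendsto_pos_mult_at_top[OF tendsto_const c(1) sinh_real_at_top])
  have ev: "eventually (\<lambda>R. Y0 < R \<and> 1 \<le> R \<and> 2 * l \<le> c * sinh R) at_top"
    using sinh_top by (auto simp: filterlim_at_top intro!: eventually_conj eventually_gt_at_top eventually_ge_at_top)
  have main: "cmod (hline ?G (pi / 4) R - f (of_real l)) \<le> B R * (pi / 2)"
    if R: "Y0 < R" "1 \<le> R" "2 * l \<le> c * sinh R" for R
  proof -
    have Gb: "cmod (?G (Complex x y)) \<le> B R" if x: "\<bar>x\<bar> = R" and y: "\<bar>y\<bar> \<le> pi / 4" for x y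
    proof -
      let ?z = "cosh_path c (Complex x y)"
      have pos: "0 < c * sinh R" using R c by auto
      have sx: "\<bar>sinh x\<bar> = sinh R" "cosh x = cosh R" using x R by (auto simp: abs_if split: if_splits)
      have z: "c * sinh R \<le> cmod ?z" using cosh_path_norm_ge[of c x y] c sx by simp
      have d: "c * sinh R / 2 \<le> cmod (?z - of_real l)"
        using norm_triangle_ineq2[of ?z "of_real l"] z R c by simp
      have ch: "cosh R \<le> 2 * sinh R"
      proof -
        have "3 \<le> exp (R + R)" using R exp_ge_add_one_self[of "R + R"] by linarith
        then have "3 \<le> exp R * exp R" by (simp only: exp_add)
        then have "3 * exp (-R) \<le> exp R" by (simp add: exp_minus field_simps)
        then show ?thesis by (simp add: cosh_def sinh_def field_simps)
      qed
      have "y < pi / 2" "- (pi / 2) < y" using y pi_gt_zero by linarith+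
      then have "\<bar>y\<bar> < pi / 2" by linarith
      then have "cmod (f ?z) \<le> A * cmod ?z powr (- \<beta>)" using fb cosh_path_Re_pos[OF c(1)] by blast
      also have "\<dots> \<le> A * (c * sinh R) powr (- \<beta>)"
        using A z pos \<beta> by (intro mult_left_mono powr_mono2') auto
      finally have fz: "cmod (f ?z) \<le> A * (c * sinh R) powr (- \<beta>)" .
      have "cmod (?G (Complex x y)) = cmod (f ?z) * (cmod (cosh_path' c (Complex x y)) / cmod (?z - of_real l)) / (2 * pi)"
        by (simp add: contour_kernel_def norm_mult norm_divide)
      also have "\<dots> \<le> (A * (c * sinh R) powr (- \<beta>)) * ((c * (2 * sinh R)) / (c * sinh R / 2)) / (2 * pi)"
      proof (intro divide_right_mono mult_mono fz frac_le d)
        show "cmod (cosh_path' c (Complex x y)) \<le> c * (2 * sinh R)"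
          using order.trans[OF cosh_path'_norm_le[of c x y, unfolded sx] mult_left_mono[OF ch, of c]] c by simp
      qed (use pos A c R in auto)
      also have "(c * (2 * sinh R)) / (c * sinh R / 2) = 4" using c R by (simp add: field_simps)
      finally show ?thesis by (simp add: B_def)
    qed
    have box: "cbox (Complex (-R) (-pi/4)) (Complex R (pi/4)) \<subseteq> hstrip (pi/2)"
      by (auto simp: in_cbox_complex_iff hstrip_def) (use pi_gt_zero in linarith)+
    have cG: "continuous_on (hstrip (pi/2) - P) ?G" using hol by (rule holomorphic_on_imp_continuous_on)
    have vb: "cmod (vline ?G x (-pi/4) (pi/4)) \<le> B R * (pi/4 - -pi/4)" if x: "\<bar>x\<bar> = R" for x
    proof (rule vline_bound)
      show "continuous_on {- pi / 4..pi / 4} (\<lambda>y. ?G (Complex x y))"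
      proof (rule continuous_on_line[OF cG])
        fix y assume "y \<in> {- pi / 4..pi / 4}"
        then have "\<bar>y\<bar> \<le> pi / 4" by auto
        then have "\<bar>y\<bar> < pi / 2" using pi_gt_zero by linarith
        then show "Complex x y \<in> hstrip (pi / 2) - P" using x R Y0 by (auto simp: hstrip_def P_def complex_eq_iff)
      qed (auto intro!: continuous_intros)
    qed (use Gb[OF x] in auto)
    have "hline ?G (-pi/4) R - hline ?G (pi/4) R + \<i> * (vline ?G R (-pi/4) (pi/4) - vline ?G (-R) (-pi/4) (pi/4))
        = 2 * pi * \<i> * (\<Sum>w\<in>P. residue ?G w)"
      by (rule rectangle_residue[OF _ _ open_hstrip convex_hstrip box _ _ hol])
         (use R Y0 in \<open>auto simp: P_def in_box_complex_iff\<close>)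
    also have "(\<Sum>w\<in>P. residue ?G w) = 2 * (- f (of_real l) / (2 * pi * \<i>))"
    proof -
      have ne: "complex_of_real Y0 \<noteq> - complex_of_real Y0" using Y0 by (simp add: complex_eq_iff)
      have "residue ?G (of_real Y0) = - f (of_real l) / (2 * pi * \<i>)"
        "residue ?G (- of_real Y0) = - f (of_real l) / (2 * pi * \<i>)"
        by (rule res, simp add: P_def)+
      then show ?thesis unfolding P_def using ne by simp
    qed
    finally have "2 * (hline ?G (pi/4) R - f (of_real l)) = \<i> * (vline ?G R (-pi/4) (pi/4) - vline ?G (-R) (-pi/4) (pi/4))"
      using hline_odd[of ?G "pi/4" R, OF contour_kernel_minus] by (simp add: algebra_simps)
    then have "2 * cmod (hline ?G (pi/4) R - f (of_real l)) = cmod (vline ?G R (-pi/4) (pi/4) - vline ?G (-R) (-pi/4) (pi/4))"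
      by (metis norm_mult norm_ii mult_1 norm_numeral)
    also have "\<dots> \<le> B R * (pi/4 - -pi/4) + B R * (pi/4 - -pi/4)"
      using vb[of R] vb[of "-R"] R by (intro order.trans[OF norm_triangle_ineq4] add_mono) auto
    finally show ?thesis by (simp add: field_simps)
  qed
  have "((\<lambda>R. (2 / pi) * A * (c * sinh R) powr (- \<beta>) * (pi / 2)) \<longlongrightarrow> (2 / pi) * A * 0 * (pi / 2)) at_top"
    using \<beta> by (intro tendsto_intros tendsto_neg_powr sinh_top) auto
  then have "((\<lambda>R. B R * (pi / 2)) \<longlongrightarrow> 0) at_top" by (simp add: B_def)
  then have "((\<lambda>R. hline ?G (pi / 4) R - f (of_real l)) \<longlongrightarrow> 0) at_top"
    by (rule Lim_null_comparison[rotated]) (use ev in eventually_elim, use main in auto)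
  then show ?thesis by (simp add: LIM_zero_iff)
qed

text \<open>For heights in \<open>[t0, \<pi>/2 - t0]\<close> the point \<open>z = c cosh Y\<close> has modulus at least a multiple of
  \<open>exp |x|\<close>, which produces the decay of \<open>f(z)\<close>. The derivative of \<open>z\<close> has modulus at most
  \<open>c cosh x\<close>, so it remains to keep \<open>|z - l|\<close> above a multiple of \<open>cosh x\<close> that does not depend on
  \<open>l \<ge> l1\<close>: near the vertex of the hyperbola the real part of \<open>z\<close> stays below \<open>l1\<close>, and away from it
  the imaginary part of \<open>z\<close> is comparable with \<open>cosh x\<close>.\<close>

lemma contour_kernel_bound:
  assumes c: "0 < c" "c < l1" and t: "0 < t0" "t0 < pi / 4" and \<beta>: "0 < \<beta>"
  shows "\<exists>K>0. \<forall>l f A x y. l1 \<le> l \<longrightarrow> 0 \<le> A \<longrightarrow> (\<forall>z. 0 < Re z \<longrightarrow> cmod (f z) \<le> A * cmod z powr (- \<beta>)) \<longrightarrow>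
     t0 \<le> y \<longrightarrow> y \<le> pi / 2 - t0 \<longrightarrow> cmod (contour_kernel f c l (Complex x y)) \<le> A * K * exp (- \<beta> * \<bar>x\<bar>)"
proof -
  \<comment> \<open>Near the vertex means \<open>cosh x \<le> m\<close>; since \<open>1 < m\<close> and \<open>c m < l1\<close>, both cases leave a positive margin.\<close>
  define m where "m = (1 + l1 / c) / 2"
  have m: "1 < m" using c by (simp add: m_def)
  define s0 where "s0 = sin t0"
  have s0: "0 < s0" using t by (auto simp: s0_def intro!: sin_gt_zero)
  define \<kappa> where "\<kappa> = min ((l1 - c) / (2 * m)) (c * s0 * sqrt (1 - 1 / m\<^sup>2))"
  have m2: "1 / m\<^sup>2 < 1" using m by (simp add: field_simps)
  have \<kappa>: "0 < \<kappa>" using c m s0 m2 by (auto simp: \<kappa>_def)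
  define K where "K = (c / \<kappa>) * (c * s0 / 2) powr (- \<beta>)"
  have K: "0 < K" using c \<kappa> s0 by (simp add: K_def)
  show ?thesis
  proof (intro exI[of _ K] conjI allI impI K)
    fix l f A x y
    assume l: "l1 \<le> l" and A: "0 \<le> A" and fb: "\<forall>z. 0 < Re z \<longrightarrow> cmod (f z) \<le> A * cmod z powr (- \<beta>)"
      and y: "t0 \<le> y" "y \<le> pi / 2 - t0"
    let ?z = "cosh_path c (Complex x y)"
    have y2: "0 < y" "y < pi / 2" using y t by auto
    have siny: "s0 \<le> sin y" unfolding s0_def using y t y2 by (intro sin_monotone_2pi_le) auto
    have cosy: "s0 \<le> cos y"
      using sin_monotone_2pi_le[of t0 "pi / 2 - y"] y t y2 by (simp add: s0_def cos_sin_eq)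
    have ch: "1 \<le> cosh x" by (rule cosh_real_ge_1)
    have Rez: "c * s0 * cosh x \<le> Re ?z" unfolding cosh_path_parts
      using cosy ch c by (simp add: mult.assoc mult.commute[of s0] mult_left_mono)
    have Rez0: "0 < Re ?z" using cosh_path_Re_pos[OF c(1)] y2 by simp
    have "exp \<bar>x\<bar> / 2 \<le> cosh x" by (cases "x \<ge> 0") (auto simp: cosh_def)
    then have "c * s0 * (exp \<bar>x\<bar> / 2) \<le> c * s0 * cosh x" using c s0 by (intro mult_left_mono) auto
    also note Rez
    also have "Re ?z \<le> cmod ?z" by (rule complex_Re_le_cmod)
    finally have zge: "(c * s0 / 2) * exp \<bar>x\<bar> \<le> cmod ?z" by simp
    have fz: "cmod (f ?z) \<le> A * ((c * s0 / 2) powr (- \<beta>) * exp (- \<beta> * \<bar>x\<bar>))"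
    proof -
      have "cmod (f ?z) \<le> A * cmod ?z powr (- \<beta>)" using fb Rez0 by blast
      also have "\<dots> \<le> A * ((c * s0 / 2) * exp \<bar>x\<bar>) powr (- \<beta>)"
        using zge \<beta> A c s0 by (intro mult_left_mono powr_mono2') auto
      also have "((c * s0 / 2) * exp \<bar>x\<bar>) powr (- \<beta>) = (c * s0 / 2) powr (- \<beta>) * exp (- \<beta> * \<bar>x\<bar>)"
        using c s0 by (subst powr_mult) (auto simp: powr_def)
      finally show ?thesis .
    qed
    have dist: "\<kappa> * cosh x \<le> cmod (?z - of_real l)"
    proof (cases "cosh x \<le> m")
      case True
      have "(l1 - c) / (2 * m) * cosh x \<le> (l1 - c) / (2 * m) * m" using True c m by (intro mult_left_mono) auto
      also have "\<dots> = (l1 - c) / 2" using m by simp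
      also have "\<dots> = l1 - c * m" using c by (simp add: m_def field_simps)
      also have "\<dots> \<le> l - Re ?z"
      proof -
        have "c * cosh x * cos y \<le> c * m * 1" using True c ch cosy s0 by (intro mult_mono) auto
        then show ?thesis using l by (simp add: cosh_path_parts)
      qed
      also have "\<dots> \<le> cmod (?z - of_real l)"
        using abs_Re_le_cmod[of "?z - of_real l"] by simp
      finally have "(l1 - c) / (2 * m) * cosh x \<le> cmod (?z - of_real l)" .
      moreover have "\<kappa> * cosh x \<le> (l1 - c) / (2 * m) * cosh x" using ch by (intro mult_right_mono) (auto simp: \<kappa>_def)
      ultimately show ?thesis by linarith
    next
      case False
      have "1 / (cosh x)\<^sup>2 \<le> 1 / m\<^sup>2" using False m by (intro divide_left_mono power_mono) auto
      then have "(1 - 1 / m\<^sup>2) * (cosh x)\<^sup>2 \<le> (1 - 1 / (cosh x)\<^sup>2) * (cosh x)\<^sup>2" by (intro mult_right_mono) auto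
      also have "\<dots> = (cosh x)\<^sup>2 - 1" using ch by (simp add: left_diff_distrib)
      also have "\<dots> = (sinh x)\<^sup>2" using cosh_square_eq[of x] by simp
      finally have "sqrt ((1 - 1 / m\<^sup>2) * (cosh x)\<^sup>2) \<le> sqrt ((sinh x)\<^sup>2)" by (rule real_sqrt_le_mono)
      then have sh: "sqrt (1 - 1 / m\<^sup>2) * cosh x \<le> \<bar>sinh x\<bar>" by (simp add: real_sqrt_mult)
      have "\<kappa> * cosh x \<le> c * s0 * sqrt (1 - 1 / m\<^sup>2) * cosh x" using ch by (intro mult_right_mono) (auto simp: \<kappa>_def)
      also have "\<dots> = (c * s0) * (sqrt (1 - 1 / m\<^sup>2) * cosh x)" by simp
      also have "\<dots> \<le> (c * sin y) * \<bar>sinh x\<bar>"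
        using sh c s0 siny m2 ch by (intro mult_mono) auto
      also have "\<dots> = \<bar>Im (?z - of_real l)\<bar>" using c siny s0 by (simp add: cosh_path_parts abs_mult)
      also have "\<dots> \<le> cmod (?z - of_real l)" by (rule abs_Im_le_cmod)
      finally show ?thesis .
    qed
    have "cmod (contour_kernel f c l (Complex x y)) =
        cmod (f ?z) * (cmod (cosh_path' c (Complex x y)) / cmod (?z - of_real l)) / (2 * pi)"
      by (simp add: contour_kernel_def norm_mult norm_divide)
    also have "\<dots> \<le> cmod (f ?z) * (cmod (cosh_path' c (Complex x y)) / cmod (?z - of_real l)) / 1"
      using pi_gt3 by (intro divide_left_mono) auto
    also have "\<dots> \<le> (A * ((c * s0 / 2) powr (- \<beta>) * exp (- \<beta> * \<bar>x\<bar>))) * ((c * cosh x) / (\<kappa> * cosh x)) / 1"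
    proof (intro divide_right_mono mult_mono fz frac_le dist)
      show "cmod (cosh_path' c (Complex x y)) \<le> c * cosh x" using cosh_path'_norm_le c by simp
    qed (use A \<kappa> ch c in auto)
    also have "\<dots> = A * K * exp (- \<beta> * \<bar>x\<bar>)" using ch by (simp add: K_def)
    finally show "cmod (contour_kernel f c l (Complex x y)) \<le> A * K * exp (- \<beta> * \<bar>x\<bar>)" .
  qed
qed

text \<open>Each pair of additional nodes adds at most the increment of the bound, by \<open>1 + u \<le> exp u\<close>; the
  increments telescope.\<close>

lemma trapezoid_tail:
  fixes F :: "complex \<Rightarrow> complex"
  assumes k: "0 < k" and c: "0 < c" and M: "0 \<le> M"
    and bd: "\<And>x. cmod (F (of_real x)) \<le> M * exp (- c * \<bar>x\<bar>)" and n: "N \<le> n"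
  shows "cmod (of_real k * (\<Sum>j\<in>{-int n..int n}. F (of_real (of_int j * k))) - of_real k * (\<Sum>j\<in>{-int N..int N}. F (of_real (of_int j * k))))
     \<le> (2 * M / c) * (exp (- c * k * N) - exp (- c * k * n))"
  using n
proof (induction n rule: dec_induct)
  case base
  show ?case by simp
next
  case (step n)
  define S where "S = (\<lambda>n::nat. of_real k * (\<Sum>j\<in>{-int n..int n}. F (of_real (of_int j * k))))"
  define q where "q = exp (- c * k * real (Suc n))"
  have "{-int (Suc n)..int (Suc n)} = insert (- int (Suc n)) (insert (int (Suc n)) {-int n..int n})" by auto
  then have "S (Suc n) - S n = of_real k * F (of_real (- real (Suc n) * k)) + of_real k * F (of_real (real (Suc n) * k))"
    by (simp add: S_def algebra_simps)
  also have "cmod \<dots> \<le> k * (M * q) + k * (M * q)"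
    using bd[of "- real (Suc n) * k"] bd[of "real (Suc n) * k"] k
    by (intro order.trans[OF norm_triangle_ineq] add_mono) (auto simp: norm_mult q_def abs_mult mult_ac simp del: of_real_mult of_real_minus of_nat_Suc)
  also have "\<dots> = (2 * M / c) * (c * k * q)" using c by simp
  also have "\<dots> \<le> (2 * M / c) * (exp (- c * k * n) - q)"
  proof (intro mult_left_mono)
    have "c * k \<le> exp (c * k) - 1" using exp_ge_add_one_self[of "c * k"] by linarith
    then have "q * (c * k) \<le> q * (exp (c * k) - 1)" by (intro mult_left_mono) (auto simp: q_def)
    also have "\<dots> = exp (- c * k * n) - q"
      by (simp add: q_def right_diff_distrib flip: exp_add) (simp add: algebra_simps)
    finally show "c * k * q \<le> exp (- c * k * n) - q" by (simp add: mult_ac)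
  qed (use M c in auto)
  finally have "cmod (S (Suc n) - S n) \<le> (2 * M / c) * (exp (- c * k * n) - q)" .
  moreover have "cmod (S n - S N) \<le> (2 * M / c) * (exp (- c * k * N) - exp (- c * k * n))"
    using step.IH by (simp add: S_def)
  moreover have "cmod (S (Suc n) - S N) \<le> cmod (S (Suc n) - S n) + cmod (S n - S N)"
    using norm_triangle_ineq[of "S (Suc n) - S n" "S n - S N"] by simp
  moreover have "(2 * M / c) * (exp (- c * k * n) - q) + (2 * M / c) * (exp (- c * k * N) - exp (- c * k * n))
      = (2 * M / c) * (exp (- c * k * N) - q)"
    by (simp only: distrib_left[symmetric]) simp
  ultimately have "cmod (S (Suc n) - S N) \<le> (2 * M / c) * (exp (- c * k * N) - q)" by linarith
  then show ?case unfolding S_def q_def .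
qed

text \<open>The finite sum is compared with the sum up to \<open>n > N\<close>, that sum with the integral over
  \<open>[- R\<^sub>n, R\<^sub>n]\<close>, and the latter with \<open>f(l)\<close>; then \<open>n\<close> tends to infinity. With the given \<open>k\<close> and
  \<open>s = \<surd>(\<pi> d \<beta> N)\<close> the truncation error is of order \<open>exp(- s)\<close> and the trapezoid error of order
  \<open>exp(- 2 s)\<close>.\<close>

theorem sinc_quadrature_bound:
  fixes \<beta> :: real
  assumes c: "0 < c" "c < l1" and d: "0 < d" "d < pi / 4" and \<beta>: "0 < \<beta>"
  shows "\<exists>C\<ge>0. \<forall>l f A (N::nat) k. l1 \<le> l \<longrightarrow> f holomorphic_on {z. 0 < Re z} \<longrightarrow> 0 \<le> A \<longrightarrow>
     (\<forall>z. 0 < Re z \<longrightarrow> cmod (f z) \<le> A * cmod z powr (- \<beta>)) \<longrightarrow> 0 < N \<longrightarrow> k = sqrt (pi * d / (\<beta> * N)) \<longrightarrow>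
     cmod (f (of_real l) - of_real k * (\<Sum>j\<in>{-int N..int N}. contour_kernel f c l (Complex (of_int j * k) (pi / 4))))
      \<le> C * A * exp (- sqrt (pi * d * \<beta> * N))"
proof -
  obtain K where K: "0 < K" and Kb: "\<And>l f A x y. l1 \<le> l \<Longrightarrow> 0 \<le> A \<Longrightarrow> (\<forall>z. 0 < Re z \<longrightarrow> cmod (f z) \<le> A * cmod z powr (- \<beta>)) \<Longrightarrow>
     pi / 4 - d \<le> y \<Longrightarrow> y \<le> pi / 2 - (pi / 4 - d) \<Longrightarrow> cmod (contour_kernel f c l (Complex x y)) \<le> A * K * exp (- \<beta> * \<bar>x\<bar>)"
    using contour_kernel_bound[OF c, of "pi / 4 - d" \<beta>] d \<beta> by auto
  \<comment> \<open>The value of \<open>\<epsilon> = exp(- 2 \<pi> d/k)\<close> for \<open>N = 1\<close>, which bounds \<open>1 - \<epsilon>\<close> away from 0 for all \<open>N\<close>.\<close>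
  define \<epsilon>0 where "\<epsilon>0 = exp (- 2 * sqrt (pi * d * \<beta>))"
  have \<epsilon>0: "\<epsilon>0 < 1" using d \<beta> by (simp add: \<epsilon>0_def)
  define C where "C = 2 * K / \<beta> + (4 * K / \<beta>) / (1 - \<epsilon>0)"
  have C: "0 \<le> C" using K \<beta> \<epsilon>0 by (auto simp: C_def intro!: add_nonneg_nonneg divide_nonneg_nonneg)
  show ?thesis
  proof (intro exI[of _ C] conjI C allI impI)
    fix l f A k and N :: nat
    assume l: "l1 \<le> l" and f: "f holomorphic_on {z. 0 < Re z}" and A: "0 \<le> A"
      and fb: "\<forall>z. 0 < Re z \<longrightarrow> cmod (f z) \<le> A * cmod z powr (- \<beta>)" and N: "0 < N"
      and kdef: "k = sqrt (pi * d / (\<beta> * N))"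
    have cl: "c < l" using c l by simp
    \<comment> \<open>The line at height \<open>\<pi>/4\<close> is moved to the real axis.\<close>
    define F where "F = (\<lambda>w. contour_kernel f c l (w + \<i> * of_real (pi / 4)))"
    define M where "M = A * K"
    have M: "0 \<le> M" using A K by (simp add: M_def)
    have Feq: "F (Complex x y) = contour_kernel f c l (Complex x (y + pi / 4))" for x y
    proof -
      have "Complex x y + \<i> * of_real (pi / 4) = Complex x (y + pi / 4)" by (simp add: complex_eq_iff)
      then show ?thesis by (simp add: F_def)
    qed
    have k: "0 < k" using d \<beta> N by (simp add: kdef)
    define s where "s = sqrt (pi * d * \<beta> * N)"
    have s1: "\<beta> * k * N = s"
    proof (rule power2_eq_imp_eq)
      show "(\<beta> * k * N)\<^sup>2 = s\<^sup>2" using d \<beta> N by (simp add: s_def kdef power_mult_distrib) (simp add: power2_eq_square field_simps)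
    qed (use d \<beta> k in \<open>auto simp: s_def\<close>)
    have s2: "2 * pi * d / k = 2 * s"
    proof -
      have "k\<^sup>2 = pi * d / (\<beta> * N)" using d \<beta> N by (simp add: kdef)
      then have "\<beta> * k * N * k = pi * d" using \<beta> N by (simp add: power2_eq_square field_simps)
      then show ?thesis using k unfolding s1[symmetric] by (simp add: field_simps)
    qed
    define \<epsilon> where "\<epsilon> = exp (- (2 * pi * d / k))"
    have \<epsilon>s: "\<epsilon> = exp (- s) * exp (- s)" unfolding \<epsilon>_def s2 by (simp flip: exp_add)
    have s: "sqrt (pi * d * \<beta>) \<le> s"
    proof -
      have "pi * d * \<beta> * 1 \<le> pi * d * \<beta> * N" using N d \<beta> by (intro mult_left_mono) auto
      then show ?thesis by (simp add: s_def)
    qed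
    then have \<epsilon>le: "\<epsilon> \<le> \<epsilon>0" by (simp add: \<epsilon>_def s2 \<epsilon>0_def)
    have \<epsilon>b: "\<epsilon> / (1 - \<epsilon>) \<le> exp (- s) / (1 - \<epsilon>0)"
    proof (intro frac_le)
      have "0 \<le> s" using d \<beta> by (simp add: s_def)
      then show "\<epsilon> \<le> exp (- s)" unfolding \<epsilon>s by (simp add: mult_le_cancel_left1)
    qed (use \<epsilon>0 \<epsilon>le in auto)
    define S where "S = (\<lambda>n::nat. of_real k * (\<Sum>j\<in>{-int n..int n}. F (of_real (of_int j * k))))"
    have Fhol: "F holomorphic_on hstrip (pi / 4)"
      unfolding F_def
    proof (rule holomorphic_on_compose_gen[unfolded o_def, where g = "contour_kernel f c l"])
      let ?A = "{Y. 0 < Im Y \<and> Im Y < pi / 2}"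
      show "contour_kernel f c l holomorphic_on ?A"
      proof (rule contour_kernel_holomorphic(2)[OF f c(1) cl])
        fix Y assume Y: "Y \<in> ?A"
        then show "cosh_path c Y \<noteq> of_real l"
          using cosh_path_eq_real_iff[OF c(1) cl, of "Im Y" "Re Y"] by auto
      qed (auto simp: hstrip_def)
      show "(\<lambda>w. w + \<i> * of_real (pi / 4)) ` hstrip (pi / 4) \<subseteq> ?A"
        by (auto simp: hstrip_def abs_less_iff)
    qed (auto intro!: holomorphic_intros)
    have Fb: "cmod (F (Complex x y)) \<le> M * exp (- \<beta> * \<bar>x\<bar>)" if "\<bar>y\<bar> \<le> d" for x y
      unfolding Feq M_def using that by (intro Kb l A fb) auto
    have Fb0: "cmod (F (of_real x)) \<le> M * exp (- \<beta> * \<bar>x\<bar>)" for x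
      using Fb[of 0 x] d by (simp add: complex_of_real_def)
    define R where "R = (\<lambda>n. (real n + 1/2) * k)"
    have h: "hline F 0 r = hline (contour_kernel f c l) (pi / 4) r" for r
      by (simp add: hline_def Feq)
    have Rtop: "filterlim R at_top sequentially"
    proof -
      have "filterlim (\<lambda>n. 1/2 + real n) at_top sequentially"
        by (rule filterlim_tendsto_add_at_top[OF tendsto_const filterlim_real_sequentially])
      from filterlim_tendsto_pos_mult_at_top[OF tendsto_const k this]
      show ?thesis by (simp add: R_def mult.commute add.commute)
    qed
    have lim: "(\<lambda>n. hline F 0 (R n)) \<longlonglongrightarrow> f (of_real l)"
      unfolding h by (rule filterlim_compose[OF contour_formula[OF f fb[rule_format] A \<beta> c(1) cl] Rtop])
    let ?B = "\<lambda>n. (2 * M / \<beta>) * exp (- s) + ((4 * M / \<beta>) * (exp (- s) / (1 - \<epsilon>0)) + 6 * d * (M * exp (- \<beta> * R n)))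
         + cmod (hline F 0 (R n) - f (of_real l))"
    have ev: "cmod (f (of_real l) - S N) \<le> ?B n" if "N \<le> n" for n
    proof -
      have "cmod (S n - S N) \<le> (2 * M / \<beta>) * (exp (- \<beta> * k * N) - exp (- \<beta> * k * n))"
        unfolding S_def by (rule trapezoid_tail[OF k \<beta> M Fb0 that])
      also have "\<dots> \<le> (2 * M / \<beta>) * exp (- s)"
        using M \<beta> s1 by (intro mult_left_mono) (auto simp: s1[symmetric])
      finally have 1: "cmod (S n - S N) \<le> (2 * M / \<beta>) * exp (- s)" .
      have "cmod (S n - hline F 0 (R n)) \<le> (4 * M / \<beta>) * (\<epsilon> / (1 - \<epsilon>)) + 6 * d * (M * exp (- \<beta> * R n))"
        unfolding S_def R_def \<epsilon>_def by (rule trapezoid_finite_rectangle[OF Fhol d k \<beta> M Fb])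
      also have "\<dots> \<le> (4 * M / \<beta>) * (exp (- s) / (1 - \<epsilon>0)) + 6 * d * (M * exp (- \<beta> * R n))"
        using M \<beta> \<epsilon>b by (intro add_right_mono mult_left_mono) auto
      finally have 2: "cmod (S n - hline F 0 (R n)) \<le> (4 * M / \<beta>) * (exp (- s) / (1 - \<epsilon>0)) + 6 * d * (M * exp (- \<beta> * R n))" .
      have "cmod (f (of_real l) - S N) \<le> cmod (S n - S N) + cmod (S n - hline F 0 (R n)) + cmod (hline F 0 (R n) - f (of_real l))"
      proof -
        have "f (of_real l) - S N = (S n - S N) - (S n - hline F 0 (R n)) - (hline F 0 (R n) - f (of_real l))" by simp
        then show ?thesis
          using norm_triangle_ineq4[of "(S n - S N) - (S n - hline F 0 (R n))" "hline F 0 (R n) - f (of_real l)"]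
            norm_triangle_ineq4[of "S n - S N" "S n - hline F 0 (R n)"] by simp
      qed
      then show ?thesis using 1 2 by linarith
    qed
    have "(\<lambda>n. exp (- \<beta> * R n)) \<longlonglongrightarrow> 0"
    proof (rule filterlim_compose[OF exp_at_bot])
      have "filterlim (\<lambda>n. \<beta> * R n) at_top sequentially"
        by (rule filterlim_tendsto_pos_mult_at_top[OF tendsto_const \<beta> Rtop])
      then show "filterlim (\<lambda>n. - \<beta> * R n) at_bot sequentially"
        by (simp add: filterlim_uminus_at_bot)
    qed
    moreover have "(\<lambda>n. cmod (hline F 0 (R n) - f (of_real l))) \<longlonglongrightarrow> 0"
      using tendsto_norm[OF LIM_zero[OF lim]] by simp
    ultimately have "?B \<longlonglongrightarrow> (2 * M / \<beta>) * exp (- s) + ((4 * M / \<beta>) * (exp (- s) / (1 - \<epsilon>0)) + 6 * d * (M * 0)) + 0"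
      by (intro tendsto_intros)
    then have "cmod (f (of_real l) - S N) \<le> (2 * M / \<beta>) * exp (- s) + ((4 * M / \<beta>) * (exp (- s) / (1 - \<epsilon>0)) + 6 * d * (M * 0)) + 0"
      by (rule LIMSEQ_le_const) (use ev in blast)
    also have "\<dots> = C * A * exp (- s)" by (simp add: C_def M_def algebra_simps)
    finally have "cmod (f (of_real l) - S N) \<le> C * A * exp (- s)" .
    moreover have "S N = of_real k * (\<Sum>j\<in>{-int N..int N}. contour_kernel f c l (Complex (of_int j * k) (pi / 4)))"
      unfolding S_def complex_of_real_def Feq by simp
    ultimately show "cmod (f (of_real l) - of_real k * (\<Sum>j\<in>{-int N..int N}. contour_kernel f c l (Complex (of_int j * k) (pi / 4))))
      \<le> C * A * exp (- sqrt (pi * d * \<beta> * N))" by (simp add: s_def)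
  qed
qed

section \<open>The error for a single eigenvalue\<close>

text \<open>The argument of \<open>z\<^sup>\<beta>\<close> is at most \<open>\<beta> \<pi>/2 < \<pi>/2\<close> in modulus.\<close>

lemma Re_powr_ge:
  assumes "0 < Re z" "0 < \<beta>" "\<beta> < 1"
  shows "cos (\<beta> * pi / 2) * cmod z powr \<beta> \<le> Re (z powr of_real \<beta>)"
proof -
  have z: "z \<noteq> 0" using assms by auto
  have A: "\<bar>Arg z\<bar> < pi / 2" using Re_Ln_pos_lt[OF z] assms(1) z by (simp add: Arg_eq_Im_Ln)
  have "Re (z powr of_real \<beta>) = cmod z powr \<beta> * cos (\<beta> * Arg z)"
    using z by (simp add: powr_def Re_exp Ln_Arg mult.commute)
  moreover have "cos (\<beta> * pi / 2) \<le> cos \<bar>\<beta> * Arg z\<bar>"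
  proof (rule cos_monotone_0_pi_le)
    have "\<beta> * \<bar>Arg z\<bar> \<le> \<beta> * (pi / 2)" using A assms by (intro mult_left_mono) auto
    then show "\<bar>\<beta> * Arg z\<bar> \<le> \<beta> * pi / 2" using assms by (simp add: abs_mult)
    have "\<beta> * pi \<le> 1 * pi" using assms by (intro mult_right_mono) auto
    then show "\<beta> * pi / 2 \<le> pi" using pi_gt_zero by linarith
  qed auto
  ultimately show ?thesis by (simp add: mult.commute mult_left_mono)
qed

text \<open>The quadrature bound for \<open>f(z) = e\<^sub>\<gamma>\<^sub>,\<^sub>1(- t\<^sup>\<gamma> z\<^sup>\<beta>)\<close>. The factor \<open>t\<^sup>-\<^sup>\<gamma>\<close> enters through the bound
  \<open>|f(z)| \<le> \<Gamma>(\<gamma> + 1) / Re(t\<^sup>\<gamma> z\<^sup>\<beta>)\<close> alone, so the remaining constant does not depend on \<open>t\<close>.\<close>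

theorem scalar_quadrature_error:
  fixes \<gamma> \<beta> b d l1 :: real
  assumes \<gamma>: "0 < \<gamma>" "\<gamma> < 1" and \<beta>: "0 < \<beta>" "\<beta> < 1" and b: "0 < b" "b < l1 / sqrt 2" and d: "0 < d" "d < pi / 4"
  shows "\<exists>C\<ge>0. \<forall>l (N::nat) k t. l1 \<le> l \<longrightarrow> 0 < N \<longrightarrow> k = sqrt (pi * d / (\<beta> * N)) \<longrightarrow> 0 < t \<longrightarrow>
     cmod (mittag_leffler \<gamma> 1 (of_real (- (t powr \<gamma> * l powr \<beta>))) -
       (- (of_real k / (2 * of_real pi * \<i>))) * (\<Sum>j\<in>{-int N..int N}.
          mittag_leffler \<gamma> 1 (- (of_real (t powr \<gamma>) * sinc_contour b (of_int j * k) powr of_real \<beta>)) *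
          vector_derivative (sinc_contour b) (at (of_int j * k)) * inverse (sinc_contour b (of_int j * k) - of_real l)))
      \<le> C * t powr (- \<gamma>) * exp (- sqrt (pi * d * \<beta> * N))"
proof -
  define c where "c = sqrt 2 * b"
  have c: "0 < c" "c < l1" using b by (auto simp: c_def field_simps)
  define q where "q = cos (\<beta> * pi / 2)"
  have q: "0 < q" unfolding q_def
  proof (rule cos_gt_zero_pi)
    have "\<beta> * pi < 1 * pi" using \<beta> by (intro mult_strict_right_mono) auto
    then show "\<beta> * pi / 2 < pi / 2" by simp
    have "0 < \<beta> * pi" using \<beta> by simp
    then show "- (pi / 2) < \<beta> * pi / 2" using pi_gt_zero by linarith
  qed
  have G: "0 < Gamma (\<gamma> + 1)" using \<gamma> by (intro Gamma_real_pos) auto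
  obtain C where C: "0 \<le> C" and Cb: "\<And>l f A (N::nat) k. l1 \<le> l \<Longrightarrow> f holomorphic_on {z. 0 < Re z} \<Longrightarrow> 0 \<le> A \<Longrightarrow>
     (\<forall>z. 0 < Re z \<longrightarrow> cmod (f z) \<le> A * cmod z powr (- \<beta>)) \<Longrightarrow> 0 < N \<Longrightarrow> k = sqrt (pi * d / (\<beta> * N)) \<Longrightarrow>
     cmod (f (of_real l) - of_real k * (\<Sum>j\<in>{-int N..int N}. contour_kernel f c l (Complex (of_int j * k) (pi / 4))))
      \<le> C * A * exp (- sqrt (pi * d * \<beta> * N))"
    using sinc_quadrature_bound[OF c d \<beta>(1)] by blast
  show ?thesis
  proof (intro exI[of _ "C * (Gamma (\<gamma> + 1) / q)"] conjI allI impI)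
    show "0 \<le> C * (Gamma (\<gamma> + 1) / q)" using C G q by simp
    fix l k t :: real and N :: nat
    assume l: "l1 \<le> l" and N: "0 < N" and k: "k = sqrt (pi * d / (\<beta> * N))" and t: "0 < t"
    define f where "f = (\<lambda>z. mittag_leffler \<gamma> 1 (- (of_real (t powr \<gamma>) * z powr of_real \<beta>)))"
    define A where "A = Gamma (\<gamma> + 1) / q * t powr (- \<gamma>)"
    have f: "f holomorphic_on {z. 0 < Re z}"
      unfolding f_def
      by (rule holomorphic_on_compose_gen[unfolded o_def, OF _ mittag_leffler_holomorphic[OF \<gamma>(1), of UNIV]])
         (auto intro!: holomorphic_intros simp: complex_nonpos_Reals_iff)
    have fb: "cmod (f z) \<le> A * cmod z powr (- \<beta>)" if z: "0 < Re z" for z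
    proof -
      let ?w = "of_real (t powr \<gamma>) * z powr of_real \<beta>"
      have cz: "0 < cmod z" using z by auto
      have R: "t powr \<gamma> * (q * cmod z powr \<beta>) \<le> Re ?w"
        using Re_powr_ge[OF z \<beta>] t by (simp add: q_def mult_left_mono)
      have pos: "0 < t powr \<gamma> * (q * cmod z powr \<beta>)" using q cz t by simp
      have "cmod (f z) \<le> Gamma (\<gamma> + 1) / Re ?w"
        unfolding f_def using R pos by (intro mittag_leffler_bound \<gamma>) linarith
      also have "\<dots> \<le> Gamma (\<gamma> + 1) / (t powr \<gamma> * (q * cmod z powr \<beta>))"
        using R pos G by (intro divide_left_mono) auto
      also have "\<dots> = A * cmod z powr (- \<beta>)"
        using q t cz by (simp add: A_def powr_minus field_simps)
      finally show ?thesis .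
    qed
    have A: "0 \<le> A" using G q by (simp add: A_def)
    have fl: "f (of_real l) = mittag_leffler \<gamma> 1 (of_real (- (t powr \<gamma> * l powr \<beta>)))"
      using c l by (simp add: f_def powr_of_real)
    have v: "vector_derivative (sinc_contour b) (at y) = cosh_path' c (Complex y (pi / 4))" for y
      unfolding c_def by (rule vector_derivative_at[OF sinc_contour_eq_cosh_path(2)])
    have alg: "K * ((- (F * V) / W) / D) = (- (K / W)) * (F * V * inverse D)" for K F V W D :: complex
      by (simp add: divide_inverse mult_ac)
    have "of_real k * (\<Sum>j\<in>{-int N..int N}. contour_kernel f c l (Complex (of_int j * k) (pi / 4))) =
       (- (of_real k / (2 * of_real pi * \<i>))) * (\<Sum>j\<in>{-int N..int N}.
          mittag_leffler \<gamma> 1 (- (of_real (t powr \<gamma>) * sinc_contour b (of_int j * k) powr of_real \<beta>)) *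
          vector_derivative (sinc_contour b) (at (of_int j * k)) * inverse (sinc_contour b (of_int j * k) - of_real l))"
      unfolding sum_distrib_left v sinc_contour_eq_cosh_path(1) c_def[symmetric]
      by (intro sum.cong refl) (simp only: contour_kernel_def f_def alg of_real_mult of_real_numeral)
    then show "cmod (mittag_leffler \<gamma> 1 (of_real (- (t powr \<gamma> * l powr \<beta>))) -
       (- (of_real k / (2 * of_real pi * \<i>))) * (\<Sum>j\<in>{-int N..int N}.
          mittag_leffler \<gamma> 1 (- (of_real (t powr \<gamma>) * sinc_contour b (of_int j * k) powr of_real \<beta>)) *
          vector_derivative (sinc_contour b) (at (of_int j * k)) * inverse (sinc_contour b (of_int j * k) - of_real l)))
      \<le> C * (Gamma (\<gamma> + 1) / q) * t powr (- \<gamma>) * exp (- sqrt (pi * d * \<beta> * N))"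
      using Cb[OF l f A _ N k] fb fl by (simp add: A_def mult.assoc)
  qed
qed

section \<open>Positive semidefinite forms\<close>

interpretation cfun: vector_space "cscale :: complex \<Rightarrow> 'n::finite cfun \<Rightarrow> 'n cfun"
  by (rule vector_space_cscale)

lemma cscale_apply [simp]: "cscale c v x = c * v x" by (simp add: cscale_def)

text \<open>Degenerate forms are allowed: elements of the function spaces are representatives, and the form
  \<open>a - \<mu> (\<cdot>, \<cdot>)\<close> at the bottom \<open>\<mu>\<close> of the spectrum vanishes on the eigenfunctions of \<open>\<mu>\<close>.\<close>

definition psd_on :: "'n::finite cfun set \<Rightarrow> ('n cfun \<Rightarrow> 'n cfun \<Rightarrow> complex) \<Rightarrow> bool" where
  "psd_on V B \<longleftrightarrow> cfun.subspace V \<and> sesquilinear_on V B \<and> hermitian_on V B \<and> (\<forall>v\<in>V. 0 \<le> Re (B v v))"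

lemma sesquilinear_onD:
  assumes "sesquilinear_on V B" "u \<in> V" "v \<in> V" "w \<in> V"
  shows "B (u + v) w = B u w + B v w" "B w (u + v) = B w u + B w v"
    "B (cscale c v) w = c * B v w" "B v (cscale c w) = cnj c * B v w"
  using assms unfolding sesquilinear_on_def by simp_all

lemma sesquilinear_expand:
  assumes V: "cfun.subspace V" and B: "sesquilinear_on V B" "hermitian_on V B" and vw: "v \<in> V" "w \<in> V"
  shows "Re (B (v + cscale c w) (v + cscale c w)) = Re (B v v) + 2 * Re (cnj c * B v w) + (cmod c)\<^sup>2 * Re (B w w)"
proof -
  have cw: "cscale c w \<in> V" by (rule cfun.subspace_scale[OF V vw(2)])
  have s: "v + cscale c w \<in> V" by (rule cfun.subspace_add[OF V vw(1) cw])
  have h: "B w v = cnj (B v w)" using B(2) vw unfolding hermitian_on_def by blast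
  have "B (v + cscale c w) (v + cscale c w) = B v v + cnj c * B v w + (c * B w v + c * (cnj c * B w w))"
    unfolding sesquilinear_onD(1)[OF B(1) vw(1) cw s] sesquilinear_onD(2)[OF B(1) vw(1) cw vw(1)]
      sesquilinear_onD(2)[OF B(1) vw(1) cw cw] sesquilinear_onD(3)[OF B(1) vw(2) vw(2) vw(1)]
      sesquilinear_onD(3)[OF B(1) vw(2) vw(2) cw] sesquilinear_onD(4)[OF B(1) vw(1) vw(1) vw(2)]
      sesquilinear_onD(4)[OF B(1) vw(2) vw(2) vw(2)] by (simp only: distrib_left)
  also have "c * B w v = cnj (cnj c * B v w)" by (simp add: h)
  also have "c * (cnj c * B w w) = of_real ((cmod c)\<^sup>2) * B w w"
    by (simp only: mult.assoc[symmetric] complex_norm_square[symmetric])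
  finally have e: "B (v + cscale c w) (v + cscale c w) = B v v + cnj c * B v w + (cnj (cnj c * B v w) + of_real ((cmod c)\<^sup>2) * B w w)" .
  show ?thesis unfolding e by simp
qed

text \<open>Positivity at \<open>v - r B(v, w) w\<close> for real \<open>r\<close>. In the degenerate case \<open>B(w, w) = 0\<close> the expression is
  affine in \<open>r\<close>, and a large \<open>r\<close> forces \<open>B(v, w) = 0\<close>.\<close>

lemma psd_Cauchy_Schwarz:
  assumes "psd_on V B" and vw: "v \<in> V" "w \<in> V"
  shows "(cmod (B v w))\<^sup>2 \<le> Re (B v v) * Re (B w w)"
proof -
  have V: "cfun.subspace V" and B: "sesquilinear_on V B" "hermitian_on V B" and pos: "\<And>v. v \<in> V \<Longrightarrow> 0 \<le> Re (B v v)"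
    using assms by (auto simp: psd_on_def)
  define z where "z = B v w"
  define P where "P = Re (B v v)"
  define Q where "Q = Re (B w w)"
  have PQ: "0 \<le> P" "0 \<le> Q" using pos vw by (auto simp: P_def Q_def)
  have main: "0 \<le> P - 2 * r * (cmod z)\<^sup>2 + r\<^sup>2 * (cmod z)\<^sup>2 * Q" for r
  proof -
    let ?c = "- of_real r * z"
    have "0 \<le> Re (B (v + cscale ?c w) (v + cscale ?c w))"
      by (intro pos cfun.subspace_add[OF V] cfun.subspace_scale[OF V] vw)
    also have "\<dots> = P + 2 * Re (cnj ?c * z) + (cmod ?c)\<^sup>2 * Q"
      unfolding sesquilinear_expand[OF V B vw] P_def Q_def z_def ..
    also have "cnj ?c * z = of_real (- r * (cmod z)\<^sup>2)"
    proof -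
      have "cnj ?c * z = - of_real r * (z * cnj z)"
        by (simp only: complex_cnj_mult complex_cnj_minus complex_cnj_complex_of_real mult.assoc mult.commute[of z])
      also have "z * cnj z = of_real ((cmod z)\<^sup>2)" by (rule complex_norm_square[symmetric])
      finally show ?thesis by (simp only: of_real_mult of_real_minus)
    qed
    also have "(cmod ?c)\<^sup>2 = r\<^sup>2 * (cmod z)\<^sup>2" by (simp add: norm_mult power_mult_distrib)
    finally show ?thesis by (simp only: Re_complex_of_real)
  qed
  have "(cmod z)\<^sup>2 \<le> P * Q"
  proof (cases "Q = 0")
    case True
    have "z = 0"
    proof (rule ccontr)
      assume "z \<noteq> 0"
      then have X: "0 < (cmod z)\<^sup>2" by simp
      have "2 * ((P + 1) / (2 * (cmod z)\<^sup>2)) * (cmod z)\<^sup>2 = P + 1"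
        using X by simp
      moreover have "((P + 1) / (2 * (cmod z)\<^sup>2))\<^sup>2 * (cmod z)\<^sup>2 * Q = 0" by (simp only: True mult_zero_right)
      ultimately show False using main[of "(P + 1) / (2 * (cmod z)\<^sup>2)"] by linarith
    qed
    then show ?thesis using PQ by simp
  next
    case False
    then have "0 < Q" using PQ by simp
    then have "(1 / Q)\<^sup>2 * (cmod z)\<^sup>2 * Q = (cmod z)\<^sup>2 / Q" by (simp add: power2_eq_square)
    moreover have "2 * (1 / Q) * (cmod z)\<^sup>2 = 2 * ((cmod z)\<^sup>2 / Q)" by simp
    ultimately have "(cmod z)\<^sup>2 / Q \<le> P" using main[of "1 / Q"] by linarith
    then show ?thesis using \<open>0 < Q\<close> by (simp only: pos_divide_le_eq)
  qed
  then show ?thesis unfolding z_def P_def Q_def .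
qed

text \<open>This turns a minimiser of a Rayleigh quotient into a solution of the eigenvalue equation.\<close>

lemma psd_null:
  assumes "psd_on V B" "v \<in> V" "w \<in> V" "Re (B v v) = 0"
  shows "B v w = 0"
  using psd_Cauchy_Schwarz[OF assms(1-3)] assms(4) by simp

lemma psd_Cauchy_Schwarz_sqrt:
  assumes "psd_on V B" and vw: "v \<in> V" "w \<in> V"
  shows "cmod (B v w) \<le> sqrt (Re (B v v)) * sqrt (Re (B w w))"
  using real_sqrt_le_mono[OF psd_Cauchy_Schwarz[OF assms]] by (simp add: real_sqrt_mult)

lemma psd_triangle:
  assumes "psd_on V B" and vw: "v \<in> V" "w \<in> V"
  shows "sqrt (Re (B (v + w) (v + w))) \<le> sqrt (Re (B v v)) + sqrt (Re (B w w))"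
proof -
  have V: "cfun.subspace V" and B: "sesquilinear_on V B" "hermitian_on V B" and pos: "\<And>v. v \<in> V \<Longrightarrow> 0 \<le> Re (B v v)"
    using assms by (auto simp: psd_on_def)
  have "v + w = v + cscale 1 w" by (simp add: fun_eq_iff)
  then have "Re (B (v + w) (v + w)) = Re (B v v) + 2 * Re (B v w) + Re (B w w)"
    using sesquilinear_expand[OF V B vw, of 1] by simp
  also have "\<dots> \<le> (sqrt (Re (B v v)))\<^sup>2 + 2 * (sqrt (Re (B v v)) * sqrt (Re (B w w))) + (sqrt (Re (B w w)))\<^sup>2"
    using psd_Cauchy_Schwarz_sqrt[OF assms] complex_Re_le_cmod[of "B v w"] pos vw by simp
  also have "\<dots> = (sqrt (Re (B v v)) + sqrt (Re (B w w)))\<^sup>2" by (simp add: power2_sum)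
  finally have "sqrt (Re (B (v + w) (v + w))) \<le> sqrt ((sqrt (Re (B v v)) + sqrt (Re (B w w)))\<^sup>2)"
    by (rule real_sqrt_le_mono)
  also have "\<dots> = sqrt (Re (B v v)) + sqrt (Re (B w w))" using pos vw by simp
  finally show ?thesis .
qed

section \<open>Square integrable functions\<close>

lemma L2_integrable_mult:
  assumes "v \<in> L2 \<Omega>" "w \<in> L2 \<Omega>"
  shows "integrable (lebesgue_on \<Omega>) (\<lambda>x. v x * w x)" "integrable (lebesgue_on \<Omega>) (\<lambda>x. v x * cnj (w x))"
proof -
  have m[measurable]: "v \<in> borel_measurable (lebesgue_on \<Omega>)" "w \<in> borel_measurable (lebesgue_on \<Omega>)"
    and i: "integrable (lebesgue_on \<Omega>) (\<lambda>x. (cmod (v x))\<^sup>2)" "integrable (lebesgue_on \<Omega>) (\<lambda>x. (cmod (w x))\<^sup>2)"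
    using assms unfolding L2_def by blast+
  have b: "cmod (v x) * cmod (w x) \<le> (cmod (v x))\<^sup>2 + (cmod (w x))\<^sup>2" for x
    using sum_squares_bound[of "cmod (v x)" "cmod (w x)"] mult_nonneg_nonneg[OF norm_ge_zero norm_ge_zero, of "v x" "w x"]
    by (simp only: mult.assoc)
  have [measurable]: "(\<lambda>x. cnj (w x)) \<in> borel_measurable (lebesgue_on \<Omega>)"
    by (rule measurable_compose[OF m(2)]) (intro borel_measurable_continuous_onI continuous_intros)
  show "integrable (lebesgue_on \<Omega>) (\<lambda>x. v x * w x)" "integrable (lebesgue_on \<Omega>) (\<lambda>x. v x * cnj (w x))"
    by (rule Bochner_Integration.integrable_bound[OF Bochner_Integration.integrable_add[OF i]], measurable,
        use b in \<open>auto simp: norm_mult\<close>)+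
qed

lemma L2_subspace: "cfun.subspace (L2 \<Omega>)"
proof (rule cfun.subspaceI)
  show "0 \<in> L2 \<Omega>" by (simp add: L2_def zero_fun_def)
  fix u v assume "u \<in> L2 \<Omega>" "v \<in> L2 \<Omega>"
  then have m[measurable]: "u \<in> borel_measurable (lebesgue_on \<Omega>)" "v \<in> borel_measurable (lebesgue_on \<Omega>)"
    and i: "integrable (lebesgue_on \<Omega>) (\<lambda>x. (cmod (u x))\<^sup>2)" "integrable (lebesgue_on \<Omega>) (\<lambda>x. (cmod (v x))\<^sup>2)"
    unfolding L2_def by blast+
  have b: "(cmod (u x + v x))\<^sup>2 \<le> 2 * (cmod (u x))\<^sup>2 + 2 * (cmod (v x))\<^sup>2" for x
  proof -
    have "(cmod (u x + v x))\<^sup>2 \<le> (cmod (u x) + cmod (v x))\<^sup>2" by (intro power_mono norm_triangle_ineq) auto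
    also have "\<dots> \<le> 2 * (cmod (u x))\<^sup>2 + 2 * (cmod (v x))\<^sup>2"
      using sum_squares_bound[of "cmod (u x)" "cmod (v x)"] by (simp add: power2_sum)
    finally show ?thesis .
  qed
  have "integrable (lebesgue_on \<Omega>) (\<lambda>x. (cmod (u x + v x))\<^sup>2)"
    by (rule Bochner_Integration.integrable_bound[OF Bochner_Integration.integrable_add[OF integrable_mult_right[OF i(1), of 2] integrable_mult_right[OF i(2), of 2]]])
       (use b in auto)
  then show "u + v \<in> L2 \<Omega>" by (auto simp: L2_def plus_fun_def)
next
  fix c and v :: "'a cfun" assume "v \<in> L2 \<Omega>"
  then show "cscale c v \<in> L2 \<Omega>" by (auto simp: L2_def cscale_def norm_mult power_mult_distrib)
qed

lemma L2_inner_self: "L2_inner \<Omega> v v = of_real ((L2_norm \<Omega> v)\<^sup>2)"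
proof -
  have "L2_inner \<Omega> v v = integral\<^sup>L (lebesgue_on \<Omega>) (\<lambda>x. of_real ((cmod (v x))\<^sup>2))"
    unfolding L2_inner_def by (simp only: complex_norm_square)
  also have "\<dots> = of_real (integral\<^sup>L (lebesgue_on \<Omega>) (\<lambda>x. (cmod (v x))\<^sup>2))" by (rule integral_complex_of_real)
  also have "\<dots> = of_real ((L2_norm \<Omega> v)\<^sup>2)" by (simp add: L2_norm_def)
  finally show ?thesis .
qed

lemma L2_norm_nonneg [simp]: "0 \<le> L2_norm \<Omega> v" by (simp add: L2_norm_def)

lemma L2_psd:
  fixes \<Omega> :: "(real^'n::finite) set"
  shows "psd_on (L2 \<Omega>) (L2_inner \<Omega>)"
  unfolding psd_on_def
proof (intro conjI L2_subspace ballI)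
  show "sesquilinear_on (L2 \<Omega>) (L2_inner \<Omega>)"
    unfolding sesquilinear_on_def L2_inner_def
  proof (intro conjI ballI allI)
    fix c and v w :: "'n cfun"
    have "(\<lambda>x. v x * cnj (cscale c w x)) = (\<lambda>x. cnj c * (v x * cnj (w x)))" by (simp add: fun_eq_iff)
    then show "(\<integral>x. v x * cnj (cscale c w x) \<partial>lebesgue_on \<Omega>) = cnj c * (\<integral>x. v x * cnj (w x) \<partial>lebesgue_on \<Omega>)"
      by simp
  qed (auto simp: distrib_right distrib_left L2_integrable_mult mult.assoc)
  show "hermitian_on (L2 \<Omega>) (L2_inner \<Omega>)"
    unfolding hermitian_on_def L2_inner_def
    by (simp add: mult.commute flip: Bochner_Integration.integral_cnj)
  show "0 \<le> Re (L2_inner \<Omega> v v)" for v by (simp add: L2_inner_self)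
qed

lemma L2_norm_eq: "sqrt (Re (L2_inner \<Omega> v v)) = L2_norm \<Omega> v"
  by (simp add: L2_inner_self)

lemma L2_Cauchy_Schwarz:
  "v \<in> L2 \<Omega> \<Longrightarrow> w \<in> L2 \<Omega> \<Longrightarrow> cmod (L2_inner \<Omega> v w) \<le> L2_norm \<Omega> v * L2_norm \<Omega> w"
  using psd_Cauchy_Schwarz_sqrt[OF L2_psd] by (simp only: L2_norm_eq)

lemma L2_triangle:
  "v \<in> L2 \<Omega> \<Longrightarrow> w \<in> L2 \<Omega> \<Longrightarrow> L2_norm \<Omega> (v + w) \<le> L2_norm \<Omega> v + L2_norm \<Omega> w"
  using psd_triangle[OF L2_psd] by (simp only: L2_norm_eq)

lemma L2_norm_cscale: "L2_norm \<Omega> (cscale c v) = cmod c * L2_norm \<Omega> v"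
  by (simp add: L2_norm_def norm_mult power_mult_distrib real_sqrt_mult)

lemma L2_diff: "v \<in> L2 \<Omega> \<Longrightarrow> w \<in> L2 \<Omega> \<Longrightarrow> v - w \<in> L2 \<Omega>"
  by (rule cfun.subspace_diff[OF L2_subspace])

lemma L2_norm_AE_cong:
  assumes "v \<in> L2 \<Omega>" "w \<in> borel_measurable (lebesgue_on \<Omega>)" "AE x in lebesgue_on \<Omega>. v x = w x"
  shows "L2_norm \<Omega> w = L2_norm \<Omega> v" "w \<in> L2 \<Omega>"
proof -
  have v[measurable]: "v \<in> borel_measurable (lebesgue_on \<Omega>)" using assms by (simp add: L2_def)
  note assms(2)[measurable]
  show "L2_norm \<Omega> w = L2_norm \<Omega> v"
    unfolding L2_norm_def by (intro arg_cong[where f=sqrt] integral_cong_AE) (use assms(3) in auto)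
  have "integrable (lebesgue_on \<Omega>) (\<lambda>x. (cmod (w x))\<^sup>2) = integrable (lebesgue_on \<Omega>) (\<lambda>x. (cmod (v x))\<^sup>2)"
    by (intro integrable_cong_AE) (use assms(3) in auto)
  then show "w \<in> L2 \<Omega>" using assms by (simp add: L2_def)
qed

lemma L2_norm_0_iff:
  assumes "v \<in> L2 \<Omega>"
  shows "L2_norm \<Omega> v = 0 \<longleftrightarrow> (AE x in lebesgue_on \<Omega>. v x = 0)"
proof -
  have "L2_norm \<Omega> v = 0 \<longleftrightarrow> integral\<^sup>L (lebesgue_on \<Omega>) (\<lambda>x. (cmod (v x))\<^sup>2) = 0"
    by (simp add: L2_norm_def)
  also have "\<dots> \<longleftrightarrow> (AE x in lebesgue_on \<Omega>. (cmod (v x))\<^sup>2 = 0)"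
    using assms by (intro integral_nonneg_eq_0_iff_AE) (auto simp: L2_def)
  finally show ?thesis by simp
qed

lemma const_L2:
  assumes "\<Omega> \<in> lmeasurable"
  shows "(\<lambda>x. c) \<in> L2 \<Omega>"
  using finite_measure.integrable_const[OF finite_measure_lebesgue_on[OF assms]]
  unfolding L2_def by auto

lemma L2_integrable:
  assumes "\<Omega> \<in> lmeasurable" "v \<in> L2 \<Omega>"
  shows "integrable (lebesgue_on \<Omega>) v"
  using L2_integrable_mult(1)[OF assms(2) const_L2[OF assms(1), of 1]] by simp

lemma L1_le_L2:
  assumes "\<Omega> \<in> lmeasurable" "v \<in> L2 \<Omega>"
  shows "integral\<^sup>L (lebesgue_on \<Omega>) (\<lambda>x. cmod (v x)) \<le> L2_norm \<Omega> v * L2_norm \<Omega> (\<lambda>x. 1)"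
proof -
  have v: "(\<lambda>x. of_real (cmod (v x))) \<in> L2 \<Omega>" using assms(2) by (auto simp: L2_def)
  have "integral\<^sup>L (lebesgue_on \<Omega>) (\<lambda>x. cmod (v x)) = Re (L2_inner \<Omega> (\<lambda>x. of_real (cmod (v x))) (\<lambda>x. 1))"
    by (simp add: L2_inner_def)
  also have "\<dots> \<le> L2_norm \<Omega> (\<lambda>x. of_real (cmod (v x))) * L2_norm \<Omega> (\<lambda>x. 1)"
    by (intro order.trans[OF complex_Re_le_cmod] L2_Cauchy_Schwarz v const_L2 assms)
  finally show ?thesis by (simp add: L2_norm_def)
qed

definition L2_Cauchy :: "(real^'n::finite) set \<Rightarrow> (nat \<Rightarrow> 'n cfun) \<Rightarrow> bool" where
  "L2_Cauchy \<Omega> v \<longleftrightarrow> (\<forall>e>0. \<exists>N. \<forall>m\<ge>N. \<forall>n\<ge>N. L2_norm \<Omega> (v m - v n) < e)"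

text \<open>Riesz--Fischer. A subsequence with summable \<open>L2\<close> increments has summable \<open>L1\<close> increments because
  the measure is finite, so it converges almost everywhere; Fatou's lemma bounds the distance of the
  sequence to the pointwise limit.\<close>

theorem L2_complete:
  assumes \<Omega>: "\<Omega> \<in> lmeasurable" and v: "\<And>m. v m \<in> L2 \<Omega>" and C: "L2_Cauchy \<Omega> v"
  shows "\<exists>w\<in>L2 \<Omega>. (\<lambda>m. L2_norm \<Omega> (v m - w)) \<longlonglongrightarrow> 0"
proof -
  let ?M = "lebesgue_on \<Omega>"
  have [measurable]: "v m \<in> borel_measurable ?M" for m using v by (simp add: L2_def)
  have "\<forall>k. \<exists>N. \<forall>m\<ge>N. \<forall>n\<ge>N. L2_norm \<Omega> (v m - v n) < (1/2) ^ k"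
    using C by (simp add: L2_Cauchy_def)
  then obtain N where N: "\<And>k m n. N k \<le> m \<Longrightarrow> N k \<le> n \<Longrightarrow> L2_norm \<Omega> (v m - v n) < (1/2) ^ k" by metis
  \<comment> \<open>Summation makes the indices increase.\<close>
  define r where "r = (\<lambda>k. \<Sum>j\<le>k. N j + 1)"
  have rN: "N k \<le> r k" for k unfolding r_def by (rule order.trans[OF _ member_le_sum[of k]]) auto
  have rS: "r k \<le> r (Suc k)" for k by (simp add: r_def)
  have rk: "k \<le> r k" for k by (induction k) (auto simp: r_def)
  define g where "g = (\<lambda>k. v (r (Suc k)) - v (r k))"
  have gL: "g k \<in> L2 \<Omega>" for k by (simp add: g_def L2_diff v)
  then have [measurable]: "g k \<in> borel_measurable ?M" for k by (simp add: L2_def)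
  have gn: "L2_norm \<Omega> (g k) \<le> (1/2) ^ k" for k
    unfolding g_def by (rule less_imp_le[OF N[OF order.trans[OF rN rS] rN]])
  define c where "c = L2_norm \<Omega> (\<lambda>x. 1)"
  have nn: "(\<integral>\<^sup>+x. ennreal (cmod (g k x)) \<partial>?M) \<le> ennreal (c * (1/2) ^ k)" for k
  proof -
    have "(\<integral>\<^sup>+x. ennreal (cmod (g k x)) \<partial>?M) = ennreal (integral\<^sup>L ?M (\<lambda>x. cmod (g k x)))"
      by (intro nn_integral_eq_integral integrable_norm L2_integrable \<Omega> gL) auto
    also have "\<dots> \<le> ennreal (c * (1/2) ^ k)"
      using L1_le_L2[OF \<Omega> gL, of k] mult_right_mono[OF gn[of k], of c]
      by (intro ennreal_leI) (simp add: c_def mult.commute)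
    finally show ?thesis .
  qed
  have "(\<integral>\<^sup>+x. (\<Sum>k. ennreal (cmod (g k x))) \<partial>?M) = (\<Sum>k. (\<integral>\<^sup>+x. ennreal (cmod (g k x)) \<partial>?M))"
    by (intro nn_integral_suminf) measurable
  also have "\<dots> \<le> (\<Sum>k. ennreal (c * (1/2) ^ k))" by (intro suminf_le nn) auto
  also have "\<dots> = ennreal (\<Sum>k. c * (1/2) ^ k)"
    by (intro suminf_ennreal2 summable_mult summable_geometric) (auto simp: c_def)
  finally have "(\<integral>\<^sup>+x. (\<Sum>k. ennreal (cmod (g k x))) \<partial>?M) \<noteq> \<infinity>"
    by (auto simp: top_unique)
  then have "AE x in ?M. (\<Sum>k. ennreal (cmod (g k x))) \<noteq> \<infinity>"
    by (intro nn_integral_PInf_AE) measurable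
  then have ae: "AE x in ?M. (\<lambda>k. v (r k) x) \<longlonglongrightarrow> lim (\<lambda>k. v (r k) x)"
  proof eventually_elim
    case (elim x)
    then have "summable (\<lambda>k. cmod (g k x))" by (intro summable_suminf_not_top) auto
    then have "summable (\<lambda>k. g k x)" by (rule summable_norm_cancel)
    then have "summable (\<lambda>k. v (r (Suc k)) x - v (r k) x)" by (simp only: g_def fun_diff_def)
    then have "convergent (\<lambda>n. \<Sum>k<n. v (r (Suc k)) x - v (r k) x)" by (simp only: summable_iff_convergent)
    then have "convergent (\<lambda>n. v (r n) x - v (r 0) x)" by (simp only: sum_lessThan_telescope[where f="\<lambda>k. v (r k) x"])
    then have "convergent (\<lambda>n. (v (r n) x - v (r 0) x) + v (r 0) x)" by (intro convergent_add convergent_const)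
    then have "convergent (\<lambda>n. v (r n) x)" by (simp only: diff_add_cancel)
    then show ?case by (simp only: convergent_LIMSEQ_iff)
  qed
  define w where "w = (\<lambda>x. lim (\<lambda>k. v (r k) x))"
  have [measurable]: "w \<in> borel_measurable ?M" unfolding w_def by measurable
  have key: "v m - w \<in> L2 \<Omega> \<and> L2_norm \<Omega> (v m - w) \<le> (1/2) ^ k" if m: "N k \<le> m" for k m
  proof -
    have "(\<integral>\<^sup>+x. ennreal ((cmod (v m x - w x))\<^sup>2) \<partial>?M) = (\<integral>\<^sup>+x. liminf (\<lambda>j. ennreal ((cmod (v m x - v (r j) x))\<^sup>2)) \<partial>?M)"
    proof (rule nn_integral_cong_AE)
      show "AE x in ?M. ennreal ((cmod (v m x - w x))\<^sup>2) = liminf (\<lambda>j. ennreal ((cmod (v m x - v (r j) x))\<^sup>2))"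
        using ae
      proof eventually_elim
        case (elim x)
        then have "(\<lambda>j. ennreal ((cmod (v m x - v (r j) x))\<^sup>2)) \<longlonglongrightarrow> ennreal ((cmod (v m x - w x))\<^sup>2)"
          unfolding w_def by (intro tendsto_ennrealI tendsto_intros)
        then show ?case by (intro lim_imp_Liminf[symmetric]) auto
      qed
    qed
    also have "\<dots> \<le> liminf (\<lambda>j. \<integral>\<^sup>+x. ennreal ((cmod (v m x - v (r j) x))\<^sup>2) \<partial>?M)"
      by (intro nn_integral_liminf) measurable
    also have "\<dots> \<le> ennreal (((1/2) ^ k)\<^sup>2)"
    proof (rule Liminf_le)
      show "eventually (\<lambda>j. (\<integral>\<^sup>+x. ennreal ((cmod (v m x - v (r j) x))\<^sup>2) \<partial>?M) \<le> ennreal (((1/2) ^ k)\<^sup>2)) sequentially"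
        using eventually_ge_at_top[of "N k"]
      proof eventually_elim
        case (elim j)
        have "v m - v (r j) \<in> L2 \<Omega>" by (intro L2_diff v)
        then have i: "integrable ?M (\<lambda>x. (cmod (v m x - v (r j) x))\<^sup>2)" by (simp add: L2_def)
        have "(\<integral>\<^sup>+x. ennreal ((cmod (v m x - v (r j) x))\<^sup>2) \<partial>?M) = ennreal ((L2_norm \<Omega> (v m - v (r j)))\<^sup>2)"
          using nn_integral_eq_integral[OF i] by (simp add: L2_norm_def)
        also have "\<dots> \<le> ennreal (((1/2) ^ k)\<^sup>2)"
          by (intro ennreal_leI power_mono L2_norm_nonneg less_imp_le[OF N[OF m order.trans[OF elim rk]]])
        finally show ?case .
      qed
    qed simp
    finally have b: "(\<integral>\<^sup>+x. ennreal ((cmod (v m x - w x))\<^sup>2) \<partial>?M) \<le> ennreal (((1/2) ^ k)\<^sup>2)" .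
    have i: "integrable ?M (\<lambda>x. (cmod (v m x - w x))\<^sup>2)"
      by (rule integrableI_bounded) (use b in \<open>auto simp: less_top[symmetric] top_unique intro: le_less_trans\<close>)
    have "integral\<^sup>L ?M (\<lambda>x. (cmod (v m x - w x))\<^sup>2) \<le> ((1/2) ^ k)\<^sup>2"
      using b nn_integral_eq_integral[OF i] by simp
    then have "L2_norm \<Omega> (v m - w) \<le> sqrt (((1/2) ^ k)\<^sup>2)"
      unfolding L2_norm_def by (intro real_sqrt_le_mono) simp
    moreover have "v m - w \<in> L2 \<Omega>" using i by (auto simp: L2_def fun_diff_def)
    ultimately show ?thesis by simp
  qed
  have "v (N 0) - (v (N 0) - w) \<in> L2 \<Omega>" by (rule L2_diff[OF v conjunct1[OF key[of 0]]]) simp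
  then have wL: "w \<in> L2 \<Omega>" by simp
  have "(\<lambda>m. L2_norm \<Omega> (v m - w)) \<longlonglongrightarrow> 0"
  proof (rule LIMSEQ_I)
    fix e :: real assume "0 < e"
    then obtain k where k: "(1/2) ^ k < e" using real_arch_pow_inv[of e "1/2"] by auto
    show "\<exists>no. \<forall>n\<ge>no. norm (L2_norm \<Omega> (v n - w) - 0) < e"
      using key k by (intro exI[of _ "N k"]) (auto intro: le_less_trans)
  qed
  then show ?thesis using wL by blast
qed

section \<open>Test functions separate integrable functions\<close>

lemma partial_deriv_eq:
  assumes "\<And>x. (v has_derivative D x) (at x)"
  shows "partial_deriv i v = (\<lambda>x. D x (axis i 1))"
  unfolding partial_deriv_def using frechet_derivative_at[OF assms] by metis

text \<open>For \<open>c > 0\<close> these functions, flat at 0, are closed under differentiation up to linear combinations,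
  which reduces the smoothness of \<open>exp(- c/s)\<close> at 0 to one limit.\<close>

definition flat_fun :: "nat \<Rightarrow> real \<Rightarrow> real \<Rightarrow> real" where
  "flat_fun j c s = (if 0 < s then inverse s ^ j * exp (- c / s) else 0)"

lemma flat_fun_tendsto_0:
  assumes "0 < (c::real)"
  shows "((\<lambda>s. inverse s ^ j * exp (- c / s)) \<longlongrightarrow> 0) (at_right 0)"
proof -
  have "((\<lambda>u. (u ^ j / exp u) * inverse c ^ j) \<longlongrightarrow> 0 * inverse c ^ j) at_top"
    by (rule tendsto_mult[OF tendsto_power_div_exp_0 tendsto_const])
  moreover have "filterlim (\<lambda>s. c * inverse s) at_top (at_right 0)"
    by (rule filterlim_tendsto_pos_mult_at_top[OF tendsto_const assms filterlim_inverse_at_top_right])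
  ultimately have "((\<lambda>s. ((c * inverse s) ^ j / exp (c * inverse s)) * inverse c ^ j) \<longlongrightarrow> 0) (at_right 0)"
    using filterlim_compose by fastforce
  moreover have "((c * inverse s) ^ j / exp (c * inverse s)) * inverse c ^ j = inverse s ^ j * exp (- c / s)" for s
  proof -
    have "c ^ j * inverse c ^ j = 1" using assms by (simp flip: power_mult_distrib)
    then show ?thesis by (simp add: power_mult_distrib exp_minus divide_inverse mult_ac)
  qed
  ultimately show ?thesis by simp
qed

lemma flat_fun_deriv:
  assumes "0 < c"
  shows "(flat_fun j c has_real_derivative (c * flat_fun (j + 2) c s - real j * flat_fun (j + 1) c s)) (at s)"
proof -
  consider "s < 0" | "s = 0" | "0 < s" by linarith
  then show ?thesis
  proof cases
    case 1
    have "((\<lambda>s. 0) has_real_derivative 0) (at s)" by simp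
    then have "(flat_fun j c has_real_derivative 0) (at s)"
      by (rule has_field_derivative_transform_within_open[of _ _ _ "{..<0}"]) (use 1 in \<open>auto simp: flat_fun_def\<close>)
    then show ?thesis using 1 by (simp add: flat_fun_def)
  next
    case 3
    have "((\<lambda>s. inverse s ^ j * exp (- c / s)) has_real_derivative (c * flat_fun (j + 2) c s - real j * flat_fun (j + 1) c s)) (at s)"
    proof -
      have "((\<lambda>s. inverse s ^ j * exp (- c / s)) has_real_derivative
           (inverse s ^ j * (exp (- c / s) * (c / (s * s))) + (real j * (inverse s ^ (j - 1)) * (- inverse (s * s))) * exp (- c / s))) (at s)"
        using 3 by (auto intro!: derivative_eq_intros simp: power2_eq_square divide_inverse)
      moreover have "real j * (inverse s ^ (j - 1)) * (- inverse (s * s)) = - (real j * inverse s ^ (j + 1))"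
        using 3 by (cases j) (auto simp: inverse_mult_distrib)
      moreover have "inverse s ^ j * (exp (- c / s) * (c / (s * s))) = c * (inverse s ^ (j + 2) * exp (- c / s))"
        using 3 by (simp add: divide_inverse inverse_mult_distrib)
      ultimately have "((\<lambda>s. inverse s ^ j * exp (- c / s)) has_real_derivative
          (c * (inverse s ^ (j + 2) * exp (- c / s)) + - (real j * inverse s ^ (j + 1)) * exp (- c / s))) (at s)"
        by (simp only:)
      moreover have "c * (inverse s ^ (j + 2) * exp (- c / s)) + - (real j * inverse s ^ (j + 1)) * exp (- c / s)
          = c * flat_fun (j + 2) c s - real j * flat_fun (j + 1) c s" using 3 by (simp add: flat_fun_def)
      ultimately show ?thesis by (simp only:)
    qed
    then show ?thesis
      by (rule has_field_derivative_transform_within_open[of _ _ _ "{0<..}"]) (use 3 in \<open>auto simp: flat_fun_def\<close>)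
  next
    case 2
    have "((\<lambda>h. (flat_fun j c (0 + h) - flat_fun j c 0) / h) \<longlongrightarrow> 0) (at 0)"
    proof (rule filterlim_split_at)
      have "eventually (\<lambda>h::real. h < 0) (at_left 0)" by (simp add: eventually_at_filter)
      then have "eventually (\<lambda>h. 0 = (flat_fun j c (0 + h) - flat_fun j c 0) / h) (at_left 0)"
        by eventually_elim (simp add: flat_fun_def)
      then show "((\<lambda>h. (flat_fun j c (0 + h) - flat_fun j c 0) / h) \<longlongrightarrow> 0) (at_left 0)"
        by (rule Lim_transform_eventually[OF tendsto_const])
      have "eventually (\<lambda>h::real. 0 < h) (at_right 0)" by (simp add: eventually_at_filter)
      then have "eventually (\<lambda>h. inverse h ^ (j + 1) * exp (- c / h) = (flat_fun j c (0 + h) - flat_fun j c 0) / h) (at_right 0)"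
        by eventually_elim (simp add: flat_fun_def divide_inverse)
      then show "((\<lambda>h. (flat_fun j c (0 + h) - flat_fun j c 0) / h) \<longlongrightarrow> 0) (at_right 0)"
        by (rule Lim_transform_eventually[OF flat_fun_tendsto_0[OF assms]])
    qed
    then show ?thesis using 2 by (simp add: DERIV_def flat_fun_def)
  qed
qed

text \<open>A class of functions that contains the bumps below and is closed under partial derivatives; its
  members are therefore differentiable of every order.\<close>

inductive smooth_gen :: "'n::finite cfun \<Rightarrow> bool" where
  const: "smooth_gen (\<lambda>x. c)"
| flat: "0 < c \<Longrightarrow> smooth_gen (\<lambda>x. of_real (flat_fun j c (\<sigma> * x $ i + \<tau>)))"
| add: "smooth_gen u \<Longrightarrow> smooth_gen v \<Longrightarrow> smooth_gen (\<lambda>x. u x + v x)"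
| mult: "smooth_gen u \<Longrightarrow> smooth_gen v \<Longrightarrow> smooth_gen (\<lambda>x. u x * v x)"

lemma smooth_gen_deriv:
  fixes v :: "'n::finite cfun"
  assumes "smooth_gen v"
  shows "(\<forall>x. v differentiable (at x)) \<and> (\<forall>i. smooth_gen (partial_deriv i v))"
  using assms
proof induction
  case (const c)
  have "partial_deriv i (\<lambda>x::real^'n. c) = (\<lambda>x. 0)" for i
    by (rule partial_deriv_eq) simp
  then show ?case by (auto intro: smooth_gen.const)
next
  case (flat c j \<sigma> k \<tau>)
  define D where "D = (\<lambda>x::real^'n. c * flat_fun (j + 2) c (\<sigma> * x $ k + \<tau>) - real j * flat_fun (j + 1) c (\<sigma> * x $ k + \<tau>))"
  have d: "((\<lambda>x. complex_of_real (flat_fun j c (\<sigma> * x $ k + \<tau>))) has_derivative (\<lambda>y. of_real (D x * (\<sigma> * y $ k)))) (at x)" for x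
  proof -
    have "((\<lambda>x. flat_fun j c (\<sigma> * x $ k + \<tau>)) has_derivative (\<lambda>y. D x * (\<sigma> * y $ k))) (at x)"
    proof (rule has_derivative_compose[of "\<lambda>x. \<sigma> * x $ k + \<tau>" "\<lambda>y. \<sigma> * y $ k" x UNIV "flat_fun j c" "\<lambda>t. D x * t", simplified])
      show "((\<lambda>x. \<sigma> * x $ k + \<tau>) has_derivative (\<lambda>y. \<sigma> * y $ k)) (at x)"
        by (auto intro!: derivative_eq_intros bounded_linear.has_derivative[OF bounded_linear_vec_nth])
      show "(flat_fun j c has_derivative (\<lambda>t. D x * t)) (at (\<sigma> * x $ k + \<tau>))"
        using flat_fun_deriv[OF flat, of j "\<sigma> * x $ k + \<tau>"] by (simp only: has_field_derivative_def D_def)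
    qed
    then show ?thesis by (rule has_derivative_of_real)
  qed
  have eq: "partial_deriv i (\<lambda>x. complex_of_real (flat_fun j c (\<sigma> * x $ k + \<tau>))) =
      (\<lambda>x. of_real (\<sigma> * (axis i 1 :: real^'n) $ k) *
        (of_real c * of_real (flat_fun (j + 2) c (\<sigma> * x $ k + \<tau>)) + of_real (- real j) * of_real (flat_fun (j + 1) c (\<sigma> * x $ k + \<tau>))))" for i
    by (subst partial_deriv_eq[OF d]) (simp add: D_def algebra_simps)
  have "smooth_gen (partial_deriv i (\<lambda>x. complex_of_real (flat_fun j c (\<sigma> * x $ k + \<tau>))))" for i
    unfolding eq by (intro smooth_gen.intros flat)
  then show ?case using d by (auto simp: differentiable_def)
next
  case (add u v)
  then have du: "(u has_derivative frechet_derivative u (at x)) (at x)" "(v has_derivative frechet_derivative v (at x)) (at x)" for x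
    by (auto simp: frechet_derivative_works)
  have d: "((\<lambda>x. u x + v x) has_derivative (\<lambda>h. frechet_derivative u (at x) h + frechet_derivative v (at x) h)) (at x)" for x
    by (intro has_derivative_add du)
  have "partial_deriv i (\<lambda>x. u x + v x) = (\<lambda>x. partial_deriv i u x + partial_deriv i v x)" for i
    by (subst partial_deriv_eq[OF d]) (simp add: partial_deriv_def)
  then show ?case using d add by (auto simp: differentiable_def intro: smooth_gen.add)
next
  case (mult u v)
  then have du: "(u has_derivative frechet_derivative u (at x)) (at x)" "(v has_derivative frechet_derivative v (at x)) (at x)" for x
    by (auto simp: frechet_derivative_works)
  have d: "((\<lambda>x. u x * v x) has_derivative (\<lambda>h. u x * frechet_derivative v (at x) h + frechet_derivative u (at x) h * v x)) (at x)" for x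
    by (intro has_derivative_mult du)
  have "partial_deriv i (\<lambda>x. u x * v x) = (\<lambda>x. u x * partial_deriv i v x + partial_deriv i u x * v x)" for i
    by (subst partial_deriv_eq[OF d]) (simp add: partial_deriv_def)
  then show ?case using d mult by (auto simp: differentiable_def intro!: smooth_gen.add smooth_gen.mult)
qed

lemma C_k_smooth_gen: "smooth_gen v \<Longrightarrow> C_k k v"
proof (induction k arbitrary: v)
  case 0
  then show ?case using smooth_gen_deriv[of v]
    by (auto intro!: continuous_at_imp_continuous_on differentiable_imp_continuous_within)
next
  case (Suc k)
  then show ?case using smooth_gen_deriv[of v] by auto
qed

lemma smooth_gen_prod: "finite I \<Longrightarrow> (\<And>i. i \<in> I \<Longrightarrow> smooth_gen (u i)) \<Longrightarrow> smooth_gen (\<lambda>x. \<Prod>i\<in>I. u i x)"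
  by (induction I rule: finite_induct) (auto intro: smooth_gen.const smooth_gen.mult)

text \<open>A product of factors \<open>exp(- c/s)\<close>, where \<open>s\<close> runs over the distances to the faces of the box. The
  arguments have the shape \<open>\<sigma> * x $ i + \<tau>\<close> of the generators of \<open>smooth_gen\<close>.\<close>

definition box_bump :: "real \<Rightarrow> real^'n \<Rightarrow> real^'n \<Rightarrow> 'n::finite cfun" where
  "box_bump c a b x = (\<Prod>i\<in>UNIV. of_real (flat_fun 0 c (1 * x $ i + (- a $ i))) * of_real (flat_fun 0 c ((-1) * x $ i + b $ i)))"

lemma box_bump_test:
  assumes "0 < c" "cbox a b \<subseteq> \<Omega>"
  shows "box_bump c a b \<in> test_functions \<Omega>"
proof -
  have "smooth_gen (box_bump c a b)"
    unfolding box_bump_def[abs_def] by (intro smooth_gen_prod smooth_gen.mult smooth_gen.flat assms) auto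
  moreover have "box_bump c a b x = 0" if out: "x \<notin> cbox a b" for x
  proof -
    obtain i where "x $ i < a $ i \<or> b $ i < x $ i" using out unfolding mem_box_cart by (meson not_le)
    then have "\<exists>i\<in>UNIV. complex_of_real (flat_fun 0 c (1 * x $ i + (- a $ i))) * of_real (flat_fun 0 c ((-1) * x $ i + b $ i)) = 0"
      by (intro bexI[of _ i]) (auto simp: flat_fun_def)
    then show ?thesis unfolding box_bump_def by (intro prod_zero) auto
  qed
  ultimately show ?thesis
    unfolding test_functions_def using assms by (auto intro: C_k_smooth_gen exI[of _ "cbox a b"])
qed

lemma flat_fun_0_bounds: "0 < c \<Longrightarrow> 0 \<le> flat_fun 0 c s \<and> flat_fun 0 c s \<le> 1"
  by (auto simp: flat_fun_def)

lemma box_bump_le_1: "0 < c \<Longrightarrow> cmod (box_bump c a b x) \<le> 1"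
  unfolding box_bump_def
  by (subst prod_norm[symmetric], rule prod_le_1)
     (use flat_fun_0_bounds in \<open>auto simp: norm_mult intro!: mult_le_one\<close>)

lemma box_bump_tendsto:
  "(\<lambda>m. box_bump (1 / real (Suc m)) a b x) \<longlonglongrightarrow> indicator (box a b) x"
proof (cases "x \<in> box a b")
  case False
  then obtain i where "x $ i \<le> a $ i \<or> b $ i \<le> x $ i" unfolding mem_box_cart by (meson not_le)
  then have "\<exists>i\<in>UNIV. complex_of_real (flat_fun 0 c (1 * x $ i + (- a $ i))) * of_real (flat_fun 0 c ((-1) * x $ i + b $ i)) = 0" for c
    by (intro bexI[of _ i]) (auto simp: flat_fun_def)
  then have "box_bump c a b x = 0" for c unfolding box_bump_def by (intro prod_zero) auto
  then show ?thesis using False by simp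
next
  case True
  have lim: "(\<lambda>m. flat_fun 0 (1 / real (Suc m)) s) \<longlonglongrightarrow> 1" if "0 < s" for s
  proof -
    have "(\<lambda>m. exp (- (1 / real (Suc m)) / s)) \<longlonglongrightarrow> exp (- 0 / s)"
      using that by (intro tendsto_intros lim_1_over_n[THEN LIMSEQ_Suc]) (auto)
    then show ?thesis using that by (simp add: flat_fun_def)
  qed
  have "(\<lambda>m. box_bump (1 / real (Suc m)) a b x) \<longlonglongrightarrow> (\<Prod>i\<in>(UNIV::'a set). of_real 1 * of_real 1)"
    unfolding box_bump_def using True
    by (intro tendsto_prod tendsto_mult tendsto_of_real lim) (auto simp: mem_box_cart)
  then show ?thesis using True by simp
qed

text \<open>For \<open>c \<longlonglongrightarrow> 0\<close> the bumps tend to the indicator function of the open box and stay bounded by 1.\<close>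

lemma integral_box_zero:
  assumes f: "integrable (lebesgue_on \<Omega>) f" and orth: "\<And>\<phi>. \<phi> \<in> test_functions \<Omega> \<Longrightarrow> integral\<^sup>L (lebesgue_on \<Omega>) (\<lambda>x. f x * \<phi> x) = 0"
    and \<Omega>: "\<Omega> \<in> sets lebesgue" and sub: "cbox a b \<subseteq> \<Omega>"
  shows "integral\<^sup>L (lebesgue_on \<Omega>) (\<lambda>x. f x * indicator (box a b) x) = 0"
proof -
  let ?M = "lebesgue_on \<Omega>"
  have fm[measurable]: "f \<in> borel_measurable ?M" using f by auto
  have t: "box_bump (1 / real (Suc m)) a b \<in> test_functions \<Omega>" for m
    by (rule box_bump_test[OF _ sub]) simp
  have bm[measurable]: "box_bump (1 / real (Suc m)) a b \<in> borel_measurable ?M" for m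
  proof -
    have "C_k 0 (box_bump (1 / real (Suc m)) a b)" using t[of m] unfolding test_functions_def by blast
    then have "box_bump (1 / real (Suc m)) a b \<in> borel_measurable borel"
      by (simp add: borel_measurable_continuous_onI)
    then have "box_bump (1 / real (Suc m)) a b \<in> borel_measurable lebesgue"
      by (simp add: measurable_completion)
    then show ?thesis by (rule measurable_restrict_space1)
  qed
  have im[measurable]: "(\<lambda>x. indicator (box a b) x :: complex) \<in> borel_measurable ?M"
    by (rule measurable_restrict_space1) (auto intro: measurable_completion)
  have "(\<lambda>m. integral\<^sup>L ?M (\<lambda>x. f x * box_bump (1 / real (Suc m)) a b x)) \<longlonglongrightarrow>
      integral\<^sup>L ?M (\<lambda>x. f x * indicator (box a b) x)"
  proof (rule integral_dominated_convergence[where w = "\<lambda>x. cmod (f x)"])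
    show "integrable ?M (\<lambda>x. cmod (f x))" using f by (rule integrable_norm)
    show "AE x in ?M. (\<lambda>m. f x * box_bump (1 / real (Suc m)) a b x) \<longlonglongrightarrow> f x * indicator (box a b) x"
      by (intro AE_I2 tendsto_mult tendsto_const box_bump_tendsto)
    show "AE x in ?M. cmod (f x * box_bump (1 / real (Suc m)) a b x) \<le> cmod (f x)" for m
      using box_bump_le_1[of "1 / real (Suc m)" a b] by (intro AE_I2) (simp add: norm_mult mult_left_le)
  qed measurable
  moreover have "integral\<^sup>L ?M (\<lambda>x. f x * box_bump (1 / real (Suc m)) a b x) = 0" for m
    by (rule orth[OF t])
  ultimately show ?thesis by (simp add: LIMSEQ_const_iff)
qed

text \<open>The sets over which \<open>f\<close> integrates to zero contain all boxes, which are closed under intersection,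
  so they contain all Borel sets. A Lebesgue set differs from an \<open>F\<^sub>\<sigma>\<close> set by a null set only.\<close>

lemma AE_zero_on_box:
  assumes f: "integrable (lebesgue_on \<Omega>) f" and orth: "\<And>\<phi>. \<phi> \<in> test_functions \<Omega> \<Longrightarrow> integral\<^sup>L (lebesgue_on \<Omega>) (\<lambda>x. f x * \<phi> x) = 0"
    and \<Omega>: "\<Omega> \<in> lmeasurable" and sub: "cbox c d \<subseteq> \<Omega>"
  shows "AE x in lebesgue_on \<Omega>. x \<in> box c d \<longrightarrow> f x = 0"
proof -
  let ?M = "lebesgue_on \<Omega>"
  have \<Omega>s: "\<Omega> \<in> sets lebesgue" using \<Omega> by (rule fmeasurableD)
  have fm[measurable]: "f \<in> borel_measurable ?M" using f by auto
  have im: "(\<lambda>x. indicator A x :: complex) \<in> borel_measurable ?M" if "A \<in> sets lebesgue" for A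
    by (rule measurable_restrict_space1) (use that in auto)
  have fi: "integrable ?M (\<lambda>x. f x * indicator A x)" if "A \<in> sets lebesgue" for A
  proof (rule Bochner_Integration.integrable_bound[OF f])
    show "(\<lambda>x. f x * indicator A x) \<in> borel_measurable ?M" by (intro borel_measurable_times fm im that)
  qed (intro AE_I2, simp add: indicator_def)
  define I where "I = (\<lambda>A. integral\<^sup>L ?M (\<lambda>x. f x * indicator (A \<inter> box c d) x))"
  have bx: "box c d \<in> sets lebesgue" by (intro sets_completionI_sets) simp
  have basic: "I (box a b) = 0" for a b
  proof (cases "box a b \<inter> box c d = {}")
    case False
    obtain p q where pq: "box a b \<inter> box c d = box p q" using box_Int_box[of a b c d] by blast
    then have "box p q \<noteq> {}" using False by simp
    then have "cbox p q = closure (box p q)" by (simp add: closure_box)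
    also have "\<dots> \<subseteq> closure (box c d)" using pq by (intro closure_mono) auto
    also have "\<dots> \<subseteq> cbox c d" by (rule closure_minimal) (auto simp: box_subset_cbox)
    finally have "cbox p q \<subseteq> \<Omega>" using sub by blast
    from integral_box_zero[OF f orth \<Omega>s this] show ?thesis unfolding I_def pq .
  qed (simp add: I_def)
  have borel0: "I A = 0" if A: "A \<in> sets borel" for A
  proof -
    have "Int_stable (range (\<lambda>(a, b). box a b :: (real^'a) set))"
      by (auto simp: Int_stable_def box_Int_box)
    moreover have "range (\<lambda>(a, b). box a b :: (real^'a) set) \<subseteq> Pow UNIV" by auto
    moreover have "A \<in> sigma_sets UNIV (range (\<lambda>(a, b). box a b))"
      using A unfolding borel_eq_box by simp
    ultimately show ?thesis
    proof (induction rule: sigma_sets_induct_disjoint)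
      case (basic A)
      then show ?case using \<open>\<And>a b. I (box a b) = 0\<close> by auto
    next
      case empty
      then show ?case by (simp add: I_def)
    next
      case (compl A)
      then have A: "A \<in> sets borel" unfolding borel_eq_box by simp
      then have A': "A \<inter> box c d \<in> sets lebesgue" by (intro sets_completionI_sets) simp
      have "I (UNIV - A) = integral\<^sup>L ?M (\<lambda>x. f x * indicator (box c d) x - f x * indicator (A \<inter> box c d) x)"
        unfolding I_def by (intro Bochner_Integration.integral_cong) (auto simp: indicator_def)
      also have "\<dots> = integral\<^sup>L ?M (\<lambda>x. f x * indicator (box c d) x) - I A"
        unfolding I_def by (rule Bochner_Integration.integral_diff[OF fi[OF bx] fi[OF A']])
      also have "\<dots> = 0" using compl integral_box_zero[OF f orth \<Omega>s sub] by simp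
      finally show ?case .
    next
      case (union A)
      have A: "A i \<in> sets borel" for i using union unfolding borel_eq_box by auto
      let ?g = "\<lambda>x. f x * indicator (box c d) x"
      have J: "I B = (LINT x:B \<inter> \<Omega>|?M. ?g x)" for B
        unfolding I_def set_lebesgue_integral_def
        by (intro Bochner_Integration.integral_cong) (auto simp: indicator_def)
      have m: "A i \<inter> \<Omega> \<in> sets ?M" for i using A[of i] \<Omega>s by (auto simp: sets_restrict_space)
      have "(LINT x:(\<Union>i. A i \<inter> \<Omega>)|?M. ?g x) = (\<Sum>i. (LINT x:A i \<inter> \<Omega>|?M. ?g x))"
      proof (rule lebesgue_integral_countable_add[OF m])
        show "set_integrable ?M (\<Union>i. A i \<inter> \<Omega>) ?g"
          unfolding set_integrable_def
          by (rule integrable_mult_indicator[OF sets.countable_UN[OF image_subsetI[OF m]] fi[OF bx]])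
      qed (use union(1) in \<open>auto simp: disjoint_family_on_def\<close>)
      also have "\<dots> = (\<Sum>i. I (A i))" by (simp only: J)
      also have "\<dots> = 0" using union by simp
      finally show ?case unfolding J by simp
    qed
  qed
  have "AE x in ?M. f x * indicator (box c d) x = 0"
  proof (rule sigma_finite_measure.density_unique_banach)
    show "sigma_finite_measure ?M"
      using finite_measure_lebesgue_on[OF \<Omega>] by (simp add: finite_measure.axioms(1) finite_measure_def)
    fix A assume "A \<in> sets ?M"
    then have A: "A \<in> sets lebesgue" using \<Omega>s by (auto simp: sets_restrict_space)
    obtain C T where CT: "fsigma C" "T \<in> null_sets lebesgue" "C \<union> T = A" "disjnt C T"
      using lebesgue_set_almost_fsigma[OF A] .
    have C: "C \<in> sets borel" using CT(1) by (induction rule: fsigma.induct) (auto intro!: borel_closed)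
    have "AE x in lebesgue. x \<notin> T" using CT(2) by (rule AE_not_in)
    then have "AE x in ?M. x \<notin> T" by (subst AE_restrict_space_iff) (use \<Omega>s in auto)
    then have "(LINT x:A|?M. f x * indicator (box c d) x) = I C"
      unfolding set_lebesgue_integral_def I_def
    proof (intro integral_cong_AE)
      show "(\<lambda>x. indicat_real A x *\<^sub>R (f x * indicator (box c d) x)) \<in> borel_measurable ?M"
        using \<open>A \<in> sets ?M\<close> by (intro borel_measurable_scaleR borel_measurable_indicator borel_measurable_times fm im bx)
      show "(\<lambda>x. f x * indicator (C \<inter> box c d) x) \<in> borel_measurable ?M"
        using C by (intro borel_measurable_times fm im) auto
      assume "AE x in ?M. x \<notin> T"
      then show "AE x in ?M. indicat_real A x *\<^sub>R (f x * indicator (box c d) x) = f x * indicator (C \<inter> box c d) x"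
        by eventually_elim (use CT(3) in \<open>auto simp: indicator_def\<close>)
    qed
    also have "\<dots> = 0" by (rule borel0[OF C])
    finally show "(LINT x:A|?M. f x * indicator (box c d) x) = (LINT x:A|?M. 0)" by (simp add: set_lebesgue_integral_def)
  qed (use fi[OF bx] in auto)
  then show ?thesis by eventually_elim (auto simp: indicator_def)
qed

text \<open>By the Lindeloef property countably many boxes cover the open set.\<close>

theorem AE_zero_of_orthogonal:
  assumes f: "integrable (lebesgue_on \<Omega>) f" and orth: "\<And>\<phi>. \<phi> \<in> test_functions \<Omega> \<Longrightarrow> integral\<^sup>L (lebesgue_on \<Omega>) (\<lambda>x. f x * \<phi> x) = 0"
    and \<Omega>: "open \<Omega>" "\<Omega> \<in> lmeasurable"
  shows "AE x in lebesgue_on \<Omega>. f x = 0"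
proof -
  have "\<exists>a b. x \<in> box a b \<and> cbox a b \<subseteq> \<Omega>" if "x \<in> \<Omega>" for x
    using \<Omega>(1) that by (meson open_contains_cbox)
  define \<B> where "\<B> = {(a, b). cbox a b \<subseteq> \<Omega>}"
  obtain \<F> where \<F>: "\<F> \<subseteq> (\<lambda>(a, b). box a b) ` \<B>" "countable \<F>" "\<Union>\<F> = (\<Union>((\<lambda>(a, b). box a b) ` \<B>))"
    using Lindelof[of "(\<lambda>(a, b). box a b) ` \<B>"] by (metis (no_types, lifting) case_prod_beta image_iff open_box)
  have "AE x in lebesgue_on \<Omega>. \<forall>X\<in>\<F>. x \<in> X \<longrightarrow> f x = 0"
    unfolding AE_ball_countable[OF \<F>(2)]
  proof
    fix X assume "X \<in> \<F>"
    then obtain a b where "X = box a b" "cbox a b \<subseteq> \<Omega>" using \<F>(1) by (auto simp: \<B>_def)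
    then show "AE x in lebesgue_on \<Omega>. x \<in> X \<longrightarrow> f x = 0" using AE_zero_on_box[OF f orth \<Omega>(2)] by simp
  qed
  moreover have "AE x in lebesgue_on \<Omega>. x \<in> \<Omega>" by (rule AE_I2) simp
  ultimately show ?thesis
  proof eventually_elim
    case (elim x)
    then obtain a b where "x \<in> box a b" "cbox a b \<subseteq> \<Omega>" using \<open>\<And>x. x \<in> \<Omega> \<Longrightarrow> \<exists>a b. x \<in> box a b \<and> cbox a b \<subseteq> \<Omega>\<close> by blast
    then have "x \<in> \<Union>\<F>" unfolding \<F>(3) by (auto simp: \<B>_def)
    then show ?case using elim by blast
  qed
qed

section \<open>Difference quotients and translations\<close>

text \<open>Continuously differentiable with compact support.\<close>

definition c1c :: "'n::finite cfun \<Rightarrow> bool" where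
  "c1c F \<longleftrightarrow> (\<forall>x. F differentiable (at x)) \<and> (\<forall>i. continuous_on UNIV (partial_deriv i F)) \<and>
     (\<exists>K. compact K \<and> (\<forall>x. x \<notin> K \<longrightarrow> F x = 0))"

lemma c1c_has_derivative: "c1c F \<Longrightarrow> (F has_derivative frechet_derivative F (at x)) (at x)"
  unfolding c1c_def using frechet_derivative_works by blast

lemma frechet_derivative_expand:
  fixes F :: "'n::finite cfun"
  assumes "F differentiable (at x)"
  shows "frechet_derivative F (at x) h = (\<Sum>i\<in>UNIV. h $ i *\<^sub>R partial_deriv i F x)"
proof -
  have l: "linear (frechet_derivative F (at x))"
    using assms by (rule linear_frechet_derivative)
  have "h = (\<Sum>i\<in>UNIV. h $ i *\<^sub>R axis i 1)"
    by (simp add: vec_eq_iff axis_def if_distrib sum.If_cases cong: if_cong)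
  then have "frechet_derivative F (at x) h = frechet_derivative F (at x) (\<Sum>i\<in>UNIV. h $ i *\<^sub>R axis i 1)" by simp
  also have "\<dots> = (\<Sum>i\<in>UNIV. h $ i *\<^sub>R frechet_derivative F (at x) (axis i 1))"
    by (simp only: linear_sum[OF l] linear_scale[OF l])
  finally show ?thesis by (simp add: partial_deriv_def)
qed

lemma c1c_dirderiv_continuous:
  assumes "c1c F"
  shows "continuous_on UNIV (\<lambda>x. frechet_derivative F (at x) h)"
proof -
  have "(\<lambda>x. frechet_derivative F (at x) h) = (\<lambda>x. \<Sum>i\<in>UNIV. h $ i *\<^sub>R partial_deriv i F x)"
    using assms by (intro ext frechet_derivative_expand) (auto simp: c1c_def)
  then show ?thesis using assms unfolding c1c_def by (simp only:) (auto intro!: continuous_intros)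
qed

lemma frechet_derivative_zero_outside:
  assumes "closed K" "\<And>x. x \<notin> K \<Longrightarrow> F x = 0" "x \<notin> K"
  shows "frechet_derivative F (at x) = (\<lambda>h. 0)"
proof -
  have "((\<lambda>x. 0) has_derivative (\<lambda>h. 0)) (at x)" by simp
  then have "(F has_derivative (\<lambda>h. 0)) (at x)"
    by (rule has_derivative_transform_within_open[of _ _ _ _ "- K"]) (use assms in auto)
  then show ?thesis by (rule frechet_derivative_at[symmetric])
qed

lemma c1c_continuous: "c1c F \<Longrightarrow> continuous_on UNIV F"
  unfolding c1c_def by (auto intro!: continuous_at_imp_continuous_on differentiable_imp_continuous_within)

lemma c1c_support:
  fixes F :: "'n::finite cfun"
  assumes "c1c F"
  obtains R B where "0 \<le> R" "0 \<le> B" "\<And>x. R < norm x \<Longrightarrow> F x = 0" "\<And>x h. R < norm x \<Longrightarrow> frechet_derivative F (at x) h = 0"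
    "\<And>x. cmod (frechet_derivative F (at x) h) \<le> B" "\<And>x. cmod (F x) \<le> B"
proof -
  obtain K where K: "compact K" "\<And>x. x \<notin> K \<Longrightarrow> F x = 0" using assms by (auto simp: c1c_def)
  obtain R where R: "\<And>x. x \<in> K \<Longrightarrow> norm x \<le> R" "0 < R" using compact_imp_bounded[OF K(1)] by (auto simp: bounded_pos)
  have z: "frechet_derivative F (at x) h = 0" if "x \<notin> K" for x h
    using frechet_derivative_zero_outside[OF compact_imp_closed[OF K(1)] K(2) that] by simp
  have bd: "\<exists>B. \<forall>x\<in>K. cmod (g x) \<le> B" if "continuous_on UNIV g" for g :: "'n cfun"
  proof -
    have "bounded (g ` K)"
      by (intro compact_imp_bounded compact_continuous_image continuous_on_subset[OF that] K) auto
    then show ?thesis by (auto simp: bounded_iff)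
  qed
  obtain B1 where B1: "\<And>x. x \<in> K \<Longrightarrow> cmod (frechet_derivative F (at x) h) \<le> B1" using bd[OF c1c_dirderiv_continuous[OF assms]] by blast
  obtain B2 where B2: "\<And>x. x \<in> K \<Longrightarrow> cmod (F x) \<le> B2" using bd[OF c1c_continuous[OF assms]] by blast
  let ?B = "max 0 (max B1 B2)"
  show ?thesis
  proof (rule that[of R ?B])
    show "cmod (frechet_derivative F (at x) h) \<le> ?B" for x using B1[of x] z[of x h] by (cases "x \<in> K") auto
    show "cmod (F x) \<le> ?B" for x using B2[of x] K(2)[of x] by (cases "x \<in> K") auto
    show "F x = 0" if "R < norm x" for x using R(1)[of x] K(2) that by force
    show "frechet_derivative F (at x) h = 0" if "R < norm x" for x h using R(1)[of x] z that by force
  qed (use R in auto)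
qed

definition diff_quot :: "'n::finite cfun \<Rightarrow> real^'n \<Rightarrow> nat \<Rightarrow> 'n cfun" where
  "diff_quot F h n x = real (Suc n) *\<^sub>R (F (x + (1 / real (Suc n)) *\<^sub>R h) - F x)"

lemma line_has_derivative:
  assumes "c1c F"
  shows "((\<lambda>t. F (x + t *\<^sub>R h)) has_derivative (\<lambda>s. s *\<^sub>R frechet_derivative F (at (x + t *\<^sub>R h)) h)) (at t)"
proof -
  have l: "linear (frechet_derivative F (at (x + t *\<^sub>R h)))"
    using assms by (intro linear_frechet_derivative) (auto simp: c1c_def)
  have "((\<lambda>t. x + t *\<^sub>R h) has_derivative (\<lambda>s. s *\<^sub>R h)) (at t)" by (auto intro!: derivative_eq_intros)
  from has_derivative_compose[OF this c1c_has_derivative[OF assms]]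
  show ?thesis by (simp add: linear_scale[OF l])
qed

lemma diff_quot_tendsto:
  assumes "c1c F"
  shows "(\<lambda>n. diff_quot F h n x) \<longlonglongrightarrow> frechet_derivative F (at x) h"
proof -
  let ?D = "frechet_derivative F (at x) h"
  have "((\<lambda>s. norm (F (x + (0 + s) *\<^sub>R h) - F (x + 0 *\<^sub>R h) - s *\<^sub>R ?D) / norm s) \<longlongrightarrow> 0) (at 0)"
    using line_has_derivative[OF assms, of x h 0] by (simp add: has_derivative_at)
  moreover have "filterlim (\<lambda>n. 1 / real (Suc n)) (at 0) sequentially"
    by (intro filterlim_atI lim_1_over_n[THEN LIMSEQ_Suc]) auto
  ultimately have "(\<lambda>n. norm (F (x + (0 + 1 / real (Suc n)) *\<^sub>R h) - F (x + 0 *\<^sub>R h) - (1 / real (Suc n)) *\<^sub>R ?D) / norm (1 / real (Suc n))) \<longlonglongrightarrow> 0"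
    by (rule filterlim_compose)
  moreover have "norm (F (x + (0 + 1 / real (Suc n)) *\<^sub>R h) - F (x + 0 *\<^sub>R h) - (1 / real (Suc n)) *\<^sub>R ?D) / norm (1 / real (Suc n))
      = norm (diff_quot F h n x - ?D)" for n
  proof -
    have "diff_quot F h n x - ?D = real (Suc n) *\<^sub>R (F (x + (0 + 1 / real (Suc n)) *\<^sub>R h) - F (x + 0 *\<^sub>R h) - (1 / real (Suc n)) *\<^sub>R ?D)"
      unfolding diff_quot_def scaleR_diff_right by simp
    then show ?thesis by simp
  qed
  ultimately have "(\<lambda>n. norm (diff_quot F h n x - ?D)) \<longlonglongrightarrow> 0" by simp
  then show ?thesis by (simp add: LIM_zero_iff tendsto_norm_zero_iff)
qed

lemma diff_quot_bound:
  assumes "c1c F" "\<And>x. cmod (frechet_derivative F (at x) h) \<le> B"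
  shows "cmod (diff_quot F h n x) \<le> B"
proof -
  let ?r = "1 / real (Suc n)"
  have "norm (F (x + ?r *\<^sub>R h) - F (x + 0 *\<^sub>R h)) \<le> B * norm (?r - 0)"
  proof (rule differentiable_bound[of UNIV "\<lambda>t. F (x + t *\<^sub>R h)" "\<lambda>t s. s *\<^sub>R frechet_derivative F (at (x + t *\<^sub>R h)) h"])
    show "onorm (\<lambda>s. s *\<^sub>R frechet_derivative F (at (x + t *\<^sub>R h)) h) \<le> B" for t
      by (rule onorm_le) (use assms(2) in \<open>auto simp: mult.commute[of B] intro: mult_left_mono\<close>)
  qed (use line_has_derivative[OF assms(1)] in auto)
  then have "cmod (F (x + ?r *\<^sub>R h) - F x) * real (Suc n) \<le> B" by (simp add: field_simps)
  then show ?thesis by (simp add: diff_quot_def mult.commute)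
qed

lemma cball_indicator_integrable:
  "integrable lborel (\<lambda>x. (c::real) * indicator (cball (0::real^'n::finite) R) x)"
proof (intro integrable_mult_right integrable_real_indicator)
  show "emeasure lborel (cball (0::real^'n) R) < \<infinity>" by (rule emeasure_bounded_finite) simp
qed simp

lemma integrable_bounded_support:
  fixes g :: "real^'n::finite \<Rightarrow> 'b::{banach,second_countable_topology}"
  assumes "g \<in> borel_measurable borel" "\<And>x. norm (g x) \<le> B" "\<And>x. R < norm x \<Longrightarrow> g x = 0"
  shows "integrable lborel g"
proof (rule Bochner_Integration.integrable_bound)
  show "integrable lborel (\<lambda>x. B * indicator (cball (0::real^'n) R) x)"
    by (rule cball_indicator_integrable)
  show "AE x in lborel. norm (g x) \<le> norm (B * indicator (cball (0::real^'n) R) x)"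
    using assms(2,3) by (intro AE_I2) (force simp: indicator_def intro: order.trans[OF _ abs_ge_self])
qed (use assms in auto)

lemma continuous_borel: "continuous_on UNIV (F :: 'n::finite cfun) \<Longrightarrow> F \<in> borel_measurable borel"
  by (rule borel_measurable_continuous_onI)

lemma diff_quot_continuous: "c1c F \<Longrightarrow> continuous_on UNIV (diff_quot F h n)"
  unfolding diff_quot_def[abs_def]
  by (intro continuous_intros continuous_on_compose2[OF c1c_continuous] c1c_continuous) auto

text \<open>Difference quotients inherit every bound of the derivative and are supported in a fixed ball, so dominated
  convergence applies.\<close>

lemma diff_quot_integrals:
  assumes F: "c1c F"
  shows "(\<lambda>n. integral\<^sup>L lborel (diff_quot F h n)) \<longlonglongrightarrow> integral\<^sup>L lborel (\<lambda>x. frechet_derivative F (at x) h)"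
    "(\<lambda>n. integral\<^sup>L lborel (\<lambda>x. (cmod (diff_quot F h n x))\<^sup>2)) \<longlonglongrightarrow> integral\<^sup>L lborel (\<lambda>x. (cmod (frechet_derivative F (at x) h))\<^sup>2)"
    "integrable lborel (\<lambda>x. (cmod (diff_quot F h n x))\<^sup>2)"
    "integrable lborel (\<lambda>x. frechet_derivative F (at x) h)" "integrable lborel (\<lambda>x. (cmod (frechet_derivative F (at x) h))\<^sup>2)"
proof -
  obtain R B where RB: "0 \<le> R" "0 \<le> B" "\<And>x. R < norm x \<Longrightarrow> F x = 0" "\<And>x h. R < norm x \<Longrightarrow> frechet_derivative F (at x) h = 0"
    "\<And>x. cmod (frechet_derivative F (at x) h) \<le> B" by (rule c1c_support[OF F, of h]) blast
  let ?D = "\<lambda>x. frechet_derivative F (at x) h"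
  define S where "S = R + norm h"
  have qb: "cmod (diff_quot F h n x) \<le> B" for n x by (rule diff_quot_bound[OF F RB(5)])
  have qs: "diff_quot F h n x = 0" if "S < norm x" for n x
  proof -
    have "norm ((1 / real (Suc n)) *\<^sub>R h) \<le> norm h" by (simp add: divide_le_eq_1 mult_le_cancel_right1 field_simps)
    then have "R < norm (x + (1 / real (Suc n)) *\<^sub>R h)"
      using that norm_triangle_ineq2[of x "- (1 / real (Suc n)) *\<^sub>R h"] by (simp add: S_def)
    moreover have "R < norm x" using that norm_ge_zero[of h] unfolding S_def by linarith
    ultimately show ?thesis using RB(3) by (simp add: diff_quot_def)
  qed
  have Ds: "?D x = 0" if "S < norm x" for x
  proof (rule RB(4))
    show "R < norm x" using that norm_ge_zero[of h] unfolding S_def by linarith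
  qed
  have qm[measurable]: "diff_quot F h n \<in> borel_measurable borel" for n
    by (intro continuous_borel diff_quot_continuous F)
  have Dm[measurable]: "?D \<in> borel_measurable borel" by (intro continuous_borel c1c_dirderiv_continuous F)
  have iw: "integrable lborel (\<lambda>x. c * indicator (cball (0::real^'a) S) x)" for c :: real
    by (rule cball_indicator_integrable)
  show "(\<lambda>n. integral\<^sup>L lborel (diff_quot F h n)) \<longlonglongrightarrow> integral\<^sup>L lborel ?D"
  proof (rule integral_dominated_convergence[OF _ _ iw[of B]])
    show "AE x in lborel. cmod (diff_quot F h n x) \<le> B * indicator (cball 0 S) x" for n
      using qb qs by (intro AE_I2) (force simp: indicator_def not_le)
  qed (use diff_quot_tendsto[OF F] in auto)
  have sq: "(cmod (diff_quot F h n x))\<^sup>2 \<le> B\<^sup>2" for n x using qb by (intro power_mono) auto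
  have sqD: "(cmod (?D x))\<^sup>2 \<le> B\<^sup>2" for x using RB(5) by (intro power_mono) auto
  show "(\<lambda>n. integral\<^sup>L lborel (\<lambda>x. (cmod (diff_quot F h n x))\<^sup>2)) \<longlonglongrightarrow> integral\<^sup>L lborel (\<lambda>x. (cmod (?D x))\<^sup>2)"
  proof (rule integral_dominated_convergence[OF _ _ iw[of "B\<^sup>2"]])
    show "AE x in lborel. norm ((cmod (diff_quot F h n x))\<^sup>2) \<le> B\<^sup>2 * indicator (cball 0 S) x" for n
      using sq qs by (intro AE_I2) (force simp: indicator_def not_le)
    show "AE x in lborel. (\<lambda>n. (cmod (diff_quot F h n x))\<^sup>2) \<longlonglongrightarrow> (cmod (?D x))\<^sup>2"
      by (intro AE_I2 tendsto_intros diff_quot_tendsto F)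
  qed auto
  show "integrable lborel (\<lambda>x. (cmod (diff_quot F h n x))\<^sup>2)"
    by (rule integrable_bounded_support[of _ "B\<^sup>2" S]) (use sq qs in auto)
  show "integrable lborel ?D" by (rule integrable_bounded_support[of _ B S]) (use RB(5) Ds in auto)
  show "integrable lborel (\<lambda>x. (cmod (?D x))\<^sup>2)"
    by (rule integrable_bounded_support[of _ "B\<^sup>2" S]) (use sqD Ds in auto)
qed

lemma nn_integral_lborel_shift:
  fixes f :: "real^'n::finite \<Rightarrow> ennreal"
  assumes [measurable]: "f \<in> borel_measurable borel"
  shows "(\<integral>\<^sup>+x. f (x + c) \<partial>lborel) = (\<integral>\<^sup>+x. f x \<partial>lborel)"
proof -
  have "(\<integral>\<^sup>+x. f x \<partial>lborel) = (\<integral>\<^sup>+x. f x \<partial>distr lborel borel ((+) c))" by (simp add: lborel_distr_plus)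
  also have "\<dots> = (\<integral>\<^sup>+x. f (c + x) \<partial>lborel)" by (rule nn_integral_distr) auto
  finally show ?thesis by (simp add: add.commute)
qed

lemma integral_lborel_shift:
  fixes f :: "'n::finite cfun"
  assumes [measurable]: "f \<in> borel_measurable borel"
  shows "(\<integral>x. f (x + c) \<partial>lborel) = (\<integral>x. f x \<partial>lborel)"
proof -
  have "(\<integral>x. f x \<partial>lborel) = (\<integral>x. f x \<partial>distr lborel borel ((+) c))" by (simp add: lborel_distr_plus)
  also have "\<dots> = (\<integral>x. f (c + x) \<partial>lborel)" by (rule integral_distr) auto
  finally show ?thesis by (simp add: add.commute)
qed

text \<open>By translation invariance the integral of every difference quotient vanishes.\<close>

lemma integral_partial_deriv_zero:
  fixes F :: "'n::finite cfun"
  assumes F: "c1c F"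
  shows "integral\<^sup>L lborel (partial_deriv i F) = 0"
proof -
  let ?h = "axis i (1::real) :: real^'n"
  obtain R B where RB: "0 \<le> R" "\<And>x. R < norm x \<Longrightarrow> F x = 0" "\<And>x. cmod (F x) \<le> B" by (rule c1c_support[OF F]) blast
  have Fm[measurable]: "F \<in> borel_measurable borel" by (intro continuous_borel c1c_continuous F)
  have i: "integrable lborel F" by (rule integrable_bounded_support[of _ B R]) (use RB in auto)
  have "integral\<^sup>L lborel (diff_quot F ?h n) = 0" for n
  proof -
    let ?c = "(1 / real (Suc n)) *\<^sub>R ?h"
    have ic: "integrable lborel (\<lambda>x. F (x + ?c))"
    proof (rule integrable_bounded_support[of _ B "R + norm ?c"])
      fix x :: "real^'n" assume "R + norm ?c < norm x"
      then have "R < norm (x + ?c)" using norm_triangle_ineq2[of x "- ?c"] by simp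
      then show "F (x + ?c) = 0" by (rule RB)
    qed (use RB in auto)
    have "integral\<^sup>L lborel (diff_quot F ?h n) = real (Suc n) *\<^sub>R (integral\<^sup>L lborel (\<lambda>x. F (x + ?c)) - integral\<^sup>L lborel F)"
      unfolding diff_quot_def[abs_def] by (simp only: integral_scaleR_right Bochner_Integration.integral_diff[OF ic i])
    then show ?thesis by (simp only: integral_lborel_shift[OF Fm]) simp
  qed
  then have "(\<lambda>n. 0) \<longlonglongrightarrow> integral\<^sup>L lborel (\<lambda>x. frechet_derivative F (at x) ?h)"
    using diff_quot_integrals(1)[OF F, of ?h] by simp
  then show ?thesis by (simp add: LIMSEQ_const_iff partial_deriv_def[abs_def])
qed

text \<open>The shift by \<open>h\<close> is split into \<open>n\<close> shifts by \<open>h/n\<close>. By the Cauchy--Schwarz inequality and translation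
  invariance the left-hand side is at most \<open>n\<^sup>2\<close> times the integral for one such shift, which is the
  integral of the squared difference quotient; then \<open>n\<close> tends to infinity. The left integral is taken in
  \<open>[0, \<infinity>]\<close> so that it may be integrated over \<open>h\<close> later.\<close>

lemma translation_estimate:
  fixes F :: "'n::finite cfun"
  assumes F: "c1c F"
  shows "(\<integral>\<^sup>+x. ennreal ((cmod (F (x + h) - F x))\<^sup>2) \<partial>lborel) \<le> ennreal (integral\<^sup>L lborel (\<lambda>x. (cmod (frechet_derivative F (at x) h))\<^sup>2))"
proof -
  have Fm[measurable]: "F \<in> borel_measurable borel" by (intro continuous_borel c1c_continuous F)
  have "(\<integral>\<^sup>+x. ennreal ((cmod (F (x + h) - F x))\<^sup>2) \<partial>lborel) \<le> ennreal (integral\<^sup>L lborel (\<lambda>x. (cmod (diff_quot F h m x))\<^sup>2))" for m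
  proof -
    define n where "n = Suc m"
    have n: "0 < n" by (simp add: n_def)
    define c where "c = (1 / real n) *\<^sub>R h"
    define d where "d = (\<lambda>k x. F (x + real (Suc k) *\<^sub>R c) - F (x + real k *\<^sub>R c))"
    have pw: "(cmod (F (x + h) - F x))\<^sup>2 \<le> real n * (\<Sum>k<n. (cmod (d k x))\<^sup>2)" for x
    proof -
      have "F (x + h) - F x = (\<Sum>k<n. d k x)"
        unfolding d_def using n by (subst sum_lessThan_telescope) (simp add: c_def)
      then have "cmod (F (x + h) - F x) \<le> (\<Sum>k<n. 1 * cmod (d k x))" by (simp add: norm_sum)
      then have "(cmod (F (x + h) - F x))\<^sup>2 \<le> (\<Sum>k<n. 1 * cmod (d k x))\<^sup>2" by (intro power_mono) auto
      also have "\<dots> \<le> (\<Sum>k<n. 1\<^sup>2) * (\<Sum>k<n. (cmod (d k x))\<^sup>2)" by (rule Cauchy_Schwarz_ineq_sum)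
      finally show ?thesis by simp
    qed
    have [measurable]: "(\<lambda>x. F (x + c)) \<in> borel_measurable borel" for c by measurable
    have dm[measurable]: "d k \<in> borel_measurable borel" for k unfolding d_def by measurable
    have "(\<integral>\<^sup>+x. ennreal ((cmod (F (x + h) - F x))\<^sup>2) \<partial>lborel) \<le> (\<integral>\<^sup>+x. (\<Sum>k<n. ennreal (real n) * ennreal ((cmod (d k x))\<^sup>2)) \<partial>lborel)"
      using pw by (intro nn_integral_mono)
        (simp add: sum_distrib_left[symmetric] ennreal_mult[symmetric] sum_nonneg ennreal_leI)
    also have "\<dots> = (\<Sum>k<n. ennreal (real n) * (\<integral>\<^sup>+x. ennreal ((cmod (d k x))\<^sup>2) \<partial>lborel))"
      by (simp add: nn_integral_sum nn_integral_cmult)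
    also have "\<dots> = (\<Sum>k<n. ennreal (real n) * (\<integral>\<^sup>+x. ennreal ((cmod (d 0 x))\<^sup>2) \<partial>lborel))"
    proof (intro sum.cong refl arg_cong[where f = "(*) (ennreal (real n))"])
      fix k
      have "(\<integral>\<^sup>+x. ennreal ((cmod (d 0 (x + real k *\<^sub>R c)))\<^sup>2) \<partial>lborel) = (\<integral>\<^sup>+x. ennreal ((cmod (d 0 x))\<^sup>2) \<partial>lborel)"
        by (rule nn_integral_lborel_shift) measurable
      moreover have "d 0 (x + real k *\<^sub>R c) = d k x" for x by (simp add: d_def algebra_simps)
      ultimately show "(\<integral>\<^sup>+x. ennreal ((cmod (d k x))\<^sup>2) \<partial>lborel) = (\<integral>\<^sup>+x. ennreal ((cmod (d 0 x))\<^sup>2) \<partial>lborel)" by simp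
    qed
    also have "\<dots> = (\<integral>\<^sup>+x. ennreal (real n * real n) * ennreal ((cmod (d 0 x))\<^sup>2) \<partial>lborel)"
      by (subst nn_integral_cmult) (auto simp: ennreal_mult mult.assoc ennreal_of_nat_eq_real_of_nat)
    also have "\<dots> = (\<integral>\<^sup>+x. ennreal ((cmod (diff_quot F h m x))\<^sup>2) \<partial>lborel)"
      by (intro nn_integral_cong)
         (simp add: diff_quot_def d_def c_def n_def power_mult_distrib power2_eq_square ennreal_mult[symmetric] of_nat_Suc[of 0] del: of_nat_Suc)
    also have "\<dots> = ennreal (integral\<^sup>L lborel (\<lambda>x. (cmod (diff_quot F h m x))\<^sup>2))"
      by (rule nn_integral_eq_integral[OF diff_quot_integrals(3)[OF F]]) auto
    finally show ?thesis .
  qed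
  note le = this
  have lim: "(\<lambda>m. ennreal (integral\<^sup>L lborel (\<lambda>x. (cmod (diff_quot F h m x))\<^sup>2))) \<longlonglongrightarrow>
      ennreal (integral\<^sup>L lborel (\<lambda>x. (cmod (frechet_derivative F (at x) h))\<^sup>2))"
    by (intro tendsto_ennrealI diff_quot_integrals F)
  show ?thesis by (rule LIMSEQ_le_const[OF lim]) (use le in blast)
qed

lemma dirderiv_sq_le:
  fixes F :: "'n::finite cfun"
  assumes F: "c1c F"
  shows "(cmod (frechet_derivative F (at x) h))\<^sup>2 \<le> (\<Sum>i\<in>UNIV. (h $ i)\<^sup>2) * (\<Sum>i\<in>UNIV. (cmod (partial_deriv i F x))\<^sup>2)"
proof -
  have "cmod (frechet_derivative F (at x) h) = cmod (\<Sum>i\<in>UNIV. h $ i *\<^sub>R partial_deriv i F x)"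
    using F by (subst frechet_derivative_expand) (auto simp: c1c_def)
  also have "\<dots> \<le> (\<Sum>i\<in>UNIV. \<bar>h $ i\<bar> * cmod (partial_deriv i F x))"
    by (rule sum_norm_le) simp
  finally have "(cmod (frechet_derivative F (at x) h))\<^sup>2 \<le> (\<Sum>i\<in>UNIV. \<bar>h $ i\<bar> * cmod (partial_deriv i F x))\<^sup>2"
    by (intro power_mono) auto
  also have "\<dots> \<le> (\<Sum>i\<in>UNIV. \<bar>h $ i\<bar>\<^sup>2) * (\<Sum>i\<in>UNIV. (cmod (partial_deriv i F x))\<^sup>2)"
    by (rule Cauchy_Schwarz_ineq_sum)
  finally show ?thesis by simp
qed

section \<open>Weak derivatives and Sobolev spaces\<close>

lemma C_k_add: "C_k k u \<Longrightarrow> C_k k v \<Longrightarrow> C_k k (u + v)"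
proof (induction k arbitrary: u v)
  case 0
  then show ?case by (simp add: plus_fun_def continuous_on_add)
next
  case (Suc k)
  have d: "((u + v) has_derivative (\<lambda>h. frechet_derivative u (at x) h + frechet_derivative v (at x) h)) (at x)" for x
    unfolding plus_fun_def using Suc.prems by (intro has_derivative_add) (auto simp: frechet_derivative_works)
  have p: "partial_deriv i (u + v) = partial_deriv i u + partial_deriv i v" for i
    by (subst partial_deriv_eq[OF d]) (simp add: partial_deriv_def plus_fun_def)
  have "(u + v) differentiable (at x)" for x using d by (rule differentiableI)
  then show ?case using Suc.prems unfolding C_k.simps p by (blast intro: Suc.IH)
qed

lemma C_k_cscale: "C_k k v \<Longrightarrow> C_k k (cscale c v)"
proof (induction k arbitrary: v)
  case 0
  then show ?case by (simp add: cscale_def continuous_on_mult_left)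
next
  case (Suc k)
  have d: "(cscale c v has_derivative (\<lambda>h. c * frechet_derivative v (at x) h)) (at x)" for x
    unfolding cscale_def using Suc.prems by (intro has_derivative_mult_right) (auto simp: frechet_derivative_works)
  have p: "partial_deriv i (cscale c v) = cscale c (partial_deriv i v)" for i
    by (subst partial_deriv_eq[OF d]) (simp add: partial_deriv_def cscale_def)
  have "cscale c v differentiable (at x)" for x using d by (rule differentiableI)
  then show ?case using Suc.prems unfolding C_k.simps p by (blast intro: Suc.IH)
qed

lemma test_subspace: "cfun.subspace (test_functions \<Omega>)"
proof (rule cfun.subspaceI)
  have "smooth_gen (0 :: 'a cfun)" unfolding zero_fun_def by (rule smooth_gen.const)
  then show "0 \<in> test_functions \<Omega>"
    by (auto simp: test_functions_def intro: C_k_smooth_gen exI[of _ "{}"])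
next
  fix u v assume "u \<in> test_functions \<Omega>" "v \<in> test_functions \<Omega>"
  then obtain K L where "compact K" "K \<subseteq> \<Omega>" "\<forall>x. x \<notin> K \<longrightarrow> u x = 0" "compact L" "L \<subseteq> \<Omega>" "\<forall>x. x \<notin> L \<longrightarrow> v x = 0"
    "\<forall>k. C_k k u" "\<forall>k. C_k k v" by (auto simp: test_functions_def)
  then show "u + v \<in> test_functions \<Omega>"
    by (auto simp: test_functions_def intro!: C_k_add exI[of _ "K \<union> L"])
next
  fix c and v :: "'a cfun" assume "v \<in> test_functions \<Omega>"
  then show "cscale c v \<in> test_functions \<Omega>" unfolding test_functions_def
    by (auto intro!: C_k_cscale) 
qed

lemma test_c1c: "\<phi> \<in> test_functions \<Omega> \<Longrightarrow> c1c \<phi>"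
proof -
  assume p: "\<phi> \<in> test_functions \<Omega>"
  then have "C_k (Suc 0) \<phi>" unfolding test_functions_def by blast
  then show ?thesis using p unfolding c1c_def test_functions_def by auto
qed

lemma test_partial_deriv:
  assumes "\<phi> \<in> test_functions \<Omega>"
  shows "partial_deriv i \<phi> \<in> test_functions \<Omega>"
proof -
  obtain K where K: "compact K" "K \<subseteq> \<Omega>" "\<And>x. x \<notin> K \<Longrightarrow> \<phi> x = 0" using assms by (auto simp: test_functions_def)
  have "C_k k (partial_deriv i \<phi>)" for k
  proof -
    have "C_k (Suc k) \<phi>" using assms unfolding test_functions_def by blast
    then show ?thesis by simp
  qed
  moreover have "partial_deriv i \<phi> x = 0" if "x \<notin> K" for x
    using frechet_derivative_zero_outside[OF compact_imp_closed[OF K(1)] K(3) that] by (simp add: partial_deriv_def)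
  ultimately show ?thesis using K unfolding test_functions_def by blast
qed

lemma partial_deriv_diff:
  assumes "c1c u" "c1c v"
  shows "partial_deriv i (u - v) = partial_deriv i u - partial_deriv i v"
proof -
  have d: "((u - v) has_derivative (\<lambda>h. frechet_derivative u (at x) h - frechet_derivative v (at x) h)) (at x)" for x
    unfolding fun_diff_def using assms by (intro has_derivative_diff c1c_has_derivative)
  show ?thesis by (subst partial_deriv_eq[OF d]) (simp add: partial_deriv_def fun_diff_def)
qed

lemma integral_lebesgue_on_eq_lborel:
  fixes g :: "real^'n::finite \<Rightarrow> 'b::{banach,second_countable_topology}"
  assumes "g \<in> borel_measurable borel" "\<And>x. x \<notin> \<Omega> \<Longrightarrow> g x = 0" "\<Omega> \<in> sets lebesgue"
  shows "integral\<^sup>L (lebesgue_on \<Omega>) g = integral\<^sup>L lborel g"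
proof -
  have "integral\<^sup>L (lebesgue_on \<Omega>) g = integral\<^sup>L lebesgue (\<lambda>x. indicator \<Omega> x *\<^sub>R g x)"
    using assms by (intro integral_restrict_space) auto
  also have "(\<lambda>x. indicator \<Omega> x *\<^sub>R g x) = g" using assms(2) by (auto simp: indicator_def fun_eq_iff)
  also have "integral\<^sup>L lebesgue g = integral\<^sup>L lborel g" using assms(1) by (intro integral_completion) simp
  finally show ?thesis .
qed

lemma L2_mult_bound:
  assumes "v \<in> L2 \<Omega>" "w \<in> L2 \<Omega>"
  shows "cmod (integral\<^sup>L (lebesgue_on \<Omega>) (\<lambda>x. v x * w x)) \<le> L2_norm \<Omega> v * L2_norm \<Omega> w"
proof -
  have [measurable]: "w \<in> borel_measurable (lebesgue_on \<Omega>)" using assms by (simp add: L2_def)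
  have "(\<lambda>x. cnj (w x)) \<in> borel_measurable (lebesgue_on \<Omega>)"
    by (rule measurable_compose[of w _ borel cnj]) (auto intro!: borel_measurable_continuous_onI continuous_intros)
  then have w: "(\<lambda>x. cnj (w x)) \<in> L2 \<Omega>" using assms by (simp add: L2_def)
  have "integral\<^sup>L (lebesgue_on \<Omega>) (\<lambda>x. v x * w x) = L2_inner \<Omega> v (\<lambda>x. cnj (w x))" by (simp add: L2_inner_def)
  also have "cmod \<dots> \<le> L2_norm \<Omega> v * L2_norm \<Omega> (\<lambda>x. cnj (w x))" by (rule L2_Cauchy_Schwarz[OF assms(1) w])
  also have "L2_norm \<Omega> (\<lambda>x. cnj (w x)) = L2_norm \<Omega> w" by (simp add: L2_norm_def)
  finally show ?thesis .
qed

text \<open>The norm as a Euclidean norm of \<open>L2\<close> norms, which makes Minkowski's inequality for finite sums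
  available.\<close>

lemma H1_norm_L2_set:
  "H1_norm \<Omega> v = L2_set (\<lambda>j. case j of None \<Rightarrow> L2_norm \<Omega> v | Some i \<Rightarrow> L2_norm \<Omega> (weak_deriv \<Omega> i v)) UNIV"
  by (simp add: H1_norm_def L2_set_def UNIV_option_conv sum.reindex)

lemma H1_norm_nonneg [simp]: "0 \<le> H1_norm \<Omega> v" by (simp add: H1_norm_def sum_nonneg)

lemma H1_norm_sq: "(H1_norm \<Omega> v)\<^sup>2 = (L2_norm \<Omega> v)\<^sup>2 + (\<Sum>i\<in>UNIV. (L2_norm \<Omega> (weak_deriv \<Omega> i v))\<^sup>2)"
  by (simp add: H1_norm_def sum_nonneg)

lemma L2_norm_le_H1_norm: "L2_norm \<Omega> v \<le> H1_norm \<Omega> v"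
  by (rule power2_le_imp_le) (auto simp: H1_norm_sq sum_nonneg)

lemma weak_deriv_le_H1_norm: "L2_norm \<Omega> (weak_deriv \<Omega> i v) \<le> H1_norm \<Omega> v"
proof (rule power2_le_imp_le)
  have "(L2_norm \<Omega> (weak_deriv \<Omega> i v))\<^sup>2 \<le> (\<Sum>i\<in>UNIV. (L2_norm \<Omega> (weak_deriv \<Omega> i v))\<^sup>2)"
    by (rule member_le_sum) auto
  then show "(L2_norm \<Omega> (weak_deriv \<Omega> i v))\<^sup>2 \<le> (H1_norm \<Omega> v)\<^sup>2"
    using zero_le_power2[of "L2_norm \<Omega> v"] by (simp only: H1_norm_sq)
qed simp

locale bounded_open_set =
  fixes \<Omega> :: "(real^'n::finite) set"
  assumes open_set: "open \<Omega>" and bounded_set: "bounded \<Omega>"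
begin

lemma lmeas: "\<Omega> \<in> lmeasurable"
  using open_set bounded_set by (intro bounded_set_imp_lmeasurable sets_completionI_sets) auto

lemma sets_\<Omega>: "\<Omega> \<in> sets lebesgue" using lmeas by (rule fmeasurableD)

lemma test_L2:
  assumes "\<phi> \<in> test_functions \<Omega>"
  shows "\<phi> \<in> L2 \<Omega>"
proof -
  have c: "c1c \<phi>" using assms by (rule test_c1c)
  obtain R B where B: "\<And>x. cmod (\<phi> x) \<le> B" by (rule c1c_support[OF c]) blast
  have "\<phi> \<in> borel_measurable borel" by (intro continuous_borel c1c_continuous c)
  then have "\<phi> \<in> borel_measurable lebesgue" by (simp add: measurable_completion)
  then have m[measurable]: "\<phi> \<in> borel_measurable (lebesgue_on \<Omega>)" by (rule measurable_restrict_space1)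
  have "integrable (lebesgue_on \<Omega>) (\<lambda>x. (cmod (\<phi> x))\<^sup>2)"
  proof (rule finite_measure.integrable_const_bound[OF finite_measure_lebesgue_on[OF lmeas]])
    show "AE x in lebesgue_on \<Omega>. norm ((cmod (\<phi> x))\<^sup>2) \<le> B\<^sup>2" using B by (intro AE_I2) (auto intro: power_mono)
  qed measurable
  then show ?thesis using m by (simp add: L2_def)
qed

text \<open>Integration by parts: the derivative of the product of two test functions integrates to zero.\<close>

lemma weak_deriv_test:
  assumes \<phi>: "\<phi> \<in> test_functions \<Omega>"
  shows "is_weak_deriv \<Omega> i \<phi> (partial_deriv i \<phi>)"
  unfolding is_weak_deriv_def
proof (intro conjI ballI)
  show "partial_deriv i \<phi> \<in> L2 \<Omega>" by (intro test_L2 test_partial_deriv \<phi>)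
  fix \<eta> assume \<eta>: "\<eta> \<in> test_functions \<Omega>"
  have c: "c1c \<phi>" "c1c \<eta>" using \<phi> \<eta> by (auto intro: test_c1c)
  define F where "F = (\<lambda>x. \<phi> x * \<eta> x)"
  have d: "(F has_derivative (\<lambda>h. \<phi> x * frechet_derivative \<eta> (at x) h + frechet_derivative \<phi> (at x) h * \<eta> x)) (at x)" for x
    unfolding F_def by (intro has_derivative_mult c1c_has_derivative c)
  have pF: "partial_deriv i F = (\<lambda>x. \<phi> x * partial_deriv i \<eta> x + partial_deriv i \<phi> x * \<eta> x)" for i
    by (subst partial_deriv_eq[OF d]) (simp add: partial_deriv_def)
  obtain K where K: "compact K" "K \<subseteq> \<Omega>" "\<And>x. x \<notin> K \<Longrightarrow> \<phi> x = 0" using \<phi> by (auto simp: test_functions_def)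
  have cF: "c1c F"
    unfolding c1c_def
  proof (intro conjI allI exI[of _ K])
    show "F differentiable at x" for x using d by (rule differentiableI)
    have pc: "continuous_on UNIV (partial_deriv i \<phi>)" "continuous_on UNIV (partial_deriv i \<eta>)" for i
      using c by (auto simp: c1c_def)
    show "continuous_on UNIV (partial_deriv i F)" for i
      unfolding pF by (intro continuous_on_add continuous_on_mult pc c1c_continuous[OF c(1)] c1c_continuous[OF c(2)])
    show "x \<notin> K \<longrightarrow> F x = 0" for x using K by (simp add: F_def)
  qed (use K in auto)
  have pd: "partial_deriv i \<phi> x = 0" if "x \<notin> K" for x
    using frechet_derivative_zero_outside[OF compact_imp_closed[OF K(1)] K(3) that] by (simp add: partial_deriv_def)
  have "0 = integral\<^sup>L lborel (partial_deriv i F)" by (rule integral_partial_deriv_zero[OF cF, symmetric])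
  also have "\<dots> = integral\<^sup>L (lebesgue_on \<Omega>) (partial_deriv i F)"
  proof (rule integral_lebesgue_on_eq_lborel[symmetric, OF _ _ sets_\<Omega>])
    show "partial_deriv i F \<in> borel_measurable borel" using cF by (intro continuous_borel) (simp add: c1c_def)
    fix x assume "x \<notin> \<Omega>"
    then have "x \<notin> K" using K by blast
    then show "partial_deriv i F x = 0" unfolding pF using pd K(3) by simp
  qed
  also have "\<dots> = integral\<^sup>L (lebesgue_on \<Omega>) (\<lambda>x. \<phi> x * partial_deriv i \<eta> x) + integral\<^sup>L (lebesgue_on \<Omega>) (\<lambda>x. partial_deriv i \<phi> x * \<eta> x)"
    unfolding pF by (intro Bochner_Integration.integral_add L2_integrable_mult test_L2 test_partial_deriv \<phi> \<eta>)
  finally show "integral\<^sup>L (lebesgue_on \<Omega>) (\<lambda>x. \<phi> x * partial_deriv i \<eta> x) = - integral\<^sup>L (lebesgue_on \<Omega>) (\<lambda>x. partial_deriv i \<phi> x * \<eta> x)"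
    by (simp add: eq_neg_iff_add_eq_0)
qed

lemma weak_deriv_unique:
  assumes "is_weak_deriv \<Omega> i v g" "is_weak_deriv \<Omega> i v g'"
  shows "AE x in lebesgue_on \<Omega>. g x = g' x"
proof -
  have L: "g \<in> L2 \<Omega>" "g' \<in> L2 \<Omega>" using assms by (auto simp: is_weak_deriv_def)
  have "AE x in lebesgue_on \<Omega>. (g - g') x = 0"
  proof (rule AE_zero_of_orthogonal[OF _ _ open_set lmeas])
    show "integrable (lebesgue_on \<Omega>) (g - g')" by (intro L2_integrable lmeas L2_diff L)
    fix \<phi> assume \<phi>: "\<phi> \<in> test_functions \<Omega>"
    have "integral\<^sup>L (lebesgue_on \<Omega>) (\<lambda>x. (g - g') x * \<phi> x) =
        integral\<^sup>L (lebesgue_on \<Omega>) (\<lambda>x. g x * \<phi> x) - integral\<^sup>L (lebesgue_on \<Omega>) (\<lambda>x. g' x * \<phi> x)"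
      using L \<phi> by (simp add: left_diff_distrib L2_integrable_mult test_L2)
    also have "\<dots> = 0"
      using bspec[OF conjunct2[OF assms(1)[unfolded is_weak_deriv_def]] \<phi>] bspec[OF conjunct2[OF assms(2)[unfolded is_weak_deriv_def]] \<phi>]
      by simp
    finally show "integral\<^sup>L (lebesgue_on \<Omega>) (\<lambda>x. (g - g') x * \<phi> x) = 0" .
  qed
  then show ?thesis by simp
qed

lemma is_weak_deriv_add:
  assumes "u \<in> L2 \<Omega>" "v \<in> L2 \<Omega>" "is_weak_deriv \<Omega> i u f" "is_weak_deriv \<Omega> i v g"
  shows "is_weak_deriv \<Omega> i (u + v) (f + g)"
  using assms unfolding is_weak_deriv_def
  by (auto simp: cfun.subspace_add[OF L2_subspace] distrib_right L2_integrable_mult test_L2 test_partial_deriv)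

lemma is_weak_deriv_cscale:
  assumes "v \<in> L2 \<Omega>" "is_weak_deriv \<Omega> i v g"
  shows "is_weak_deriv \<Omega> i (cscale c v) (cscale c g)"
  using assms unfolding is_weak_deriv_def
  by (auto simp: cfun.subspace_scale[OF L2_subspace] mult.assoc)

lemma cfun_diff: "u - v = u + cscale (-1) (v :: 'n cfun)" by (simp add: fun_eq_iff)

lemma is_weak_deriv_diff:
  assumes "u \<in> L2 \<Omega>" "v \<in> L2 \<Omega>" "is_weak_deriv \<Omega> i u f" "is_weak_deriv \<Omega> i v g"
  shows "is_weak_deriv \<Omega> i (u - v) (f - g)"
  unfolding cfun_diff by (intro is_weak_deriv_add is_weak_deriv_cscale assms cfun.subspace_scale[OF L2_subspace])

lemma H1_weak_deriv:
  assumes "v \<in> H1 \<Omega>"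
  shows "is_weak_deriv \<Omega> i v (weak_deriv \<Omega> i v)"
proof -
  have ex: "\<exists>g. is_weak_deriv \<Omega> i v g" using assms unfolding H1_def by blast
  show ?thesis unfolding weak_deriv_def by (rule someI_ex[of "is_weak_deriv \<Omega> i v", OF ex])
qed

lemma H1_subspace: "cfun.subspace (H1 \<Omega>)"
proof (rule cfun.subspaceI)
  have "is_weak_deriv \<Omega> i 0 0" for i
    unfolding is_weak_deriv_def using cfun.subspace_0[OF L2_subspace] by simp
  then show "0 \<in> H1 \<Omega>" unfolding H1_def using cfun.subspace_0[OF L2_subspace] by blast
next
  fix u v assume "u \<in> H1 \<Omega>" "v \<in> H1 \<Omega>"
  then show "u + v \<in> H1 \<Omega>" unfolding H1_def
    by (auto intro: cfun.subspace_add[OF L2_subspace]) (meson is_weak_deriv_add)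
next
  fix c and v :: "'n cfun" assume "v \<in> H1 \<Omega>"
  then show "cscale c v \<in> H1 \<Omega>" unfolding H1_def
    by (auto intro: cfun.subspace_scale[OF L2_subspace]) (meson is_weak_deriv_cscale)
qed

lemma H1_L2: "v \<in> H1 \<Omega> \<Longrightarrow> v \<in> L2 \<Omega>" by (simp add: H1_def)

text \<open>The derivative chosen by \<open>weak_deriv\<close> agrees almost everywhere with any other one.\<close>

lemma weak_deriv_norm:
  assumes "is_weak_deriv \<Omega> i v g"
  shows "L2_norm \<Omega> (weak_deriv \<Omega> i v) = L2_norm \<Omega> g"
proof -
  have w: "is_weak_deriv \<Omega> i v (weak_deriv \<Omega> i v)" unfolding weak_deriv_def by (rule someI[of "is_weak_deriv \<Omega> i v", OF assms])
  have "AE x in lebesgue_on \<Omega>. g x = weak_deriv \<Omega> i v x" by (rule weak_deriv_unique[OF assms w])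
  moreover have "g \<in> L2 \<Omega>" "weak_deriv \<Omega> i v \<in> borel_measurable (lebesgue_on \<Omega>)"
    using assms w unfolding is_weak_deriv_def L2_def by blast+
  ultimately show ?thesis using L2_norm_AE_cong(1) by blast
qed

lemma test_H1: "\<phi> \<in> test_functions \<Omega> \<Longrightarrow> \<phi> \<in> H1 \<Omega>"
  unfolding H1_def using weak_deriv_test test_L2 by blast

lemma test_H1_norm_sq:
  "\<phi> \<in> test_functions \<Omega> \<Longrightarrow> (H1_norm \<Omega> \<phi>)\<^sup>2 = (L2_norm \<Omega> \<phi>)\<^sup>2 + (\<Sum>i\<in>UNIV. (L2_norm \<Omega> (partial_deriv i \<phi>))\<^sup>2)"
  by (simp add: H1_norm_sq weak_deriv_norm[OF weak_deriv_test])

lemma H1_norm_triangle: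
  assumes "u \<in> H1 \<Omega>" "v \<in> H1 \<Omega>"
  shows "H1_norm \<Omega> (u + v) \<le> H1_norm \<Omega> u + H1_norm \<Omega> v"
proof -
  let ?n = "\<lambda>v j. case j of None \<Rightarrow> L2_norm \<Omega> v | Some i \<Rightarrow> L2_norm \<Omega> (weak_deriv \<Omega> i v)"
  have wL: "weak_deriv \<Omega> i u \<in> L2 \<Omega>" "weak_deriv \<Omega> i v \<in> L2 \<Omega>" for i
    using H1_weak_deriv assms by (auto simp: is_weak_deriv_def)
  have "L2_norm \<Omega> (weak_deriv \<Omega> i (u + v)) = L2_norm \<Omega> (weak_deriv \<Omega> i u + weak_deriv \<Omega> i v)" for i
    by (intro weak_deriv_norm is_weak_deriv_add H1_L2 H1_weak_deriv assms)
  then have "?n (u + v) j \<le> ?n u j + ?n v j" for j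
    using L2_triangle[OF H1_L2 H1_L2, OF assms] L2_triangle[OF wL] by (cases j) auto
  then have "L2_set (?n (u + v)) UNIV \<le> L2_set (\<lambda>j. ?n u j + ?n v j) UNIV"
    by (intro L2_set_mono) (auto split: option.split)
  also have "\<dots> \<le> L2_set (?n u) UNIV + L2_set (?n v) UNIV" by (rule L2_set_triangle_ineq)
  finally show ?thesis by (simp only: H1_norm_L2_set)
qed

lemma H1_norm_cscale:
  assumes "v \<in> H1 \<Omega>"
  shows "H1_norm \<Omega> (cscale c v) = cmod c * H1_norm \<Omega> v"
proof -
  have "L2_norm \<Omega> (weak_deriv \<Omega> i (cscale c v)) = cmod c * L2_norm \<Omega> (weak_deriv \<Omega> i v)" for i
    using weak_deriv_norm[OF is_weak_deriv_cscale[OF H1_L2 H1_weak_deriv, OF assms assms]]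
    by (simp add: L2_norm_cscale)
  then show ?thesis
    by (simp add: H1_norm_def L2_norm_cscale power_mult_distrib sum_distrib_left[symmetric] distrib_left[symmetric] real_sqrt_mult)
qed

lemma H1_diff: "u \<in> H1 \<Omega> \<Longrightarrow> v \<in> H1 \<Omega> \<Longrightarrow> u - v \<in> H1 \<Omega>"
  by (rule cfun.subspace_diff[OF H1_subspace])

lemma H1_norm_minus: "u \<in> H1 \<Omega> \<Longrightarrow> v \<in> H1 \<Omega> \<Longrightarrow> H1_norm \<Omega> (u - v) = H1_norm \<Omega> (v - u)"
  using H1_norm_cscale[OF H1_diff, of u v "-1"] by (simp add: cscale_def fun_diff_def)

lemma H1_norm_diff_triangle:
  "u \<in> H1 \<Omega> \<Longrightarrow> v \<in> H1 \<Omega> \<Longrightarrow> w \<in> H1 \<Omega> \<Longrightarrow> H1_norm \<Omega> (u - w) \<le> H1_norm \<Omega> (u - v) + H1_norm \<Omega> (v - w)"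
  using H1_norm_triangle[OF H1_diff H1_diff, of u v v w] by simp

lemma H10_H1: "v \<in> H10 \<Omega> \<Longrightarrow> v \<in> H1 \<Omega>" by (simp add: H10_def)

lemma H1_norm_0: "H1_norm \<Omega> 0 = 0"
  using H1_norm_cscale[OF cfun.subspace_0[OF H1_subspace], of 0] by simp

lemma test_H10: "\<phi> \<in> test_functions \<Omega> \<Longrightarrow> \<phi> \<in> H10 \<Omega>"
  unfolding H10_def using test_H1 by (auto intro!: exI[of _ "\<lambda>_. \<phi>"] simp: H1_norm_0)

lemma H10_subspace: "cfun.subspace (H10 \<Omega>)"
proof (rule cfun.subspaceI)
  show "0 \<in> H10 \<Omega>" by (intro test_H10 cfun.subspace_0 test_subspace)
next
  fix u v assume u: "u \<in> H10 \<Omega>" and v: "v \<in> H10 \<Omega>"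
  obtain \<phi> where \<phi>: "\<And>m. \<phi> m \<in> test_functions \<Omega>" "(\<lambda>m::nat. H1_norm \<Omega> (\<phi> m - u)) \<longlonglongrightarrow> 0" using u by (auto simp: H10_def)
  obtain \<theta> where \<theta>: "\<And>m. \<theta> m \<in> test_functions \<Omega>" "(\<lambda>m::nat. H1_norm \<Omega> (\<theta> m - v)) \<longlonglongrightarrow> 0" using v by (auto simp: H10_def)
  have "(\<lambda>m. H1_norm \<Omega> ((\<phi> m + \<theta> m) - (u + v))) \<longlonglongrightarrow> 0"
  proof (rule tendsto_0_le[OF tendsto_add_zero[OF \<phi>(2) \<theta>(2)], of _ 1])
    have "H1_norm \<Omega> ((\<phi> m + \<theta> m) - (u + v)) \<le> H1_norm \<Omega> (\<phi> m - u) + H1_norm \<Omega> (\<theta> m - v)" for m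
    proof -
      have e: "(\<phi> m + \<theta> m) - (u + v) = (\<phi> m - u) + (\<theta> m - v)" by simp
      show ?thesis unfolding e by (intro H1_norm_triangle H1_diff test_H1 \<phi> \<theta> H10_H1 u v)
    qed
    then show "\<forall>\<^sub>F m in sequentially. norm (H1_norm \<Omega> ((\<phi> m + \<theta> m) - (u + v))) \<le> norm (H1_norm \<Omega> (\<phi> m - u) + H1_norm \<Omega> (\<theta> m - v)) * 1"
      by (intro always_eventually) simp
  qed
  moreover have "\<phi> m + \<theta> m \<in> test_functions \<Omega>" for m by (intro cfun.subspace_add[OF test_subspace] \<phi> \<theta>)
  moreover have "u + v \<in> H1 \<Omega>" by (intro cfun.subspace_add[OF H1_subspace] H10_H1 u v)
  ultimately show "u + v \<in> H10 \<Omega>" unfolding H10_def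
    by (intro CollectI conjI exI[of _ "\<lambda>m. \<phi> m + \<theta> m"] allI)
next
  fix c and v :: "'n cfun" assume v: "v \<in> H10 \<Omega>"
  obtain \<theta> where \<theta>: "\<And>m. \<theta> m \<in> test_functions \<Omega>" "(\<lambda>m::nat. H1_norm \<Omega> (\<theta> m - v)) \<longlonglongrightarrow> 0" using v by (auto simp: H10_def)
  have "H1_norm \<Omega> (cscale c (\<theta> m) - cscale c v) = cmod c * H1_norm \<Omega> (\<theta> m - v)" for m
  proof -
    have e: "cscale c (\<theta> m) - cscale c v = cscale c (\<theta> m - v)" by (simp add: fun_eq_iff right_diff_distrib)
    show ?thesis unfolding e by (intro H1_norm_cscale H1_diff test_H1 \<theta> H10_H1 v)
  qed
  then have "(\<lambda>m. H1_norm \<Omega> (cscale c (\<theta> m) - cscale c v)) \<longlonglongrightarrow> 0"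
    using tendsto_mult_right_zero[OF \<theta>(2), of "cmod c"] by simp
  moreover have "cscale c (\<theta> m) \<in> test_functions \<Omega>" for m by (intro cfun.subspace_scale[OF test_subspace] \<theta>)
  moreover have "cscale c v \<in> H1 \<Omega>" by (intro cfun.subspace_scale[OF H1_subspace] H10_H1 v)
  ultimately show "cscale c v \<in> H10 \<Omega>" unfolding H10_def
    by (intro CollectI conjI exI[of _ "\<lambda>m. cscale c (\<theta> m)"] allI)
qed

text \<open>The functions and their partial derivatives converge in \<open>L2\<close>, and the defining identity of weak
  derivatives is continuous in both, so the limits of the derivatives are derivatives of the limit.\<close>

theorem H10_complete:
  assumes \<phi>: "\<And>m. \<phi> m \<in> test_functions \<Omega>"
    and C: "\<And>e. 0 < e \<Longrightarrow> \<exists>N. \<forall>m\<ge>N. \<forall>n\<ge>N. H1_norm \<Omega> (\<phi> m - \<phi> n) < e"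
  shows "\<exists>v\<in>H10 \<Omega>. (\<lambda>m. H1_norm \<Omega> (\<phi> m - v)) \<longlonglongrightarrow> 0"
proof -
  have L: "\<phi> m \<in> L2 \<Omega>" "partial_deriv i (\<phi> m) \<in> L2 \<Omega>" for m i by (intro test_L2 test_partial_deriv \<phi>)+
  have d: "\<phi> m - \<phi> n \<in> test_functions \<Omega>" for m n by (intro cfun.subspace_diff[OF test_subspace] \<phi>)
  have "L2_norm \<Omega> (partial_deriv i (\<phi> m) - partial_deriv i (\<phi> n)) \<le> H1_norm \<Omega> (\<phi> m - \<phi> n)" for i m n
    using weak_deriv_le_H1_norm[of \<Omega> i "\<phi> m - \<phi> n"]
    by (simp only: weak_deriv_norm[OF weak_deriv_test[OF d]] partial_deriv_diff[OF test_c1c[OF \<phi>] test_c1c[OF \<phi>]])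
  then have "L2_Cauchy \<Omega> (\<lambda>m. partial_deriv i (\<phi> m))" for i
    unfolding L2_Cauchy_def using C by (meson le_less_trans)
  then have "\<exists>w\<in>L2 \<Omega>. (\<lambda>m. L2_norm \<Omega> (partial_deriv i (\<phi> m) - w)) \<longlonglongrightarrow> 0" for i
    by (intro L2_complete lmeas L)
  then obtain g where g: "\<And>i. g i \<in> L2 \<Omega>" "\<And>i. (\<lambda>m. L2_norm \<Omega> (partial_deriv i (\<phi> m) - g i)) \<longlonglongrightarrow> 0" by metis
  have "L2_Cauchy \<Omega> \<phi>"
    unfolding L2_Cauchy_def using C by (meson L2_norm_le_H1_norm le_less_trans)
  then obtain v where v: "v \<in> L2 \<Omega>" "(\<lambda>m. L2_norm \<Omega> (\<phi> m - v)) \<longlonglongrightarrow> 0"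
    using L2_complete[OF lmeas, of \<phi>] L(1) by blast
  have lim: "(\<lambda>m. integral\<^sup>L (lebesgue_on \<Omega>) (\<lambda>x. f m x * \<eta> x)) \<longlonglongrightarrow> integral\<^sup>L (lebesgue_on \<Omega>) (\<lambda>x. w x * \<eta> x)"
    if "\<And>m. f m \<in> L2 \<Omega>" "w \<in> L2 \<Omega>" "\<eta> \<in> L2 \<Omega>" "(\<lambda>m. L2_norm \<Omega> (f m - w)) \<longlonglongrightarrow> 0" for f w \<eta>
  proof -
    have "(\<lambda>m. integral\<^sup>L (lebesgue_on \<Omega>) (\<lambda>x. f m x * \<eta> x) - integral\<^sup>L (lebesgue_on \<Omega>) (\<lambda>x. w x * \<eta> x)) \<longlonglongrightarrow> 0"
    proof (rule tendsto_0_le[OF that(4), of _ "L2_norm \<Omega> \<eta>"], intro always_eventually allI)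
      fix m
      have "integral\<^sup>L (lebesgue_on \<Omega>) (\<lambda>x. f m x * \<eta> x) - integral\<^sup>L (lebesgue_on \<Omega>) (\<lambda>x. w x * \<eta> x) = 
         integral\<^sup>L (lebesgue_on \<Omega>) (\<lambda>x. (f m - w) x * \<eta> x)"
        using that by (simp add: left_diff_distrib L2_integrable_mult)
      also have "cmod \<dots> \<le> L2_norm \<Omega> (f m - w) * L2_norm \<Omega> \<eta>" by (intro L2_mult_bound L2_diff that)
      finally show "norm (integral\<^sup>L (lebesgue_on \<Omega>) (\<lambda>x. f m x * \<eta> x) - integral\<^sup>L (lebesgue_on \<Omega>) (\<lambda>x. w x * \<eta> x))
          \<le> norm (L2_norm \<Omega> (f m - w)) * L2_norm \<Omega> \<eta>"
        by (simp only: real_norm_def abs_of_nonneg[OF L2_norm_nonneg])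
    qed
    then show ?thesis by (simp add: LIM_zero_iff)
  qed
  have wd: "is_weak_deriv \<Omega> i v (g i)" for i
    unfolding is_weak_deriv_def
  proof (intro conjI g ballI)
    fix \<eta> assume \<eta>: "\<eta> \<in> test_functions \<Omega>"
    have "(\<lambda>m. integral\<^sup>L (lebesgue_on \<Omega>) (\<lambda>x. \<phi> m x * partial_deriv i \<eta> x)) \<longlonglongrightarrow> integral\<^sup>L (lebesgue_on \<Omega>) (\<lambda>x. v x * partial_deriv i \<eta> x)"
      by (intro lim L v test_L2 test_partial_deriv \<eta>)
    moreover have "integral\<^sup>L (lebesgue_on \<Omega>) (\<lambda>x. \<phi> m x * partial_deriv i \<eta> x) = - integral\<^sup>L (lebesgue_on \<Omega>) (\<lambda>x. partial_deriv i (\<phi> m) x * \<eta> x)" for m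
      using weak_deriv_test[OF \<phi>, of i m] \<eta> unfolding is_weak_deriv_def by blast
    moreover have "(\<lambda>m. - integral\<^sup>L (lebesgue_on \<Omega>) (\<lambda>x. partial_deriv i (\<phi> m) x * \<eta> x)) \<longlonglongrightarrow> - integral\<^sup>L (lebesgue_on \<Omega>) (\<lambda>x. g i x * \<eta> x)"
      by (intro tendsto_minus lim L g test_L2 \<eta>)
    ultimately show "integral\<^sup>L (lebesgue_on \<Omega>) (\<lambda>x. v x * partial_deriv i \<eta> x) = - integral\<^sup>L (lebesgue_on \<Omega>) (\<lambda>x. g i x * \<eta> x)"
      by (simp add: LIMSEQ_unique)
  qed
  have vH: "v \<in> H1 \<Omega>" unfolding H1_def using v wd by blast
  have "L2_norm \<Omega> (weak_deriv \<Omega> i (\<phi> m - v)) = L2_norm \<Omega> (partial_deriv i (\<phi> m) - g i)" for i m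
    by (intro weak_deriv_norm is_weak_deriv_diff L v weak_deriv_test \<phi> wd)
  then have "H1_norm \<Omega> (\<phi> m - v) = sqrt ((L2_norm \<Omega> (\<phi> m - v))\<^sup>2 + (\<Sum>i\<in>UNIV. (L2_norm \<Omega> (partial_deriv i (\<phi> m) - g i))\<^sup>2))" for m
    by (simp add: H1_norm_def)
  moreover have "(\<lambda>m. sqrt ((L2_norm \<Omega> (\<phi> m - v))\<^sup>2 + (\<Sum>i\<in>UNIV. (L2_norm \<Omega> (partial_deriv i (\<phi> m) - g i))\<^sup>2)))
      \<longlonglongrightarrow> sqrt (0\<^sup>2 + (\<Sum>i\<in>(UNIV::'n set). 0\<^sup>2))"
    by (intro tendsto_intros v g)
  ultimately have "(\<lambda>m. H1_norm \<Omega> (\<phi> m - v)) \<longlonglongrightarrow> 0" by simp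
  then show ?thesis using vH \<phi> unfolding H10_def by blast
qed

end

section \<open>Compactness of bounded sets of test functions\<close>

text \<open>The index of the half-open cube of side \<open>1/p\<close> that contains \<open>x\<close>; every point lies in exactly one
  such cube.\<close>

definition grid :: "nat \<Rightarrow> real^'n::finite \<Rightarrow> int^'n" where
  "grid p x = (\<chi> i. \<lfloor>real p * x $ i\<rfloor>)"

definition cell :: "nat \<Rightarrow> int^'n::finite \<Rightarrow> (real^'n) set" where
  "cell p \<kappa> = {x. grid p x = \<kappa>}"

lemma mem_cell:
  assumes "0 < p"
  shows "x \<in> cell p \<kappa> \<longleftrightarrow> (\<forall>i. of_int (\<kappa> $ i) / real p \<le> x $ i \<and> x $ i < (of_int (\<kappa> $ i) + 1) / real p)"
proof -
  have "\<lfloor>real p * x $ i\<rfloor> = \<kappa> $ i \<longleftrightarrow> of_int (\<kappa> $ i) / real p \<le> x $ i \<and> x $ i < (of_int (\<kappa> $ i) + 1) / real p" for i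
    using assms by (auto simp: floor_eq_iff field_simps)
  then show ?thesis by (simp add: cell_def grid_def vec_eq_iff)
qed

lemma cell_borel:
  assumes "0 < p"
  shows "cell p \<kappa> \<in> sets borel"
proof -
  have "cell p \<kappa> = (\<Inter>i\<in>UNIV. {x. of_int (\<kappa> $ i) / real p \<le> x $ i} \<inter> {x. x $ i < (of_int (\<kappa> $ i) + 1) / real p})"
    using mem_cell[OF assms] by (auto simp: set_eq_iff)
  also have "\<dots> \<in> sets borel"
  proof (intro sets.finite_INT sets.Int)
    show "{x. of_int (\<kappa> $ i) / real p \<le> x $ i} \<in> sets borel" for i
      by (intro borel_closed closed_Collect_le continuous_intros)
    show "{x. x $ i < (of_int (\<kappa> $ i) + 1) / real p} \<in> sets borel" for i
      by (intro borel_open open_Collect_less continuous_intros)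
  qed auto
  finally show ?thesis .
qed

lemma emeasure_cube:
  fixes a :: "real^'n::finite"
  assumes "0 \<le> c"
  shows "emeasure lborel (cbox a (a + (\<chi> i. c))) = ennreal (c ^ DIM(real^'n))"
    "emeasure lborel (box a (a + (\<chi> i. c))) = ennreal (c ^ DIM(real^'n))"
proof -
  have b: "(\<chi> i. c) \<bullet> b = c" if "b \<in> (Basis :: (real^'n) set)" for b
    using that by (auto simp: Basis_vec_def inner_axis)
  have le: "a \<bullet> b \<le> (a + (\<chi> i. c)) \<bullet> b" if "b \<in> Basis" for b using b[OF that] assms by (simp add: inner_add_left)
  show "emeasure lborel (cbox a (a + (\<chi> i. c))) = ennreal (c ^ DIM(real^'n))"
    using le b by (subst emeasure_lborel_cbox) auto
  show "emeasure lborel (box a (a + (\<chi> i. c))) = ennreal (c ^ DIM(real^'n))"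
    using le b by (subst emeasure_lborel_box) auto
qed

lemma emeasure_cell:
  fixes \<kappa> :: "int^'n::finite"
  assumes p: "0 < p"
  shows "emeasure lborel (cell p \<kappa>) = ennreal ((1 / real p) ^ DIM(real^'n))"
proof (rule antisym)
  define a :: "real^'n" where "a = (\<chi> i. of_int (\<kappa> $ i) / real p)"
  have "cell p \<kappa> \<subseteq> cbox a (a + (\<chi> i. 1 / real p))"
  proof
    fix x assume x: "x \<in> cell p \<kappa>"
    have "a $ i \<le> x $ i \<and> x $ i \<le> (a + (\<chi> i. 1 / real p)) $ i" for i
      using x[unfolded mem_cell[OF p] add_divide_distrib, rule_format, of i] by (simp add: a_def)
    then show "x \<in> cbox a (a + (\<chi> i. 1 / real p))" unfolding mem_box_cart by blast
  qed
  then have "emeasure lborel (cell p \<kappa>) \<le> emeasure lborel (cbox a (a + (\<chi> i. 1 / real p)))"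
    by (intro emeasure_mono) auto
  then show "emeasure lborel (cell p \<kappa>) \<le> ennreal ((1 / real p) ^ DIM(real^'n))" by (subst (asm) emeasure_cube) auto
  have "box a (a + (\<chi> i. 1 / real p)) \<subseteq> cell p \<kappa>"
  proof
    fix x assume x: "x \<in> box a (a + (\<chi> i. 1 / real p))"
    have "of_int (\<kappa> $ i) / real p \<le> x $ i \<and> x $ i < of_int (\<kappa> $ i) / real p + 1 / real p" for i
      using x[unfolded mem_box_cart, rule_format, of i] by (simp add: a_def)
    then show "x \<in> cell p \<kappa>" unfolding mem_cell[OF p] add_divide_distrib by blast
  qed
  then have "emeasure lborel (box a (a + (\<chi> i. 1 / real p))) \<le> emeasure lborel (cell p \<kappa>)"
    using cell_borel[OF p] by (intro emeasure_mono) auto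
  then show "ennreal ((1 / real p) ^ DIM(real^'n)) \<le> emeasure lborel (cell p \<kappa>)" by (subst (asm) emeasure_cube) auto
qed

text \<open>Expanding the square; this is twice the variance when \<open>M\<close> is a probability measure.\<close>

lemma variance_identity:
  fixes u :: "'a \<Rightarrow> complex"
  assumes M: "finite_measure M" and u[measurable]: "u \<in> borel_measurable M" and bd: "\<And>x. cmod (u x) \<le> B"
  shows "(\<integral>\<^sup>+x. (\<integral>\<^sup>+y. ennreal ((cmod (u x - u y))\<^sup>2) \<partial>M) \<partial>M) =
     ennreal (2 * measure M (space M) * (\<integral>x. (cmod (u x))\<^sup>2 \<partial>M) - 2 * (cmod (\<integral>x. u x \<partial>M))\<^sup>2)"
proof -
  interpret finite_measure M by (rule M)
  define m where "m = measure M (space M)"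
  define S where "S = (\<integral>x. (cmod (u x))\<^sup>2 \<partial>M)"
  define U where "U = (\<integral>x. u x \<partial>M)"
  have iu: "integrable M u" by (rule integrable_const_bound[of _ B]) (use bd in auto)
  have iu2: "integrable M (\<lambda>x. (cmod (u x))\<^sup>2)"
    by (rule integrable_const_bound[of _ "B\<^sup>2"]) (use bd in \<open>auto intro!: AE_I2 power_mono\<close>)
  have ex: "(cmod (a - b))\<^sup>2 = (cmod a)\<^sup>2 + (cmod b)\<^sup>2 - 2 * (a \<bullet> b)" for a b :: complex
    by (simp add: power2_norm_eq_inner inner_diff_left inner_diff_right inner_commute)
  have inner: "(\<integral>\<^sup>+y. ennreal ((cmod (u x - u y))\<^sup>2) \<partial>M) = ennreal (m * (cmod (u x))\<^sup>2 + S - 2 * (u x \<bullet> U))" for x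
  proof -
    have iy: "integrable M (\<lambda>y. (cmod (u x))\<^sup>2 + (cmod (u y))\<^sup>2 - 2 * (u x \<bullet> u y))"
      by (intro Bochner_Integration.integrable_diff Bochner_Integration.integrable_add integrable_const iu2 integrable_mult_right integrable_inner_right) (rule iu)
    have iy': "integrable M (\<lambda>y. (cmod (u x - u y))\<^sup>2)" using iy by (simp only: ex)
    have "(\<integral>\<^sup>+y. ennreal ((cmod (u x - u y))\<^sup>2) \<partial>M) = ennreal (\<integral>y. (cmod (u x - u y))\<^sup>2 \<partial>M)"
      by (rule nn_integral_eq_integral[OF iy']) simp
    also have "(\<integral>y. (cmod (u x - u y))\<^sup>2 \<partial>M) = (\<integral>y. (cmod (u x))\<^sup>2 + (cmod (u y))\<^sup>2 - 2 * (u x \<bullet> u y) \<partial>M)"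
      by (simp only: ex)
    also have "(\<integral>y. (cmod (u x))\<^sup>2 + (cmod (u y))\<^sup>2 - 2 * (u x \<bullet> u y) \<partial>M) = m * (cmod (u x))\<^sup>2 + S - 2 * (u x \<bullet> U)"
      using iu iu2 by (simp add: S_def U_def m_def)
    finally show ?thesis .
  qed
  have i2: "integrable M (\<lambda>x. m * (cmod (u x))\<^sup>2 + S - 2 * (u x \<bullet> U))"
    by (intro Bochner_Integration.integrable_diff Bochner_Integration.integrable_add integrable_const integrable_mult_right iu2 integrable_inner_left) (rule iu)
  have nonneg: "0 \<le> m * (cmod (u x))\<^sup>2 + S - 2 * (u x \<bullet> U)" for x
  proof -
    have "m * (cmod (u x))\<^sup>2 + S - 2 * (u x \<bullet> U) = (\<integral>y. (cmod (u x - u y))\<^sup>2 \<partial>M)"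
      unfolding ex using iu iu2 by (simp add: S_def U_def m_def)
    then show ?thesis by simp
  qed
  have "(\<integral>\<^sup>+x. (\<integral>\<^sup>+y. ennreal ((cmod (u x - u y))\<^sup>2) \<partial>M) \<partial>M) = ennreal (\<integral>x. m * (cmod (u x))\<^sup>2 + S - 2 * (u x \<bullet> U) \<partial>M)"
    unfolding inner by (rule nn_integral_eq_integral[OF i2]) (use nonneg in auto)
  also have "(\<integral>x. m * (cmod (u x))\<^sup>2 + S - 2 * (u x \<bullet> U) \<partial>M) = m * S + m * S - 2 * (U \<bullet> U)"
    using iu iu2 by (simp add: S_def[symmetric] U_def[symmetric] m_def[symmetric])
  also have "\<dots> = 2 * m * S - 2 * (cmod U)\<^sup>2" by (simp add: power2_norm_eq_inner)
  finally show ?thesis by (simp add: m_def S_def U_def)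
qed

text \<open>The variance identity on one cube, rearranged into a sum of nonnegative terms.\<close>

lemma cell_variance:
  fixes F :: "'n::finite cfun"
  assumes F[measurable]: "F \<in> borel_measurable borel" and bd: "\<And>x. cmod (F x) \<le> B" and p: "0 < p"
  shows "ennreal (2 * (1 / real p) ^ DIM(real^'n) * (\<integral>x. indicator (cell p \<kappa>) x * (cmod (F x))\<^sup>2 \<partial>lborel)) =
     ennreal (2 * (cmod (\<integral>x. indicator (cell p \<kappa>) x *\<^sub>R F x \<partial>lborel))\<^sup>2) +
     (\<integral>\<^sup>+x. (\<integral>\<^sup>+y. ennreal ((cmod (F x - F y))\<^sup>2) * indicator (cell p \<kappa>) x * indicator (cell p \<kappa>) y \<partial>lborel) \<partial>lborel)"
proof -
  let ?Q = "cell p \<kappa>"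
  have Q[measurable]: "?Q \<in> sets borel" by (rule cell_borel[OF p])
  define M where "M = restrict_space lborel ?Q"
  have sp: "space M = ?Q" by (simp add: M_def space_restrict_space)
  have em: "emeasure M (space M) = ennreal ((1 / real p) ^ DIM(real^'n))"
    unfolding sp using emeasure_cell[OF p, of \<kappa>] by (simp add: M_def emeasure_restrict_space)
  have fin: "finite_measure M" by (rule finite_measureI) (simp add: em)
  have ms: "measure M (space M) = (1 / real p) ^ DIM(real^'n)" by (simp add: measure_def em)
  have mF: "F \<in> borel_measurable M" unfolding M_def by (rule measurable_restrict_space1) simp
  let ?S = "\<integral>x. (cmod (F x))\<^sup>2 \<partial>M" and ?U = "\<integral>x. F x \<partial>M"
  have S: "?S = (\<integral>x. indicator ?Q x * (cmod (F x))\<^sup>2 \<partial>lborel)" unfolding M_def by (subst integral_restrict_space) auto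
  have U: "?U = (\<integral>x. indicator ?Q x *\<^sub>R F x \<partial>lborel)" unfolding M_def by (subst integral_restrict_space) auto
  have V: "(\<integral>\<^sup>+x. (\<integral>\<^sup>+y. ennreal ((cmod (F x - F y))\<^sup>2) \<partial>M) \<partial>M) =
     (\<integral>\<^sup>+x. (\<integral>\<^sup>+y. ennreal ((cmod (F x - F y))\<^sup>2) * indicator ?Q x * indicator ?Q y \<partial>lborel) \<partial>lborel)"
  proof -
    have "(\<integral>\<^sup>+x. (\<integral>\<^sup>+y. ennreal ((cmod (F x - F y))\<^sup>2) \<partial>M) \<partial>M) =
       (\<integral>\<^sup>+x. (\<integral>\<^sup>+y. ennreal ((cmod (F x - F y))\<^sup>2) * indicator ?Q y \<partial>lborel) * indicator ?Q x \<partial>lborel)"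
      unfolding M_def by (simp add: nn_integral_restrict_space)
    also have "\<dots> = (\<integral>\<^sup>+x. (\<integral>\<^sup>+y. (ennreal ((cmod (F x - F y))\<^sup>2) * indicator ?Q y) * indicator ?Q x \<partial>lborel) \<partial>lborel)"
      by (intro nn_integral_cong nn_integral_multc[symmetric]) measurable
    finally show ?thesis by (simp add: mult_ac)
  qed
  note v = variance_identity[OF fin mF bd, unfolded ms]
  show ?thesis
  proof (cases "0 \<le> 2 * (1 / real p) ^ DIM(real^'n) * ?S - 2 * (cmod ?U)\<^sup>2")
    case True
    have "2 * (1 / real p) ^ DIM(real^'n) * ?S = 2 * (cmod ?U)\<^sup>2 + (2 * (1 / real p) ^ DIM(real^'n) * ?S - 2 * (cmod ?U)\<^sup>2)" by simp
    then have "ennreal (2 * (1 / real p) ^ DIM(real^'n) * ?S) = ennreal (2 * (cmod ?U)\<^sup>2) + ennreal (2 * (1 / real p) ^ DIM(real^'n) * ?S - 2 * (cmod ?U)\<^sup>2)"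
      using True by (metis ennreal_plus mult_nonneg_nonneg zero_le_numeral zero_le_power2)
    then show ?thesis unfolding v[symmetric] V unfolding S U .
  next
    \<comment> \<open>\<open>ennreal\<close> cuts off negative numbers, so the difference has to be nonnegative. This is positivity of
      the variance: the mean \<open>W\<close> of \<open>F\<close> satisfies \<open>0 \<le> \<integral> |F - W|\<^sup>2\<close>.\<close>
    case False
    have iF: "integrable M F" by (rule finite_measure.integrable_const_bound[OF fin, of _ B]) (use bd mF in auto)
    have iF2: "integrable M (\<lambda>x. (cmod (F x))\<^sup>2)"
      by (rule finite_measure.integrable_const_bound[OF fin, of _ "B\<^sup>2"]) (use bd mF in \<open>auto intro!: AE_I2 power_mono\<close>)
    let ?m = "(1 / real p) ^ DIM(real^'n)"
    have m: "0 < ?m" using p by simp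
    define W where "W = (1 / ?m) *\<^sub>R ?U"
    have iW: "integrable M (\<lambda>x. F x \<bullet> W)" by (intro integrable_inner_left) (rule iF)
    have "0 \<le> (\<integral>x. (cmod (F x - W))\<^sup>2 \<partial>M)" by simp
    also have "\<dots> = (\<integral>x. (cmod (F x))\<^sup>2 + (cmod W)\<^sup>2 - 2 * (F x \<bullet> W) \<partial>M)"
      by (intro Bochner_Integration.integral_cong refl)
         (simp add: power2_norm_eq_inner inner_diff_left inner_diff_right inner_commute)
    also have "\<dots> = ?S + ?m * (cmod W)\<^sup>2 - 2 * (?U \<bullet> W)"
    proof -
      note ic = finite_measure.integrable_const[OF fin, of "(cmod W)\<^sup>2"]
      have "(\<integral>x. (cmod (F x))\<^sup>2 + (cmod W)\<^sup>2 - 2 * (F x \<bullet> W) \<partial>M) =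
          (\<integral>x. (cmod (F x))\<^sup>2 + (cmod W)\<^sup>2 \<partial>M) - (\<integral>x. 2 * (F x \<bullet> W) \<partial>M)"
        by (rule Bochner_Integration.integral_diff[OF Bochner_Integration.integrable_add[OF iF2 ic] integrable_mult_right[OF iW]])
      also have "(\<integral>x. (cmod (F x))\<^sup>2 + (cmod W)\<^sup>2 \<partial>M) = ?S + (\<integral>x. (cmod W)\<^sup>2 \<partial>M)"
        by (rule Bochner_Integration.integral_add[OF iF2 ic])
      also have "(\<integral>x. (cmod W)\<^sup>2 \<partial>M) = ?m * (cmod W)\<^sup>2" using ms by simp
      also have "(\<integral>x. 2 * (F x \<bullet> W) \<partial>M) = 2 * (?U \<bullet> W)"
        by (simp only: integral_mult_right_zero integral_inner_left[OF iF])
      finally show ?thesis .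
    qed
    also have "?U \<bullet> W = (cmod ?U)\<^sup>2 / ?m"
      by (simp only: W_def inner_scaleR_right power2_norm_eq_inner) simp
    also have "?m * (cmod W)\<^sup>2 = (cmod ?U)\<^sup>2 / ?m"
    proof -
      have "cmod W = cmod ?U / ?m" using m by (simp only: W_def norm_scaleR abs_of_pos zero_less_divide_1_iff) simp
      moreover have "q * (A / q)\<^sup>2 = A\<^sup>2 / q" if "0 < q" for q A :: real
        using that by (simp add: power2_eq_square)
      ultimately show ?thesis using m by (simp only:)
    qed
    finally have "(cmod ?U)\<^sup>2 / ?m \<le> ?S" by simp
    then have "(cmod ?U)\<^sup>2 \<le> ?m * ?S" using m by (simp add: pos_divide_le_eq mult.commute)
    then show ?thesis using False by simp
  qed
qed

text \<open>After the substitution \<open>y = x + h\<close> this is the translation estimate integrated over the cube of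
  shifts \<open>h\<close> with \<open>|h\<^sub>i| \<le> c\<close>.\<close>

lemma translation_cube_estimate:
  fixes F :: "'n::finite cfun"
  assumes F: "c1c F" and c: "0 \<le> c"
  defines "B \<equiv> cbox (- (\<chi> i. c)) (\<chi> i. c) :: (real^'n) set"
  defines "G \<equiv> (\<Sum>i\<in>UNIV. (\<integral>x. (cmod (partial_deriv i F x))\<^sup>2 \<partial>lborel))"
  shows "(\<integral>\<^sup>+x. (\<integral>\<^sup>+y. ennreal ((cmod (F x - F y))\<^sup>2) * indicator B (y - x) \<partial>lborel) \<partial>lborel)
           \<le> ennreal (real CARD('n) * c\<^sup>2 * G * (2 * c) ^ DIM(real^'n))"
proof -
  have Fm[measurable]: "F \<in> borel_measurable borel" by (intro continuous_borel c1c_continuous F)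
  have B[measurable]: "B \<in> sets borel" by (simp add: B_def)
  have G: "0 \<le> G" by (auto simp: G_def intro!: sum_nonneg)
  have "(\<integral>\<^sup>+x. (\<integral>\<^sup>+y. ennreal ((cmod (F x - F y))\<^sup>2) * indicator B (y - x) \<partial>lborel) \<partial>lborel) =
     (\<integral>\<^sup>+x. (\<integral>\<^sup>+h. ennreal ((cmod (F x - F (h + x)))\<^sup>2) * indicator B h \<partial>lborel) \<partial>lborel)"
  proof (rule nn_integral_cong)
    fix x :: "real^'n"
    have "(\<integral>\<^sup>+y. ennreal ((cmod (F x - F y))\<^sup>2) * indicator B (y - x) \<partial>lborel) =
      (\<integral>\<^sup>+h. ennreal ((cmod (F x - F (h + x)))\<^sup>2) * indicator B (h + x - x) \<partial>lborel)"
      by (rule nn_integral_lborel_shift[symmetric]) measurable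
    then show "(\<integral>\<^sup>+y. ennreal ((cmod (F x - F y))\<^sup>2) * indicator B (y - x) \<partial>lborel) =
      (\<integral>\<^sup>+h. ennreal ((cmod (F x - F (h + x)))\<^sup>2) * indicator B h \<partial>lborel)" by simp
  qed
  also have "\<dots> = (\<integral>\<^sup>+h. (\<integral>\<^sup>+x. ennreal ((cmod (F x - F (h + x)))\<^sup>2) * indicator B h \<partial>lborel) \<partial>lborel)"
    by (rule lborel_pair.Fubini') measurable
  also have "\<dots> \<le> (\<integral>\<^sup>+h. ennreal (real CARD('n) * c\<^sup>2 * G) * indicator B h \<partial>lborel)"
  proof (rule nn_integral_mono)
    fix h :: "real^'n"
    show "(\<integral>\<^sup>+x. ennreal ((cmod (F x - F (h + x)))\<^sup>2) * indicator B h \<partial>lborel) \<le> ennreal (real CARD('n) * c\<^sup>2 * G) * indicator B h"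
    proof (cases "h \<in> B")
      case True
      have h: "(\<Sum>i\<in>UNIV. (h $ i)\<^sup>2) \<le> real CARD('n) * c\<^sup>2"
      proof -
        have "(h $ i)\<^sup>2 \<le> c\<^sup>2" for i using True by (intro abs_le_square_iff[THEN iffD1]) (auto simp: B_def mem_box_cart abs_le_iff minus_le_iff abs_of_nonneg[OF c])
        then have "(\<Sum>i\<in>UNIV. (h $ i)\<^sup>2) \<le> (\<Sum>i\<in>(UNIV::'n set). c\<^sup>2)" by (intro sum_mono)
        then show ?thesis by simp
      qed
      have ip: "integrable lborel (\<lambda>x. (cmod (partial_deriv i F x))\<^sup>2)" for i
        unfolding partial_deriv_def by (rule diff_quot_integrals(5)[OF F])
      have "(\<integral>\<^sup>+x. ennreal ((cmod (F x - F (h + x)))\<^sup>2) * indicator B h \<partial>lborel) = (\<integral>\<^sup>+x. ennreal ((cmod (F (x + h) - F x))\<^sup>2) \<partial>lborel)"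
        using True by (intro nn_integral_cong) (simp add: norm_minus_commute add.commute)
      also have "\<dots> \<le> ennreal (\<integral>x. (cmod (frechet_derivative F (at x) h))\<^sup>2 \<partial>lborel)"
        by (rule translation_estimate[OF F])
      also have "\<dots> \<le> ennreal (\<integral>x. (\<Sum>i\<in>UNIV. (h $ i)\<^sup>2) * (\<Sum>i\<in>UNIV. (cmod (partial_deriv i F x))\<^sup>2) \<partial>lborel)"
        by (intro ennreal_leI integral_mono diff_quot_integrals(5)[OF F] integrable_mult_right Bochner_Integration.integrable_sum ip dirderiv_sq_le F)
      also have "(\<integral>x. (\<Sum>i\<in>UNIV. (h $ i)\<^sup>2) * (\<Sum>i\<in>UNIV. (cmod (partial_deriv i F x))\<^sup>2) \<partial>lborel) = (\<Sum>i\<in>UNIV. (h $ i)\<^sup>2) * G"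
        unfolding G_def using ip by (simp add: Bochner_Integration.integral_sum)
      also have "ennreal \<dots> \<le> ennreal (real CARD('n) * c\<^sup>2 * G)" by (intro ennreal_leI mult_right_mono h G)
      finally show ?thesis using True by simp
    qed simp
  qed
  also have "\<dots> = ennreal (real CARD('n) * c\<^sup>2 * G) * emeasure lborel B"
    by (subst nn_integral_cmult) auto
  also have "emeasure lborel B = ennreal ((2 * c) ^ DIM(real^'n))"
  proof -
    have e: "- (\<chi> i. c) + ((\<chi> i. 2 * c) :: real^'n) = (\<chi> i. c)" by (simp add: vec_eq_iff)
    show ?thesis using emeasure_cube(1)[of "2 * c" "- (\<chi> i. c) :: real^'n"] c unfolding B_def e by simp
  qed
  also have "ennreal (real CARD('n) * c\<^sup>2 * G) * ennreal ((2 * c) ^ DIM(real^'n)) = ennreal (real CARD('n) * c\<^sup>2 * G * (2 * c) ^ DIM(real^'n))"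
    using G c by (subst ennreal_mult) auto
  finally show ?thesis .
qed

text \<open>Two points of the same cube differ by a vector with entries at most \<open>1/p\<close>, so summing the variances
  over the cubes is covered by the translation estimate. What is left are the finitely many averages
  over the cubes that meet the support.\<close>

lemma cell_estimate:
  fixes F :: "'n::finite cfun"
  assumes F: "c1c F" and p: "0 < p" and K: "finite K" "\<And>x. F x \<noteq> 0 \<Longrightarrow> grid p x \<in> K"
  shows "(\<integral>x. (cmod (F x))\<^sup>2 \<partial>lborel) \<le> real p ^ DIM(real^'n) * (\<Sum>\<kappa>\<in>K. (cmod (\<integral>x. indicator (cell p \<kappa>) x *\<^sub>R F x \<partial>lborel))\<^sup>2)
    + real CARD('n) * 2 ^ DIM(real^'n) * (\<Sum>i\<in>UNIV. (\<integral>x. (cmod (partial_deriv i F x))\<^sup>2 \<partial>lborel)) / (real p)\<^sup>2"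
proof -
  have Fm[measurable]: "F \<in> borel_measurable borel" by (intro continuous_borel c1c_continuous F)
  obtain R B0 where RB: "\<And>x. R < norm x \<Longrightarrow> F x = 0" "\<And>x. cmod (F x) \<le> B0" by (rule c1c_support[OF F]) blast
  define D where "D = DIM(real^'n)"
  define G where "G = (\<Sum>i\<in>UNIV. (\<integral>x. (cmod (partial_deriv i F x))\<^sup>2 \<partial>lborel))"
  have G: "0 \<le> G" by (auto simp: G_def intro!: sum_nonneg)
  define U where "U = (\<lambda>\<kappa>. (cmod (\<integral>x. indicator (cell p \<kappa>) x *\<^sub>R F x \<partial>lborel))\<^sup>2)"
  have cm[measurable]: "cell p \<kappa> \<in> sets borel" for \<kappa> :: "int^'n" by (rule cell_borel[OF p])
  let ?B = "cbox (- (\<chi> i. 1 / real p)) (\<chi> i. 1 / real p) :: (real^'n) set"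
  let ?W = "\<lambda>\<kappa> x y. ennreal ((cmod (F x - F y))\<^sup>2) * indicator (cell p \<kappa>) x * indicator (cell p \<kappa>) y"
  have iF2: "integrable lborel (\<lambda>x. (cmod (F x))\<^sup>2)"
    by (rule integrable_bounded_support[of _ "B0\<^sup>2" R]) (use RB in \<open>auto intro!: power_mono\<close>)
  have ic: "integrable lborel (\<lambda>x. indicator (cell p \<kappa>) x * (cmod (F x))\<^sup>2)" for \<kappa>
    using integrable_mult_indicator[OF _ iF2, of "cell p \<kappa>"] by simp
  define s where "s = (\<lambda>\<kappa>. \<integral>x. indicator (cell p \<kappa>) x * (cmod (F x))\<^sup>2 \<partial>lborel)"
  have s0: "0 \<le> s \<kappa>" for \<kappa> by (auto simp: s_def)
  have tot: "(\<integral>x. (cmod (F x))\<^sup>2 \<partial>lborel) = (\<Sum>\<kappa>\<in>K. s \<kappa>)"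
  proof -
    have "(\<Sum>\<kappa>\<in>K. indicator (cell p \<kappa>) x * (cmod (F x))\<^sup>2) = (cmod (F x))\<^sup>2" for x
    proof (cases "F x = 0")
      case False
      have "(\<Sum>\<kappa>\<in>K. indicator (cell p \<kappa>) x * (cmod (F x))\<^sup>2) = (\<Sum>\<kappa>\<in>K. if \<kappa> = grid p x then (cmod (F x))\<^sup>2 else 0)"
        by (intro sum.cong) (auto simp: cell_def)
      then show ?thesis using K(2)[OF False] K(1) by simp
    qed simp
    then show ?thesis unfolding s_def by (subst Bochner_Integration.integral_sum[symmetric, OF ic]) simp
  qed
  have W[measurable]: "(\<lambda>(x, y). ?W \<kappa> x y) \<in> borel_measurable (lborel \<Otimes>\<^sub>M lborel)" for \<kappa> by measurable
  have "ennreal (2 * (1 / real p) ^ D * (\<Sum>\<kappa>\<in>K. s \<kappa>)) = (\<Sum>\<kappa>\<in>K. ennreal (2 * (1 / real p) ^ D * s \<kappa>))"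
    using s0 by (simp add: sum_distrib_left)
  also have "\<dots> = (\<Sum>\<kappa>\<in>K. ennreal (2 * U \<kappa>) + (\<integral>\<^sup>+x. (\<integral>\<^sup>+y. ?W \<kappa> x y \<partial>lborel) \<partial>lborel))"
    unfolding s_def U_def D_def by (intro sum.cong refl cell_variance[OF Fm RB(2) p])
  also have "\<dots> = (\<Sum>\<kappa>\<in>K. ennreal (2 * U \<kappa>)) + (\<Sum>\<kappa>\<in>K. (\<integral>\<^sup>+x. (\<integral>\<^sup>+y. ?W \<kappa> x y \<partial>lborel) \<partial>lborel))"
    by (rule sum.distrib)
  also have "(\<Sum>\<kappa>\<in>K. ennreal (2 * U \<kappa>)) = ennreal (2 * (\<Sum>\<kappa>\<in>K. U \<kappa>))"
    by (simp add: sum_distrib_left U_def)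
  also have "(\<Sum>\<kappa>\<in>K. (\<integral>\<^sup>+x. (\<integral>\<^sup>+y. ?W \<kappa> x y \<partial>lborel) \<partial>lborel)) = (\<integral>\<^sup>+x. (\<integral>\<^sup>+y. (\<Sum>\<kappa>\<in>K. ?W \<kappa> x y) \<partial>lborel) \<partial>lborel)"
    by (simp add: nn_integral_sum)
  also have "\<dots> \<le> (\<integral>\<^sup>+x. (\<integral>\<^sup>+y. ennreal ((cmod (F x - F y))\<^sup>2) * indicator ?B (y - x) \<partial>lborel) \<partial>lborel)"
  proof (intro nn_integral_mono)
    fix x y :: "real^'n"
    have "(\<Sum>\<kappa>\<in>K. ?W \<kappa> x y) = (\<Sum>\<kappa>\<in>K. if \<kappa> = grid p x then (if grid p x = grid p y then ennreal ((cmod (F x - F y))\<^sup>2) else 0) else 0)"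
      by (intro sum.cong) (auto simp: cell_def indicator_def)
    also have "\<dots> \<le> (if grid p x = grid p y then ennreal ((cmod (F x - F y))\<^sup>2) else 0)" using K(1) by simp
    also have "\<dots> \<le> ennreal ((cmod (F x - F y))\<^sup>2) * indicator ?B (y - x)"
    proof (cases "grid p x = grid p y")
      case True
      have xc: "x \<in> cell p (grid p x)" "y \<in> cell p (grid p x)" using True by (auto simp: cell_def)
      have "- (1 / real p) \<le> y $ i - x $ i \<and> y $ i - x $ i \<le> 1 / real p" for i
      proof -
        have "of_int (grid p x $ i) / real p \<le> x $ i" "x $ i < of_int (grid p x $ i) / real p + 1 / real p"
          "of_int (grid p x $ i) / real p \<le> y $ i" "y $ i < of_int (grid p x $ i) / real p + 1 / real p"
          using xc unfolding mem_cell[OF p] add_divide_distrib by blast+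
        then show ?thesis by linarith
      qed
      then have "y - x \<in> ?B" by (simp add: mem_box_cart)
      then show ?thesis using True by simp
    qed simp
    finally show "(\<Sum>\<kappa>\<in>K. ?W \<kappa> x y) \<le> ennreal ((cmod (F x - F y))\<^sup>2) * indicator ?B (y - x)" .
  qed
  also have "\<dots> \<le> ennreal (real CARD('n) * (1 / real p)\<^sup>2 * G * (2 * (1 / real p)) ^ D)"
    unfolding G_def D_def by (rule translation_cube_estimate[OF F]) simp
  finally have "ennreal (2 * (1 / real p) ^ D * (\<Sum>\<kappa>\<in>K. s \<kappa>)) \<le> ennreal (2 * (\<Sum>\<kappa>\<in>K. U \<kappa>)) + ennreal (real CARD('n) * (1 / real p)\<^sup>2 * G * (2 * (1 / real p)) ^ D)"
    by (simp add: add_left_mono)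
  also have "\<dots> = ennreal (2 * (\<Sum>\<kappa>\<in>K. U \<kappa>) + real CARD('n) * (1 / real p)\<^sup>2 * G * (2 * (1 / real p)) ^ D)"
    using G by (intro ennreal_plus[symmetric]) (auto simp: U_def intro!: sum_nonneg mult_nonneg_nonneg)
  finally have "2 * (1 / real p) ^ D * (\<Sum>\<kappa>\<in>K. s \<kappa>) \<le> 2 * (\<Sum>\<kappa>\<in>K. U \<kappa>) + real CARD('n) * (1 / real p)\<^sup>2 * G * (2 * (1 / real p)) ^ D"
    using G by (subst (asm) ennreal_le_iff) (auto simp: U_def intro!: add_nonneg_nonneg sum_nonneg mult_nonneg_nonneg)
  then have "real p ^ D * (2 * (1 / real p) ^ D * (\<Sum>\<kappa>\<in>K. s \<kappa>)) \<le> real p ^ D * (2 * (\<Sum>\<kappa>\<in>K. U \<kappa>) + real CARD('n) * (1 / real p)\<^sup>2 * G * (2 * (1 / real p)) ^ D)"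
    by (intro mult_left_mono) auto
  also have "real p ^ D * (2 * (1 / real p) ^ D * (\<Sum>\<kappa>\<in>K. s \<kappa>)) = 2 * (\<Sum>\<kappa>\<in>K. s \<kappa>)"
    using p by (simp add: power_divide)
  also have "real p ^ D * (2 * (\<Sum>\<kappa>\<in>K. U \<kappa>) + real CARD('n) * (1 / real p)\<^sup>2 * G * (2 * (1 / real p)) ^ D) =
     2 * (real p ^ D * (\<Sum>\<kappa>\<in>K. U \<kappa>)) + real CARD('n) * 2 ^ D * G / (real p)\<^sup>2"
    using p by (simp add: power_divide distrib_left)
  finally have "2 * (\<Sum>\<kappa>\<in>K. s \<kappa>) \<le> 2 * (real p ^ D * (\<Sum>\<kappa>\<in>K. U \<kappa>)) + real CARD('n) * 2 ^ D * G / (real p)\<^sup>2" .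
  moreover have "0 \<le> real CARD('n) * 2 ^ D * G / (real p)\<^sup>2" using G by simp
  moreover have "S \<le> X + Y" if "2 * S \<le> 2 * X + Y" "0 \<le> Y" for S X Y :: real using that by linarith
  ultimately have "(\<Sum>\<kappa>\<in>K. s \<kappa>) \<le> real p ^ D * (\<Sum>\<kappa>\<in>K. U \<kappa>) + real CARD('n) * 2 ^ D * G / (real p)\<^sup>2" by blast
  then show ?thesis unfolding tot by (simp add: U_def G_def D_def)
qed

lemma finite_grid_image:
  assumes "bounded (S :: (real^'n::finite) set)"
  shows "finite (grid p ` S)"
proof -
  obtain R where R: "\<And>x. x \<in> S \<Longrightarrow> norm x \<le> R" using assms by (auto simp: bounded_iff)
  define I where "I = {\<lfloor>- (real p * R)\<rfloor>..\<lfloor>real p * R\<rfloor>}"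
  have "grid p ` S \<subseteq> vec_lambda ` (PiE UNIV (\<lambda>_. I))"
  proof
    fix \<kappa> assume "\<kappa> \<in> grid p ` S"
    then obtain x where x: "x \<in> S" "\<kappa> = grid p x" by blast
    have "\<lfloor>real p * x $ i\<rfloor> \<in> I" for i
    proof -
      have "\<bar>x $ i\<bar> \<le> R" using component_le_norm_cart[of x i] R[OF x(1)] by linarith
      then have "x $ i \<le> R" "- R \<le> x $ i" by auto
      then have "real p * x $ i \<le> real p * R" "real p * - R \<le> real p * x $ i" using mult_left_mono[of "- R" "x $ i" "real p"] mult_left_mono[of "x $ i" R "real p"] by simp_all
      then show ?thesis by (auto simp: I_def intro!: floor_mono)
    qed
    then show "\<kappa> \<in> vec_lambda ` (PiE UNIV (\<lambda>_. I))" using x by (auto simp: grid_def intro!: image_eqI[of _ vec_lambda "\<lambda>i. \<lfloor>real p * x $ i\<rfloor>"])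
  qed
  moreover have "finite (vec_lambda ` (PiE (UNIV::'n set) (\<lambda>_. I)))" by (intro finite_imageI finite_PiE) (auto simp: I_def)
  ultimately show ?thesis by (rule finite_subset)
qed

context bounded_open_set
begin

lemma L2_norm_lborel:
  assumes "\<phi> \<in> test_functions \<Omega>"
  shows "(L2_norm \<Omega> \<phi>)\<^sup>2 = (\<integral>x. (cmod (\<phi> x))\<^sup>2 \<partial>lborel)"
proof -
  have [measurable]: "\<phi> \<in> borel_measurable borel" by (intro continuous_borel c1c_continuous test_c1c[OF assms])
  have "\<phi> x = 0" if "x \<notin> \<Omega>" for x using assms that by (auto simp: test_functions_def)
  then have "integral\<^sup>L (lebesgue_on \<Omega>) (\<lambda>x. (cmod (\<phi> x))\<^sup>2) = (\<integral>x. (cmod (\<phi> x))\<^sup>2 \<partial>lborel)"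
    by (intro integral_lebesgue_on_eq_lborel sets_\<Omega>) auto
  then show ?thesis by (simp add: L2_norm_def)
qed

text \<open>A diagonal subsequence makes the averages over all cubes of all sizes converge. By \<open>cell_estimate\<close>
  the distance of two members is then controlled by finitely many averages on a grid so fine that the
  gradient term is small.\<close>

theorem Rellich:
  fixes \<phi> :: "nat \<Rightarrow> 'n cfun"
  assumes \<phi>: "\<And>m. \<phi> m \<in> test_functions \<Omega>" and C: "\<And>m. H1_norm \<Omega> (\<phi> m) \<le> C"
  shows "\<exists>r. strict_mono r \<and> L2_Cauchy \<Omega> (\<phi> \<circ> r)"
proof -
  define c1 where "c1 = L2_norm \<Omega> (\<lambda>x. 1)"
  define A where "A = (\<lambda>m (q :: nat \<times> (int^'n)). \<integral>x. indicator (cell (Suc (fst q)) (snd q)) x *\<^sub>R \<phi> m x \<partial>lborel)"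
  have \<phi>m[measurable]: "\<phi> m \<in> borel_measurable borel" for m by (intro continuous_borel c1c_continuous test_c1c[OF \<phi>])
  have i\<phi>: "integrable lborel (\<phi> m)" for m
  proof -
    obtain R B0 where RB: "\<And>x. R < norm x \<Longrightarrow> \<phi> m x = 0" "\<And>x. cmod (\<phi> m x) \<le> B0" by (rule c1c_support[OF test_c1c[OF \<phi>]]) blast
    show ?thesis by (rule integrable_bounded_support[of _ B0 R]) (use RB in auto)
  qed
  have ind: "integrable lborel (\<lambda>x. indicator (cell (Suc p) \<kappa>) x *\<^sub>R \<phi> m x)" for p \<kappa> m
    using cell_borel[of "Suc p" \<kappa>] by (intro integrable_mult_indicator i\<phi>) auto
  have Ab: "cmod (A m q) \<le> C * c1" for m q
  proof -
    have "cmod (A m q) \<le> (\<integral>x. cmod (\<phi> m x) \<partial>lborel)"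
      unfolding A_def
      by (rule order.trans[OF integral_norm_bound])
         (intro integral_mono integrable_norm ind i\<phi>, auto simp: indicator_def)
    also have "\<dots> = integral\<^sup>L (lebesgue_on \<Omega>) (\<lambda>x. cmod (\<phi> m x))"
      using \<phi>[of m] by (intro integral_lebesgue_on_eq_lborel[symmetric] sets_\<Omega>) (auto simp: test_functions_def)
    also have "\<dots> \<le> L2_norm \<Omega> (\<phi> m) * c1" unfolding c1_def by (intro L1_le_L2 lmeas test_L2 \<phi>)
    also have "\<dots> \<le> C * c1" using order.trans[OF L2_norm_le_H1_norm C] by (intro mult_right_mono) (auto simp: c1_def)
    finally show ?thesis .
  qed
  obtain r where r: "strict_mono r" "\<And>q. \<exists>l. (\<lambda>n. A (r n) q) \<longlonglongrightarrow> l"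
    using function_convergent_subsequence[of "UNIV :: (nat \<times> (int^'n)) set" A "C * c1"] Ab by auto
  have "L2_Cauchy \<Omega> (\<phi> \<circ> r)"
    unfolding L2_Cauchy_def
  proof (intro allI impI)
    fix e :: real assume e: "0 < e"
    define D where "D = DIM(real^'n)"
    define c2 where "c2 = real CARD('n) * 2 ^ D * (2 * C)\<^sup>2"
    have "(\<lambda>p. c2 * (1 / real (Suc p))\<^sup>2) \<longlonglongrightarrow> c2 * 0\<^sup>2"
      by (intro tendsto_intros lim_1_over_n[THEN LIMSEQ_Suc])
    then have "eventually (\<lambda>p. c2 * (1 / real (Suc p))\<^sup>2 < e\<^sup>2 / 2) sequentially"
      using e by (intro order_tendstoD(2)) auto
    then obtain p where p: "c2 * (1 / real (Suc p))\<^sup>2 < e\<^sup>2 / 2" by (auto simp: eventually_sequentially)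
    define K where "K = grid (Suc p) ` \<Omega>"
    have K: "finite K" unfolding K_def by (rule finite_grid_image[OF bounded_set])
    \<comment> \<open>The summand 1 keeps \<open>b\<close> positive when \<open>K\<close> is empty.\<close>
    define b where "b = real (Suc p) ^ D * (real (card K) + 1)"
    have b: "0 < b" by (simp add: b_def)
    define \<delta> where "\<delta> = sqrt (e\<^sup>2 / (2 * b))"
    have \<delta>: "0 < \<delta>" "\<delta>\<^sup>2 = e\<^sup>2 / (2 * b)" using e b by (auto simp: \<delta>_def)
    have "\<exists>N. \<forall>m\<ge>N. \<forall>n\<ge>N. cmod (A (r m) (p, \<kappa>) - A (r n) (p, \<kappa>)) < \<delta>" for \<kappa>
    proof -
      have "Cauchy (\<lambda>n. A (r n) (p, \<kappa>))" using r(2) by (meson LIMSEQ_imp_Cauchy)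
      then show ?thesis using \<delta>(1) by (auto simp: Cauchy_def dist_norm)
    qed
    then obtain N where N: "\<And>\<kappa> m n. N \<kappa> \<le> m \<Longrightarrow> N \<kappa> \<le> n \<Longrightarrow> cmod (A (r m) (p, \<kappa>) - A (r n) (p, \<kappa>)) < \<delta>" by metis
    define N0 where "N0 = (\<Sum>\<kappa>\<in>K. N \<kappa>)"
    have N0: "N \<kappa> \<le> N0" if "\<kappa> \<in> K" for \<kappa> unfolding N0_def using that K by (intro member_le_sum) auto
    show "\<exists>N. \<forall>m\<ge>N. \<forall>n\<ge>N. L2_norm \<Omega> ((\<phi> \<circ> r) m - (\<phi> \<circ> r) n) < e"
    proof (intro exI[of _ N0] allI impI)
      fix m n assume mn: "N0 \<le> m" "N0 \<le> n"
      define F where "F = \<phi> (r m) - \<phi> (r n)"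
      have Ft: "F \<in> test_functions \<Omega>" unfolding F_def by (intro cfun.subspace_diff[OF test_subspace] \<phi>)
      have pt: "partial_deriv i F \<in> test_functions \<Omega>" for i by (rule test_partial_deriv[OF Ft])
      have AF: "(\<integral>x. indicator (cell (Suc p) \<kappa>) x *\<^sub>R F x \<partial>lborel) = A (r m) (p, \<kappa>) - A (r n) (p, \<kappa>)" for \<kappa>
        unfolding A_def F_def using ind by (simp add: scaleR_diff_right)
      have H: "H1_norm \<Omega> F \<le> 2 * C"
      proof -
        have "H1_norm \<Omega> F \<le> H1_norm \<Omega> (\<phi> (r m) - 0) + H1_norm \<Omega> (0 - \<phi> (r n))"
          unfolding F_def by (intro H1_norm_diff_triangle test_H1 \<phi> cfun.subspace_0[OF test_subspace])
        also have "H1_norm \<Omega> (0 - \<phi> (r n)) = H1_norm \<Omega> (\<phi> (r n) - 0)"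
          by (intro H1_norm_minus test_H1 \<phi> cfun.subspace_0[OF test_subspace])
        finally show ?thesis using C[of "r m"] C[of "r n"] by simp
      qed
      have G: "(\<Sum>i\<in>UNIV. (\<integral>x. (cmod (partial_deriv i F x))\<^sup>2 \<partial>lborel)) \<le> (2 * C)\<^sup>2"
      proof -
        have "(\<Sum>i\<in>UNIV. (\<integral>x. (cmod (partial_deriv i F x))\<^sup>2 \<partial>lborel)) = (\<Sum>i\<in>UNIV. (L2_norm \<Omega> (partial_deriv i F))\<^sup>2)"
          by (simp only: L2_norm_lborel[OF pt])
        also have "\<dots> \<le> (H1_norm \<Omega> F)\<^sup>2" using zero_le_power2[of "L2_norm \<Omega> F"] by (simp only: test_H1_norm_sq[OF Ft])
        also have "\<dots> \<le> (2 * C)\<^sup>2" by (intro power_mono H) simp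
        finally show ?thesis .
      qed
      have "(L2_norm \<Omega> F)\<^sup>2 \<le> real (Suc p) ^ D * (\<Sum>\<kappa>\<in>K. (cmod (\<integral>x. indicator (cell (Suc p) \<kappa>) x *\<^sub>R F x \<partial>lborel))\<^sup>2)
         + real CARD('n) * 2 ^ D * (\<Sum>i\<in>UNIV. (\<integral>x. (cmod (partial_deriv i F x))\<^sup>2 \<partial>lborel)) / (real (Suc p))\<^sup>2"
        unfolding L2_norm_lborel[OF Ft] D_def
      proof (rule cell_estimate[OF test_c1c[OF Ft] _ K])
        fix x assume "F x \<noteq> 0"
        then have "x \<in> \<Omega>" using Ft by (auto simp: test_functions_def)
        then show "grid (Suc p) x \<in> K" by (simp add: K_def)
      qed simp
      also have "\<dots> \<le> real (Suc p) ^ D * (\<Sum>\<kappa>\<in>K. \<delta>\<^sup>2) + real CARD('n) * 2 ^ D * (2 * C)\<^sup>2 / (real (Suc p))\<^sup>2"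
      proof (intro add_mono mult_left_mono sum_mono divide_right_mono G)
        fix \<kappa> assume "\<kappa> \<in> K"
        then have "N \<kappa> \<le> m" "N \<kappa> \<le> n" using N0[of \<kappa>] mn by auto
        then show "(cmod (\<integral>x. indicator (cell (Suc p) \<kappa>) x *\<^sub>R F x \<partial>lborel))\<^sup>2 \<le> \<delta>\<^sup>2"
          unfolding AF by (intro power_mono less_imp_le[OF N] norm_ge_zero)
      qed auto
      also have "\<dots> \<le> b * \<delta>\<^sup>2 + c2 * (1 / real (Suc p))\<^sup>2"
      proof (rule add_mono)
        have "real (Suc p) ^ D * (\<Sum>\<kappa>\<in>K. \<delta>\<^sup>2) = real (Suc p) ^ D * real (card K) * \<delta>\<^sup>2" by simp
        also have "\<dots> \<le> b * \<delta>\<^sup>2" unfolding b_def by (intro mult_right_mono mult_left_mono) auto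
        finally show "real (Suc p) ^ D * (\<Sum>\<kappa>\<in>K. \<delta>\<^sup>2) \<le> b * \<delta>\<^sup>2" .
      qed (simp add: c2_def power_divide)
      also have "\<dots> < e\<^sup>2" using p b e by (simp add: \<delta>(2) field_simps)
      finally have "L2_norm \<Omega> F < e" using e by (simp add: power_less_imp_less_base)
      then show "L2_norm \<Omega> ((\<phi> \<circ> r) m - (\<phi> \<circ> r) n) < e" by (simp only: F_def o_def)
    qed
  qed
  then show ?thesis using r(1) by blast
qed

end

section \<open>The smallest eigenvalue and the Rayleigh quotient\<close>

lemma sesquilinear_on_subset:
  assumes B: "sesquilinear_on W B" and V: "V \<subseteq> W"
  shows "sesquilinear_on V B"
  unfolding sesquilinear_on_def
proof (intro conjI ballI allI)
  show "B (u + v) w = B u w + B v w" "B w (u + v) = B w u + B w v" if "u \<in> V" "v \<in> V" "w \<in> V" for u v w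
    using sesquilinear_onD(1,2)[OF B] that V by (simp_all add: subset_iff)
  show "B (cscale c v) w = c * B v w" "B v (cscale c w) = cnj c * B v w" if "v \<in> V" "w \<in> V" for c v w
    using sesquilinear_onD(3)[OF B, of v v w c] sesquilinear_onD(4)[OF B, of v v w c] that V by (simp_all add: subset_iff)
qed

locale elliptic_form = bounded_open_set \<Omega> for \<Omega> :: "(real^'n::finite) set" +
  fixes a :: "'n cfun \<Rightarrow> 'n cfun \<Rightarrow> complex"
  assumes sesquilinear: "sesquilinear_on (H10 \<Omega>) a" and hermitian: "hermitian_on (H10 \<Omega>) a"
    and coercive: "coercive_form \<Omega> a" and bounded_a: "bounded_form \<Omega> a"
begin

lemma a_nonneg: "v \<in> H10 \<Omega> \<Longrightarrow> 0 \<le> Re (a v v)"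
proof -
  assume v: "v \<in> H10 \<Omega>"
  obtain c where "0 < c" "c * (H1_norm \<Omega> v)\<^sup>2 \<le> Re (a v v)" using coercive v unfolding coercive_form_def by blast
  moreover from this have "0 \<le> c * (H1_norm \<Omega> v)\<^sup>2" by simp
  ultimately show ?thesis by linarith
qed

lemma a_psd: "psd_on (H10 \<Omega>) a"
  unfolding psd_on_def using a_nonneg by (intro conjI H10_subspace sesquilinear hermitian ballI)

lemma H10_L2: "v \<in> H10 \<Omega> \<Longrightarrow> v \<in> L2 \<Omega>" by (intro H1_L2 H10_H1)

lemma L2_psd_H10: "psd_on (H10 \<Omega>) (L2_inner \<Omega>)"
proof -
  have sub: "H10 \<Omega> \<subseteq> L2 \<Omega>" using H10_L2 by blast
  have L: "sesquilinear_on (L2 \<Omega>) (L2_inner \<Omega>)" "hermitian_on (L2 \<Omega>) (L2_inner \<Omega>)"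
    using L2_psd unfolding psd_on_def by blast+
  have "sesquilinear_on (H10 \<Omega>) (L2_inner \<Omega>)" by (rule sesquilinear_on_subset[OF L(1) sub])
  moreover have "hermitian_on (H10 \<Omega>) (L2_inner \<Omega>)"
    using L(2) sub unfolding hermitian_on_def by blast
  ultimately show ?thesis unfolding psd_on_def using H10_subspace by (simp add: L2_inner_self)
qed

text \<open>Both square roots are seminorms dominated by the \<open>H1\<close> norm.\<close>

lemma H1_limit:
  assumes \<phi>: "\<And>m. \<phi> m \<in> H10 \<Omega>" and v: "v \<in> H10 \<Omega>" and lim: "(\<lambda>m::nat. H1_norm \<Omega> (\<phi> m - v)) \<longlonglongrightarrow> 0"
  shows "(\<lambda>m. Re (a (\<phi> m) (\<phi> m))) \<longlonglongrightarrow> Re (a v v)" "(\<lambda>m. L2_norm \<Omega> (\<phi> m)) \<longlonglongrightarrow> L2_norm \<Omega> v"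
proof -
  have gen: "(\<lambda>m. sqrt (Re (B (\<phi> m) (\<phi> m)))) \<longlonglongrightarrow> sqrt (Re (B v v))"
    if B: "psd_on (H10 \<Omega>) B" and C: "\<And>w. w \<in> H10 \<Omega> \<Longrightarrow> sqrt (Re (B w w)) \<le> C * H1_norm \<Omega> w" for B C
  proof -
    let ?N = "\<lambda>w. sqrt (Re (B w w))"
    have d: "\<phi> m - v \<in> H10 \<Omega>" "v - \<phi> m \<in> H10 \<Omega>" for m by (intro cfun.subspace_diff[OF H10_subspace] \<phi> v)+
    have e: "H1_norm \<Omega> (v - \<phi> m) = H1_norm \<Omega> (\<phi> m - v)" for m by (intro H1_norm_minus H10_H1 \<phi> v)
    have "\<bar>?N (\<phi> m) - ?N v\<bar> \<le> C * H1_norm \<Omega> (\<phi> m - v)" for m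
      using psd_triangle[OF B d(1)[of m] v] psd_triangle[OF B d(2)[of m] \<phi>[of m]] C[OF d(1)[of m]] C[OF d(2)[of m]] e[of m]
      by simp
    then have "(\<lambda>m. ?N (\<phi> m) - ?N v) \<longlonglongrightarrow> 0"
      by (intro Lim_null_comparison[OF _ tendsto_mult_right_zero[OF lim, of C]] always_eventually) simp
    then show ?thesis by (simp add: LIM_zero_iff)
  qed
  obtain cb where cb: "\<And>v w. v \<in> H10 \<Omega> \<Longrightarrow> w \<in> H10 \<Omega> \<Longrightarrow> cmod (a v w) \<le> cb * H1_norm \<Omega> v * H1_norm \<Omega> w"
    using bounded_a unfolding bounded_form_def by blast
  have C: "sqrt (Re (a w w)) \<le> sqrt \<bar>cb\<bar> * H1_norm \<Omega> w" if w: "w \<in> H10 \<Omega>" for w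
  proof -
    have "Re (a w w) \<le> cmod (a w w)" by (rule complex_Re_le_cmod)
    also have "\<dots> \<le> cb * H1_norm \<Omega> w * H1_norm \<Omega> w" by (rule cb[OF w w])
    also have "\<dots> \<le> \<bar>cb\<bar> * H1_norm \<Omega> w * H1_norm \<Omega> w" by (intro mult_right_mono) auto
    finally have "sqrt (Re (a w w)) \<le> sqrt (\<bar>cb\<bar> * (H1_norm \<Omega> w)\<^sup>2)" by (intro real_sqrt_le_mono) (simp add: power2_eq_square)
    then show ?thesis by (simp add: real_sqrt_mult)
  qed
  have "(\<lambda>m. (sqrt (Re (a (\<phi> m) (\<phi> m))))\<^sup>2) \<longlonglongrightarrow> (sqrt (Re (a v v)))\<^sup>2"
    by (intro tendsto_power gen[OF a_psd C])
  then show "(\<lambda>m. Re (a (\<phi> m) (\<phi> m))) \<longlonglongrightarrow> Re (a v v)" using a_nonneg \<phi> v by simp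
  have "(\<lambda>m. sqrt (Re (L2_inner \<Omega> (\<phi> m) (\<phi> m)))) \<longlonglongrightarrow> sqrt (Re (L2_inner \<Omega> v v))"
    by (rule gen[OF L2_psd_H10, of 1]) (simp only: L2_norm_eq mult_1 L2_norm_le_H1_norm)
  then show "(\<lambda>m. L2_norm \<Omega> (\<phi> m)) \<longlonglongrightarrow> L2_norm \<Omega> v" by (simp only: L2_norm_eq)
qed

lemma H10_approx:
  assumes "v \<in> H10 \<Omega>"
  obtains \<phi> where "\<And>m. \<phi> m \<in> test_functions \<Omega>" "(\<lambda>m::nat. H1_norm \<Omega> (\<phi> m - v)) \<longlonglongrightarrow> 0"
  using assms unfolding H10_def by blast

lemma a_cscale: "v \<in> H10 \<Omega> \<Longrightarrow> Re (a (cscale c v) (cscale c v)) = (cmod c)\<^sup>2 * Re (a v v)"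
proof -
  assume v: "v \<in> H10 \<Omega>"
  have cv: "cscale c v \<in> H10 \<Omega>" by (rule cfun.subspace_scale[OF H10_subspace v])
  have "a (cscale c v) (cscale c v) = (c * cnj c) * a v v"
    using sesquilinear_onD(3)[OF sesquilinear v v cv] sesquilinear_onD(4)[OF sesquilinear v v v] by simp
  also have "c * cnj c = of_real ((cmod c)\<^sup>2)" by (rule complex_norm_square[symmetric])
  finally have e: "a (cscale c v) (cscale c v) = of_real ((cmod c)\<^sup>2) * a v v" .
  show ?thesis unfolding e by simp
qed

lemma shifted_form_psd:
  assumes low: "\<And>v. v \<in> H10 \<Omega> \<Longrightarrow> \<mu> * (L2_norm \<Omega> v)\<^sup>2 \<le> Re (a v v)"
  shows "psd_on (H10 \<Omega>) (\<lambda>u v. a u v - of_real \<mu> * L2_inner \<Omega> u v)"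
  unfolding psd_on_def
proof (intro conjI H10_subspace ballI)
  have L: "sesquilinear_on (H10 \<Omega>) (L2_inner \<Omega>)" "hermitian_on (H10 \<Omega>) (L2_inner \<Omega>)" using L2_psd_H10 by (auto simp: psd_on_def)
  show "sesquilinear_on (H10 \<Omega>) (\<lambda>u v. a u v - of_real \<mu> * L2_inner \<Omega> u v)"
    unfolding sesquilinear_on_def
    by (intro conjI ballI allI; simp only: sesquilinear_onD[OF sesquilinear] sesquilinear_onD[OF L(1)]; simp add: algebra_simps)
  show "hermitian_on (H10 \<Omega>) (\<lambda>u v. a u v - of_real \<mu> * L2_inner \<Omega> u v)"
    unfolding hermitian_on_def
  proof (intro ballI)
    fix v w assume vw: "v \<in> H10 \<Omega>" "w \<in> H10 \<Omega>"
    have "a v w = cnj (a w v)" "L2_inner \<Omega> v w = cnj (L2_inner \<Omega> w v)"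
      using hermitian L(2) vw unfolding hermitian_on_def by blast+
    then show "a v w - of_real \<mu> * L2_inner \<Omega> v w = cnj (a w v - of_real \<mu> * L2_inner \<Omega> w v)" by simp
  qed
  show "0 \<le> Re (a v v - of_real \<mu> * L2_inner \<Omega> v v)" if "v \<in> H10 \<Omega>" for v
    using low[OF that] by (simp add: L2_inner_self)
qed

text \<open>Half of the parallelogram law: the term \<open>B(u + v, u + v)\<close> is dropped.\<close>

lemma parallelogram:
  assumes B: "psd_on (H10 \<Omega>) B" and uv: "u \<in> H10 \<Omega>" "v \<in> H10 \<Omega>"
  shows "Re (B (u - v) (u - v)) \<le> 2 * Re (B u u) + 2 * Re (B v v)"
proof -
  have V: "cfun.subspace (H10 \<Omega>)" and s: "sesquilinear_on (H10 \<Omega>) B" "hermitian_on (H10 \<Omega>) B" and pos: "\<And>v. v \<in> H10 \<Omega> \<Longrightarrow> 0 \<le> Re (B v v)"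
    using B by (auto simp: psd_on_def)
  have e: "u - v = u + cscale (-1) v" "u + v = u + cscale 1 v" by (simp_all add: fun_eq_iff)
  have "0 \<le> Re (B (u + v) (u + v))" by (intro pos cfun.subspace_add[OF V] uv)
  then show ?thesis unfolding e sesquilinear_expand[OF V s uv] by simp
qed

text \<open>Let \<open>\<mu>\<close> be the infimum of the Rayleigh quotient over test functions and suppose \<open>\<mu> < lam1\<close>. A minimising
  sequence is bounded in \<open>H1\<close> by coercivity and so has an \<open>L2\<close>-Cauchy subsequence. Its members are
  almost null for the semidefinite form \<open>B = a - \<mu> (\<cdot>, \<cdot>)\<close>, hence so are their differences, and
  \<open>a = B + \<mu> (\<cdot>, \<cdot>)\<close> shows that the subsequence is Cauchy in \<open>H1\<close>. The limit has norm 1 and is a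
  null vector of \<open>B\<close>, that is an eigenfunction for \<open>\<mu>\<close>, against the minimality of \<open>lam1\<close>.\<close>

theorem Rayleigh_lower_bound:
  assumes ev: "smallest_eigenvalue_L \<Omega> a lam1" and v0: "v0 \<in> H10 \<Omega>"
  shows "lam1 * (L2_norm \<Omega> v0)\<^sup>2 \<le> Re (a v0 v0)"
proof (rule ccontr)
  assume "\<not> lam1 * (L2_norm \<Omega> v0)\<^sup>2 \<le> Re (a v0 v0)"
  then have lt: "Re (a v0 v0) < lam1 * (L2_norm \<Omega> v0)\<^sup>2" by simp
  obtain c where c: "0 < c" "\<And>v. v \<in> H10 \<Omega> \<Longrightarrow> c * (H1_norm \<Omega> v)\<^sup>2 \<le> Re (a v v)"
    using coercive unfolding coercive_form_def by blast
  \<comment> \<open>Test functions suffice because both sides are continuous in the \<open>H1\<close> norm.\<close>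
  define R where "R = {Re (a \<phi> \<phi>) |\<phi>. \<phi> \<in> test_functions \<Omega> \<and> L2_norm \<Omega> \<phi> = 1}"
  have R0: "0 \<le> x" if "x \<in> R" for x using that a_nonneg test_H10 by (auto simp: R_def)
  have bb: "bdd_below R" by (rule bdd_belowI[of _ 0]) (rule R0)
  have normalise: "Re (a \<phi> \<phi>) / (L2_norm \<Omega> \<phi>)\<^sup>2 \<in> R" if \<phi>: "\<phi> \<in> test_functions \<Omega>" and n: "L2_norm \<Omega> \<phi> \<noteq> 0" for \<phi>
  proof -
    let ?c = "complex_of_real (1 / L2_norm \<Omega> \<phi>)"
    have m: "cscale ?c \<phi> \<in> test_functions \<Omega>" by (intro cfun.subspace_scale[OF test_subspace] \<phi>)
    have n1: "L2_norm \<Omega> (cscale ?c \<phi>) = 1" using n by (simp only: L2_norm_cscale norm_of_real) simp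
    have e: "Re (a (cscale ?c \<phi>) (cscale ?c \<phi>)) = Re (a \<phi> \<phi>) / (L2_norm \<Omega> \<phi>)\<^sup>2"
      by (simp only: a_cscale[OF test_H10[OF \<phi>]] norm_of_real) (simp add: power_divide)
    show ?thesis unfolding R_def by (rule CollectI, rule exI[of _ "cscale ?c \<phi>"]) (intro conjI e[symmetric] m n1)
  qed
  obtain \<phi>0 where \<phi>0: "\<phi>0 \<in> test_functions \<Omega>" "Re (a \<phi>0 \<phi>0) < lam1 * (L2_norm \<Omega> \<phi>0)\<^sup>2"
  proof -
    obtain \<phi> where \<phi>: "\<And>m. \<phi> m \<in> test_functions \<Omega>" "(\<lambda>m::nat. H1_norm \<Omega> (\<phi> m - v0)) \<longlonglongrightarrow> 0" using H10_approx[OF v0] by blast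
    note l = H1_limit[OF test_H10[OF \<phi>(1)] v0 \<phi>(2)]
    have "(\<lambda>m. Re (a (\<phi> m) (\<phi> m)) - lam1 * (L2_norm \<Omega> (\<phi> m))\<^sup>2) \<longlonglongrightarrow> Re (a v0 v0) - lam1 * (L2_norm \<Omega> v0)\<^sup>2"
      by (intro tendsto_intros l)
    then have "eventually (\<lambda>m. Re (a (\<phi> m) (\<phi> m)) - lam1 * (L2_norm \<Omega> (\<phi> m))\<^sup>2 < 0) sequentially"
      by (rule order_tendstoD(2)) (use lt in simp)
    then obtain m where "Re (a (\<phi> m) (\<phi> m)) - lam1 * (L2_norm \<Omega> (\<phi> m))\<^sup>2 < 0" by (auto simp: eventually_sequentially)
    then show thesis using that[OF \<phi>(1)] by simp
  qed
  have n0: "L2_norm \<Omega> \<phi>0 \<noteq> 0" using \<phi>0(2) a_nonneg[OF test_H10[OF \<phi>0(1)]] by auto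
  define \<mu> where "\<mu> = Inf R"
  have mem0: "Re (a \<phi>0 \<phi>0) / (L2_norm \<Omega> \<phi>0)\<^sup>2 \<in> R" by (rule normalise[OF \<phi>0(1) n0])
  have "0 < (L2_norm \<Omega> \<phi>0)\<^sup>2" using n0 by simp
  then have "Re (a \<phi>0 \<phi>0) / (L2_norm \<Omega> \<phi>0)\<^sup>2 < lam1" using \<phi>0(2) by (simp only: pos_divide_less_eq)
  moreover have "\<mu> \<le> Re (a \<phi>0 \<phi>0) / (L2_norm \<Omega> \<phi>0)\<^sup>2" unfolding \<mu>_def by (rule cInf_lower[OF mem0 bb])
  ultimately have \<mu>lt: "\<mu> < lam1" by linarith
  have \<mu>0: "0 \<le> \<mu>" unfolding \<mu>_def by (rule cInf_greatest) (use mem0 R0 in auto)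
  have low_test: "\<mu> * (L2_norm \<Omega> \<phi>)\<^sup>2 \<le> Re (a \<phi> \<phi>)" if \<phi>: "\<phi> \<in> test_functions \<Omega>" for \<phi>
  proof (cases "L2_norm \<Omega> \<phi> = 0")
    case True
    then show ?thesis using a_nonneg[OF test_H10[OF \<phi>]] by simp
  next
    case False
    have "\<mu> \<le> Re (a \<phi> \<phi>) / (L2_norm \<Omega> \<phi>)\<^sup>2" unfolding \<mu>_def by (rule cInf_lower[OF normalise[OF \<phi> False] bb])
    moreover have "0 < (L2_norm \<Omega> \<phi>)\<^sup>2" using False by simp
    ultimately show ?thesis by (simp only: pos_le_divide_eq)
  qed
  have low: "\<mu> * (L2_norm \<Omega> v)\<^sup>2 \<le> Re (a v v)" if v: "v \<in> H10 \<Omega>" for v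
  proof -
    obtain \<phi> where \<phi>: "\<And>m. \<phi> m \<in> test_functions \<Omega>" "(\<lambda>m::nat. H1_norm \<Omega> (\<phi> m - v)) \<longlonglongrightarrow> 0" using H10_approx[OF v] by blast
    note l = H1_limit[OF test_H10[OF \<phi>(1)] v \<phi>(2)]
    show ?thesis
      by (rule LIMSEQ_le[OF tendsto_mult[OF tendsto_const tendsto_power[OF l(2)]] l(1)]) (use low_test \<phi>(1) in blast)
  qed
  define B where "B = (\<lambda>u v. a u v - of_real \<mu> * L2_inner \<Omega> u v)"
  have B: "psd_on (H10 \<Omega>) B" unfolding B_def by (rule shifted_form_psd[OF low])
  have ReB: "Re (B v v) = Re (a v v) - \<mu> * (L2_norm \<Omega> v)\<^sup>2" for v by (simp add: B_def L2_inner_self)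
  have "\<exists>\<phi>. \<phi> \<in> test_functions \<Omega> \<and> L2_norm \<Omega> \<phi> = 1 \<and> Re (a \<phi> \<phi>) < \<mu> + 1 / real (Suc m)" for m
  proof -
    have "Inf R < \<mu> + 1 / real (Suc m)" unfolding \<mu>_def by simp
    then obtain x where "x \<in> R" "x < \<mu> + 1 / real (Suc m)" using cInf_lessD[of R] mem0 by blast
    then show ?thesis unfolding R_def by blast
  qed
  then have "\<exists>\<phi>. \<forall>m. \<phi> m \<in> test_functions \<Omega> \<and> L2_norm \<Omega> (\<phi> m) = 1 \<and> Re (a (\<phi> m) (\<phi> m)) < \<mu> + 1 / real (Suc m)"
    by (intro choice) blast
  then obtain \<phi> where \<phi>: "\<And>m. \<phi> m \<in> test_functions \<Omega>" "\<And>m. L2_norm \<Omega> (\<phi> m) = 1" "\<And>m. Re (a (\<phi> m) (\<phi> m)) < \<mu> + 1 / real (Suc m)"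
    by blast
  have "H1_norm \<Omega> (\<phi> m) \<le> sqrt ((\<mu> + 1) / c)" for m
  proof -
    have "c * (H1_norm \<Omega> (\<phi> m))\<^sup>2 \<le> \<mu> + 1 / real (Suc m)" using c(2)[OF test_H10[OF \<phi>(1)[of m]]] \<phi>(3)[of m] by linarith
    also have "\<dots> \<le> \<mu> + 1" by simp
    finally have "(H1_norm \<Omega> (\<phi> m))\<^sup>2 \<le> (\<mu> + 1) / c" using c(1) by (simp add: pos_le_divide_eq mult.commute)
    then show ?thesis by (rule real_le_rsqrt)
  qed
  then have "\<exists>r. strict_mono r \<and> L2_Cauchy \<Omega> (\<phi> \<circ> r)" by (rule Rellich[OF \<phi>(1)])
  then obtain r where r: "strict_mono r" "L2_Cauchy \<Omega> (\<phi> \<circ> r)" by (elim exE conjE)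
  define \<theta> where "\<theta> = \<phi> \<circ> r"
  have \<theta>: "\<theta> m \<in> test_functions \<Omega>" "L2_norm \<Omega> (\<theta> m) = 1" for m by (simp_all add: \<theta>_def \<phi>)
  have \<theta>B: "Re (B (\<theta> m) (\<theta> m)) \<le> 1 / real (Suc m)" for m
  proof -
    have "Re (B (\<theta> m) (\<theta> m)) \<le> 1 / real (Suc (r m))" using \<phi>(2,3)[of "r m"] unfolding ReB \<theta>_def o_def by simp
    also have "\<dots> \<le> 1 / real (Suc m)" using seq_suble[OF r(1), of m] by (intro divide_left_mono) auto
    finally show ?thesis .
  qed
  have Cauchy: "\<exists>N. \<forall>m\<ge>N. \<forall>n\<ge>N. H1_norm \<Omega> (\<theta> m - \<theta> n) < e" if e: "0 < e" for e
  proof -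
    \<comment> \<open>The factor \<open>\<mu> + 1\<close> instead of \<open>\<mu>\<close> avoids a division by zero.\<close>
    define \<delta> where "\<delta> = sqrt (c * e\<^sup>2 / (2 * (\<mu> + 1)))"
    have \<delta>: "0 < \<delta>" "\<delta>\<^sup>2 = c * e\<^sup>2 / (2 * (\<mu> + 1))" using c e \<mu>0 by (auto simp: \<delta>_def)
    obtain N1 where N1: "\<And>m n. N1 \<le> m \<Longrightarrow> N1 \<le> n \<Longrightarrow> L2_norm \<Omega> (\<theta> m - \<theta> n) < \<delta>"
      using r(2) \<delta>(1) unfolding L2_Cauchy_def \<theta>_def[symmetric] by meson
    have "(\<lambda>n. 4 * (1 / real (Suc n))) \<longlonglongrightarrow> 4 * 0" by (intro tendsto_intros lim_1_over_n[THEN LIMSEQ_Suc])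
    then have "eventually (\<lambda>n. 4 * (1 / real (Suc n)) < c * e\<^sup>2 / 2) sequentially"
      using c e by (intro order_tendstoD(2)) auto
    then obtain N2 where N2: "\<And>n. N2 \<le> n \<Longrightarrow> 4 * (1 / real (Suc n)) < c * e\<^sup>2 / 2" by (auto simp: eventually_sequentially)
    show ?thesis
    proof (intro exI[of _ "max N1 N2"] allI impI)
      fix m n assume mn: "max N1 N2 \<le> m" "max N1 N2 \<le> n"
      have t: "\<theta> m \<in> H10 \<Omega>" "\<theta> n \<in> H10 \<Omega>" "\<theta> m - \<theta> n \<in> H10 \<Omega>"
        by (intro test_H10 \<theta> cfun.subspace_diff[OF test_subspace])+
      have "c * (H1_norm \<Omega> (\<theta> m - \<theta> n))\<^sup>2 \<le> Re (a (\<theta> m - \<theta> n) (\<theta> m - \<theta> n))" by (rule c(2)[OF t(3)])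
      also have "\<dots> = Re (B (\<theta> m - \<theta> n) (\<theta> m - \<theta> n)) + \<mu> * (L2_norm \<Omega> (\<theta> m - \<theta> n))\<^sup>2" unfolding ReB by simp
      also have "\<dots> \<le> (2 * (1 / real (Suc m)) + 2 * (1 / real (Suc n))) + (\<mu> + 1) * \<delta>\<^sup>2"
      proof (rule add_mono)
        show "Re (B (\<theta> m - \<theta> n) (\<theta> m - \<theta> n)) \<le> 2 * (1 / real (Suc m)) + 2 * (1 / real (Suc n))"
          using parallelogram[OF B t(1,2)] \<theta>B[of m] \<theta>B[of n] by linarith
        have "L2_norm \<Omega> (\<theta> m - \<theta> n) \<le> \<delta>" using N1[of m n] mn by simp
        then show "\<mu> * (L2_norm \<Omega> (\<theta> m - \<theta> n))\<^sup>2 \<le> (\<mu> + 1) * \<delta>\<^sup>2" using \<mu>0 by (intro mult_mono power_mono) auto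
      qed
      also have "(\<mu> + 1) * \<delta>\<^sup>2 = c * e\<^sup>2 / 2" unfolding \<delta>(2) using \<mu>0 by (simp add: divide_simps)
      also have "2 * (1 / real (Suc m)) + 2 * (1 / real (Suc n)) + c * e\<^sup>2 / 2 < c * e\<^sup>2"
        using N2[of m] N2[of n] mn by simp
      finally have "(H1_norm \<Omega> (\<theta> m - \<theta> n))\<^sup>2 < e\<^sup>2" by (simp only: mult_less_cancel_left_pos[OF c(1)])
      then show "H1_norm \<Omega> (\<theta> m - \<theta> n) < e" by (rule power_less_imp_less_base) (use e in simp)
    qed
  qed
  obtain w where w: "w \<in> H10 \<Omega>" "(\<lambda>m. H1_norm \<Omega> (\<theta> m - w)) \<longlonglongrightarrow> 0" using H10_complete[OF \<theta>(1) Cauchy] by blast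
  note l = H1_limit[OF test_H10[OF \<theta>(1)] w]
  have nw: "L2_norm \<Omega> w = 1" using l(2) by (simp add: \<theta>(2) LIMSEQ_const_iff)
  have "(\<lambda>m. Re (B (\<theta> m) (\<theta> m))) \<longlonglongrightarrow> Re (B w w)" unfolding ReB by (intro tendsto_intros l)
  then have "Re (B w w) \<le> 0"
    by (rule LIMSEQ_le[OF _ lim_1_over_n[THEN LIMSEQ_Suc]]) (use \<theta>B in blast)
  moreover have "0 \<le> Re (B w w)" using B w(1) unfolding psd_on_def by blast
  ultimately have "Re (B w w) = 0" by simp
  then have Bw: "B w \<theta> = 0" if "\<theta> \<in> H10 \<Omega>" for \<theta> using psd_null[OF B w(1) that] by simp
  have wL: "w \<in> L2 \<Omega>" by (rule H10_L2[OF w(1)])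
  have "eigenvalue_L \<Omega> a (of_real \<mu>)"
    unfolding eigenvalue_L_def
  proof (intro exI[of _ w] conjI)
    show "is_L \<Omega> a w (cscale (of_real \<mu>) w)"
      unfolding is_L_def is_T_def
    proof (intro conjI ballI w(1) cfun.subspace_scale[OF L2_subspace wL])
      fix \<theta> assume t: "\<theta> \<in> H10 \<Omega>"
      have "sesquilinear_on (L2 \<Omega>) (L2_inner \<Omega>)" using L2_psd by (auto simp: psd_on_def)
      from sesquilinear_onD(3)[OF this wL wL H10_L2[OF t]]
      show "a w \<theta> = L2_inner \<Omega> (cscale (of_real \<mu>) w) \<theta>" using Bw[OF t] by (simp add: B_def)
    qed
    show "\<not> (AE x in lebesgue_on \<Omega>. w x = 0)" using L2_norm_0_iff[OF wL] nw by simp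
  qed
  then have "lam1 \<le> \<mu>" using ev unfolding smallest_eigenvalue_L_def by blast
  then show False using \<mu>lt by simp
qed

end

section \<open>The finite element operator in its eigenbasis\<close>

lemma sesquilinear_sum:
  assumes V: "cfun.subspace V" and B: "sesquilinear_on V B" and "finite J" and f: "\<And>j. j \<in> J \<Longrightarrow> f j \<in> V" and w: "w \<in> V"
  shows "B (\<Sum>j\<in>J. cscale (c j) (f j)) w = (\<Sum>j\<in>J. c j * B (f j) w)"
    "B w (\<Sum>j\<in>J. cscale (c j) (f j)) = (\<Sum>j\<in>J. cnj (c j) * B w (f j))"
proof -
  have z: "B 0 w = 0 \<and> B w 0 = 0"
  proof -
    have e: "(0 :: 'a cfun) = cscale 0 w" by (simp add: fun_eq_iff)
    show ?thesis unfolding e sesquilinear_onD(3)[OF B w w w] sesquilinear_onD(4)[OF B w w w] by simp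
  qed
  have "B (\<Sum>j\<in>J. cscale (c j) (f j)) w = (\<Sum>j\<in>J. c j * B (f j) w) \<and>
        B w (\<Sum>j\<in>J. cscale (c j) (f j)) = (\<Sum>j\<in>J. cnj (c j) * B w (f j))"
    using \<open>finite J\<close> f
  proof (induction J rule: finite_induct)
    case empty
    show ?case using z by (simp only: sum.empty)
  next
    case (insert j J)
    have fj: "f j \<in> V" using insert by simp
    have 1: "cscale (c j) (f j) \<in> V" by (rule cfun.subspace_scale[OF V fj])
    have 2: "(\<Sum>j\<in>J. cscale (c j) (f j)) \<in> V"
      by (intro cfun.subspace_sum[OF V] cfun.subspace_scale[OF V]) (use insert in auto)
    have IH: "B (\<Sum>j\<in>J. cscale (c j) (f j)) w = (\<Sum>j\<in>J. c j * B (f j) w)"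
        "B w (\<Sum>j\<in>J. cscale (c j) (f j)) = (\<Sum>j\<in>J. cnj (c j) * B w (f j))"
      using insert.IH[OF insert.prems[OF insertI2]] by blast+
    show ?case
      unfolding sum.insert[OF insert(1,2)] sesquilinear_onD(1,2)[OF B 1 2 w]
        sesquilinear_onD(3)[OF B fj fj w] sesquilinear_onD(4)[OF B w w fj] IH
      by (intro conjI refl)
  qed
  then show "B (\<Sum>j\<in>J. cscale (c j) (f j)) w = (\<Sum>j\<in>J. c j * B (f j) w)"
    "B w (\<Sum>j\<in>J. cscale (c j) (f j)) = (\<Sum>j\<in>J. cnj (c j) * B w (f j))" by blast+
qed

text \<open>The dimension of a space without a finite basis is 0 by convention, so positivity of \<open>fe_dim\<close>
  provides a finite basis of the finite element space.\<close>

locale discrete_spectrum = elliptic_form +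
  fixes \<T> :: "(real^'n::finite) set set" and \<psi> :: "nat \<Rightarrow> 'n cfun" and lam :: "nat \<Rightarrow> real"
  assumes on: "orthonormal_eigenfunctions \<Omega> \<T> a \<psi> lam" and dim_pos: "0 < fe_dim \<Omega> \<T>"
begin

abbreviation "V \<equiv> fe_space \<Omega> \<T>"
abbreviation "M \<equiv> fe_dim \<Omega> \<T>"
abbreviation ip (infix "\<bullet>\<^sub>2" 70) where "u \<bullet>\<^sub>2 v \<equiv> L2_inner \<Omega> u v"

lemma fe_spaceI:
  assumes "v \<in> H10 \<Omega>" "continuous_on (closure \<Omega>) v" "\<And>x. x \<notin> \<Omega> \<Longrightarrow> v x = 0"
    "\<And>K. K \<in> \<T> \<Longrightarrow> \<exists>A c. linear A \<and> (\<forall>x\<in>K. v x = A x + c)"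
  shows "v \<in> V"
  unfolding fe_space_def by (intro CollectI conjI allI impI ballI assms)

lemma fe_spaceD:
  assumes "v \<in> V"
  shows "v \<in> H10 \<Omega>" "continuous_on (closure \<Omega>) v" "x \<notin> \<Omega> \<Longrightarrow> v x = 0"
    "K \<in> \<T> \<Longrightarrow> \<exists>A c. linear A \<and> (\<forall>x\<in>K. v x = A x + c)"
proof -
  note v = CollectD[OF assms[unfolded fe_space_def]]
  show "v \<in> H10 \<Omega>" by (rule conjunct1[OF v])
  show "continuous_on (closure \<Omega>) v" by (rule conjunct1[OF conjunct2[OF v]])
  show "v x = 0" if "x \<notin> \<Omega>" by (rule mp[OF spec[OF conjunct1[OF conjunct2[OF conjunct2[OF v]]]] that])
  show "\<exists>A c. linear A \<and> (\<forall>x\<in>K. v x = A x + c)" if "K \<in> \<T>"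
    by (rule bspec[OF conjunct2[OF conjunct2[OF conjunct2[OF v]]] that])
qed

lemmas V_H10 = fe_spaceD(1)

lemma V_subspace: "cfun.subspace V"
proof (rule cfun.subspaceI)
  show "0 \<in> V"
  proof (rule fe_spaceI)
    show "0 \<in> H10 \<Omega>" by (rule cfun.subspace_0[OF H10_subspace])
    show "continuous_on (closure \<Omega>) (0 :: 'n cfun)" unfolding zero_fun_def by (rule continuous_on_const)
    show "(0 :: 'n cfun) x = 0" for x by simp
    show "\<exists>A c. linear A \<and> (\<forall>x\<in>K. (0 :: 'n cfun) x = A x + c)" for K
      by (intro exI[of _ "\<lambda>x. 0"] exI[of _ 0] conjI linear_zero) simp
  qed
next
  fix u v assume u: "u \<in> V" and v: "v \<in> V"
  show "u + v \<in> V"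
  proof (rule fe_spaceI)
    show "u + v \<in> H10 \<Omega>" by (intro cfun.subspace_add[OF H10_subspace] V_H10 u v)
    show "continuous_on (closure \<Omega>) (u + v)" unfolding plus_fun_def by (intro continuous_on_add fe_spaceD(2) u v)
    show "(u + v) x = 0" if "x \<notin> \<Omega>" for x using fe_spaceD(3)[OF u that] fe_spaceD(3)[OF v that] by simp
    show "\<exists>A c. linear A \<and> (\<forall>x\<in>K. (u + v) x = A x + c)" if K: "K \<in> \<T>" for K
    proof -
      obtain A c where A: "linear A" "\<forall>x\<in>K. u x = A x + c" using fe_spaceD(4)[OF u K] by (elim exE conjE)
      obtain A' c' where A': "linear A'" "\<forall>x\<in>K. v x = A' x + c'" using fe_spaceD(4)[OF v K] by (elim exE conjE)
      show ?thesis
        by (intro exI[of _ "\<lambda>x. A x + A' x"] exI[of _ "c + c'"] conjI linear_compose_add A(1) A'(1)) (use A(2) A'(2) in simp)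
    qed
  qed
next
  fix c :: complex and v assume v: "v \<in> V"
  show "cscale c v \<in> V"
  proof (rule fe_spaceI)
    show "cscale c v \<in> H10 \<Omega>" by (intro cfun.subspace_scale[OF H10_subspace] V_H10 v)
    show "continuous_on (closure \<Omega>) (cscale c v)" unfolding cscale_def by (intro continuous_on_mult_left fe_spaceD(2) v)
    show "cscale c v x = 0" if "x \<notin> \<Omega>" for x using fe_spaceD(3)[OF v that] by simp
    show "\<exists>A d. linear A \<and> (\<forall>x\<in>K. cscale c v x = A x + d)" if K: "K \<in> \<T>" for K
    proof -
      obtain A d where A: "linear A" "\<forall>x\<in>K. v x = A x + d" using fe_spaceD(4)[OF v K] by (elim exE conjE)
      have "linear (\<lambda>x. c * A x)"
        by (rule linearI) (simp_all add: linear_add[OF A(1)] linear_scale[OF A(1)] distrib_left)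
      then show ?thesis using A(2)
        by (intro exI[of _ "\<lambda>x. c * A x"] exI[of _ "c * d"] conjI) (assumption, simp add: distrib_left)
    qed
  qed
qed

lemma \<psi>_V: "j \<in> {1..M} \<Longrightarrow> \<psi> j \<in> V"
  and eigen: "j \<in> {1..M} \<Longrightarrow> L_h \<Omega> \<T> a (\<psi> j) = cscale (of_real (lam j)) (\<psi> j)"
  using on[unfolded orthonormal_eigenfunctions_def, THEN conjunct1] by (simp_all only: Ball_def)

lemma orthonormal: "i \<in> {1..M} \<Longrightarrow> j \<in> {1..M} \<Longrightarrow> \<psi> i \<bullet>\<^sub>2 \<psi> j = (if i = j then 1 else 0)"
  using on[unfolded orthonormal_eigenfunctions_def, THEN conjunct2] by (simp only: Ball_def)

lemma L2_sesq: "sesquilinear_on V (L2_inner \<Omega>)"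
proof (rule sesquilinear_on_subset)
  show "sesquilinear_on (H10 \<Omega>) (L2_inner \<Omega>)" using L2_psd_H10 unfolding psd_on_def by (elim conjE)
  show "V \<subseteq> H10 \<Omega>" by (rule subsetI, rule V_H10)
qed

lemma a_sesq: "sesquilinear_on V a"
  by (rule sesquilinear_on_subset[OF sesquilinear]) (rule subsetI, rule V_H10)

lemma comb_V: "(\<Sum>j=1..M. cscale (c j) (\<psi> j)) \<in> V"
  by (intro cfun.subspace_sum[OF V_subspace] cfun.subspace_scale[OF V_subspace] \<psi>_V) auto

lemma comb_inner:
  assumes "i \<in> {1..M}"
  shows "(\<Sum>j=1..M. cscale (c j) (\<psi> j)) \<bullet>\<^sub>2 \<psi> i = c i"
proof -
  have "(\<Sum>j=1..M. cscale (c j) (\<psi> j)) \<bullet>\<^sub>2 \<psi> i = (\<Sum>j=1..M. c j * (\<psi> j \<bullet>\<^sub>2 \<psi> i))"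
    by (rule sesquilinear_sum[OF V_subspace L2_sesq]) (use assms \<psi>_V in auto)
  also have "\<dots> = (\<Sum>j=1..M. if j = i then c j else 0)"
  proof (intro sum.cong refl)
    fix j assume "j \<in> {1..M}"
    from orthonormal[OF this assms] show "c j * (\<psi> j \<bullet>\<^sub>2 \<psi> i) = (if j = i then c j else 0)" by simp
  qed
  finally show ?thesis using assms by simp
qed

lemma \<psi>_inj: "inj_on \<psi> {1..M}"
proof (rule inj_onI)
  fix i j assume ij: "i \<in> {1..M}" "j \<in> {1..M}" "\<psi> i = \<psi> j"
  show "i = j" using orthonormal[OF ij(1,2)] orthonormal[OF ij(1,1)] ij(3) by (simp split: if_splits)
qed

lemma span_comb:
  assumes "v \<in> cfun.span (\<psi> ` {1..M})"
  shows "\<exists>c. v = (\<Sum>j=1..M. cscale (c j) (\<psi> j))"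
proof -
  obtain u where "v = (\<Sum>w\<in>\<psi> ` {1..M}. cscale (u w) w)"
    using assms cfun.span_finite[of "\<psi> ` {1..M}"] by auto
  then have "v = (\<Sum>j=1..M. cscale (u (\<psi> j)) (\<psi> j))" unfolding sum.reindex[OF \<psi>_inj] o_def .
  then show ?thesis by (rule exI[of _ "\<lambda>j. u (\<psi> j)"])
qed

lemma \<psi>_independent: "cfun.independent (\<psi> ` {1..M})"
proof
  assume "cfun.dependent (\<psi> ` {1..M})"
  then obtain u where u: "\<exists>v\<in>\<psi> ` {1..M}. u v \<noteq> 0" "(\<Sum>v\<in>\<psi> ` {1..M}. cscale (u v) v) = 0"
    using cfun.dependent_finite[of "\<psi> ` {1..M}"] by auto
  have z: "(\<Sum>j=1..M. cscale (u (\<psi> j)) (\<psi> j)) = 0" using u(2) unfolding sum.reindex[OF \<psi>_inj] o_def .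
  obtain i where i: "i \<in> {1..M}" "u (\<psi> i) \<noteq> 0" using u(1) by blast
  have "u (\<psi> i) = 0 \<bullet>\<^sub>2 \<psi> i" using comb_inner[OF i(1), of "\<lambda>j. u (\<psi> j)"] unfolding z by simp
  also have "\<dots> = 0" by (simp add: L2_inner_def)
  finally show False using i(2) by simp
qed

text \<open>The eigenfunctions are orthonormal, hence independent, and as many as the elements of a basis. A
  function outside of their span could be added to an independent set that is then too large.\<close>

lemma V_expand:
  assumes v: "v \<in> V"
  shows "v = (\<Sum>j=1..M. cscale (v \<bullet>\<^sub>2 \<psi> j) (\<psi> j))"
proof -
  obtain B where B: "B \<subseteq> V" "cfun.independent B" "V \<subseteq> cfun.span B" "card B = cfun.dim V"
    using cfun.basis_exists[of V] by blast
  have cB: "card B = M" using B(4) by (simp add: fe_dim_def)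
  then have fB: "finite B" using dim_pos by (simp add: card_ge_0_finite)
  have "v \<in> cfun.span (\<psi> ` {1..M})"
  proof (rule ccontr)
    assume n: "v \<notin> cfun.span (\<psi> ` {1..M})"
    then have "cfun.independent (insert v (\<psi> ` {1..M}))" by (intro cfun.independent_insertI \<psi>_independent)
    moreover have "insert v (\<psi> ` {1..M}) \<subseteq> cfun.span B" using v \<psi>_V B(3) by blast
    ultimately have "card (insert v (\<psi> ` {1..M})) \<le> card B" using cfun.independent_span_bound[OF fB] by blast
    moreover have "v \<notin> \<psi> ` {1..M}" using n cfun.span_base by blast
    ultimately show False using cB card_image[OF \<psi>_inj] by simp
  qed
  then obtain c where c: "v = (\<Sum>j=1..M. cscale (c j) (\<psi> j))" using span_comb by blast
  have "v \<bullet>\<^sub>2 \<psi> j = c j" if "j \<in> {1..M}" for j unfolding c by (rule comb_inner[OF that])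
  then have "(\<Sum>j=1..M. cscale (v \<bullet>\<^sub>2 \<psi> j) (\<psi> j)) = (\<Sum>j=1..M. cscale (c j) (\<psi> j))" by (intro sum.cong) auto
  then show ?thesis using c by simp
qed

lemma L_h_unique:
  assumes v: "v \<in> V" and w: "w \<in> V" "\<And>\<phi>. \<phi> \<in> V \<Longrightarrow> w \<bullet>\<^sub>2 \<phi> = a v \<phi>"
  shows "L_h \<Omega> \<T> a v = w"
  unfolding L_h_def
proof (rule the_equality)
  show "w \<in> V \<and> (\<forall>\<phi>\<in>V. w \<bullet>\<^sub>2 \<phi> = a v \<phi>)" using w by blast
  fix u assume u: "u \<in> V \<and> (\<forall>\<phi>\<in>V. u \<bullet>\<^sub>2 \<phi> = a v \<phi>)"
  have "u = (\<Sum>j=1..M. cscale (u \<bullet>\<^sub>2 \<psi> j) (\<psi> j))" using u by (intro V_expand) blast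
  also have "\<dots> = (\<Sum>j=1..M. cscale (w \<bullet>\<^sub>2 \<psi> j) (\<psi> j))"
  proof (intro sum.cong refl)
    fix j assume "j \<in> {1..M}"
    then have "u \<bullet>\<^sub>2 \<psi> j = w \<bullet>\<^sub>2 \<psi> j" using u w(2) \<psi>_V by simp
    then show "cscale (u \<bullet>\<^sub>2 \<psi> j) (\<psi> j) = cscale (w \<bullet>\<^sub>2 \<psi> j) (\<psi> j)" by simp
  qed
  also have "\<dots> = w" by (rule V_expand[OF w(1), symmetric])
  finally show "u = w" .
qed

text \<open>Riesz representation: the coefficients of \<open>L_h v\<close> are the numbers \<open>a(v, \<psi>\<^sub>j)\<close>.\<close>

lemma L_h_inner:
  assumes v: "v \<in> V" and \<phi>: "\<phi> \<in> V"
  shows "L_h \<Omega> \<T> a v \<bullet>\<^sub>2 \<phi> = a v \<phi>"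
proof -
  let ?w = "\<Sum>j=1..M. cscale (a v (\<psi> j)) (\<psi> j)"
  have w: "?w \<bullet>\<^sub>2 \<phi> = a v \<phi>" if \<phi>: "\<phi> \<in> V" for \<phi>
  proof -
    have h: "\<psi> j \<bullet>\<^sub>2 \<phi> = cnj (\<phi> \<bullet>\<^sub>2 \<psi> j)" if "j \<in> {1..M}" for j
    proof -
      have "\<forall>v\<in>H10 \<Omega>. \<forall>w\<in>H10 \<Omega>. v \<bullet>\<^sub>2 w = cnj (w \<bullet>\<^sub>2 v)"
        using L2_psd_H10 unfolding psd_on_def hermitian_on_def by (elim conjE)
      then show ?thesis by (elim ballE[where x = "\<psi> j"] ballE[where x = \<phi>]) (use V_H10[OF \<phi>] V_H10[OF \<psi>_V[OF that]] in auto)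
    qed
    have "?w \<bullet>\<^sub>2 \<phi> = (\<Sum>j=1..M. a v (\<psi> j) * (\<psi> j \<bullet>\<^sub>2 \<phi>))"
      by (rule sesquilinear_sum[OF V_subspace L2_sesq]) (use \<phi> \<psi>_V in auto)
    also have "\<dots> = (\<Sum>j=1..M. cnj (\<phi> \<bullet>\<^sub>2 \<psi> j) * a v (\<psi> j))" by (intro sum.cong refl) (simp add: h)
    also have "\<dots> = a v (\<Sum>j=1..M. cscale (\<phi> \<bullet>\<^sub>2 \<psi> j) (\<psi> j))"
      by (rule sesquilinear_sum(2)[OF V_subspace a_sesq, symmetric]) (use v \<psi>_V in auto)
    also have "\<dots> = a v \<phi>" by (simp only: V_expand[OF \<phi>, symmetric])
    finally show ?thesis .
  qed
  have "L_h \<Omega> \<T> a v = ?w" by (rule L_h_unique[OF v comb_V w])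
  then show ?thesis using w[OF \<phi>] by simp
qed

lemma L_h_comb: "L_h \<Omega> \<T> a (\<Sum>j=1..M. cscale (c j) (\<psi> j)) = (\<Sum>j=1..M. cscale (of_real (lam j) * c j) (\<psi> j))"
proof (rule L_h_unique[OF comb_V comb_V])
  fix \<phi> assume \<phi>: "\<phi> \<in> V"
  have e: "a (\<psi> j) \<phi> = of_real (lam j) * (\<psi> j \<bullet>\<^sub>2 \<phi>)" if j: "j \<in> {1..M}" for j
    using L_h_inner[OF \<psi>_V[OF j] \<phi>] unfolding eigen[OF j] sesquilinear_onD(3)[OF L2_sesq \<psi>_V[OF j] \<psi>_V[OF j] \<phi>] by simp
  have "(\<Sum>j=1..M. cscale (of_real (lam j) * c j) (\<psi> j)) \<bullet>\<^sub>2 \<phi> = (\<Sum>j=1..M. (of_real (lam j) * c j) * (\<psi> j \<bullet>\<^sub>2 \<phi>))"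
    by (rule sesquilinear_sum[OF V_subspace L2_sesq]) (use \<phi> \<psi>_V in auto)
  also have "\<dots> = (\<Sum>j=1..M. c j * a (\<psi> j) \<phi>)" by (intro sum.cong refl) (simp add: e)
  also have "\<dots> = a (\<Sum>j=1..M. cscale (c j) (\<psi> j)) \<phi>"
    by (rule sesquilinear_sum[OF V_subspace a_sesq, symmetric]) (use \<phi> \<psi>_V in auto)
  finally show "(\<Sum>j=1..M. cscale (of_real (lam j) * c j) (\<psi> j)) \<bullet>\<^sub>2 \<phi> = a (\<Sum>j=1..M. cscale (c j) (\<psi> j)) \<phi>" .
qed

text \<open>The Rayleigh quotient of \<open>\<psi>\<^sub>j\<close> is \<open>lam j\<close>, and the finite element space is contained in \<open>H10\<close>.\<close>

lemma lam_ge: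
  assumes ev: "smallest_eigenvalue_L \<Omega> a lam1" and j: "j \<in> {1..M}"
  shows "lam1 \<le> lam j"
proof -
  have 1: "\<psi> j \<bullet>\<^sub>2 \<psi> j = 1" using orthonormal[OF j j] by simp
  have "a (\<psi> j) (\<psi> j) = of_real (lam j)"
    using L_h_inner[OF \<psi>_V[OF j] \<psi>_V[OF j]]
    unfolding eigen[OF j] sesquilinear_onD(3)[OF L2_sesq \<psi>_V[OF j] \<psi>_V[OF j] \<psi>_V[OF j]] 1 by simp
  moreover have "(L2_norm \<Omega> (\<psi> j))\<^sup>2 = 1" using arg_cong[OF 1, of Re] by (simp add: L2_inner_self)
  ultimately show ?thesis using Rayleigh_lower_bound[OF ev V_H10[OF \<psi>_V[OF j]]] by simp
qed

text \<open>Since \<open>z - L_h\<close> multiplies the coefficients by the nonzero numbers \<open>z - lam j\<close>, it is injective and its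
  inverse divides by them.\<close>

lemma resolvent_comb:
  assumes z: "\<And>j. j \<in> {1..M} \<Longrightarrow> z \<noteq> of_real (lam j)"
  shows "resolvent_h \<Omega> \<T> a z (\<Sum>j=1..M. cscale (c j) (\<psi> j)) = (\<Sum>j=1..M. cscale (c j * inverse (z - of_real (lam j))) (\<psi> j))"
  unfolding resolvent_h_def
proof (rule inv_into_f_eq)
  have app: "cscale z (\<Sum>j=1..M. cscale (c j) (\<psi> j)) - L_h \<Omega> \<T> a (\<Sum>j=1..M. cscale (c j) (\<psi> j)) =
      (\<Sum>j=1..M. cscale ((z - of_real (lam j)) * c j) (\<psi> j))" for c
    unfolding L_h_comb
    by (simp only: cfun.scale_sum_right cfun.scale_scale sum_subtractf[symmetric] cfun.scale_left_diff_distrib[symmetric] left_diff_distrib[symmetric])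
  show "inj_on (\<lambda>w. cscale z w - L_h \<Omega> \<T> a w) V"
  proof (rule inj_onI)
    fix u v assume u: "u \<in> V" and v: "v \<in> V" and eq: "cscale z u - L_h \<Omega> \<T> a u = cscale z v - L_h \<Omega> \<T> a v"
    have 1: "(cscale z w - L_h \<Omega> \<T> a w) \<bullet>\<^sub>2 \<psi> j = (z - of_real (lam j)) * (w \<bullet>\<^sub>2 \<psi> j)" if "w \<in> V" "j \<in> {1..M}" for w j
      using app[of "\<lambda>j. w \<bullet>\<^sub>2 \<psi> j"] comb_inner[OF that(2), of "\<lambda>j. (z - of_real (lam j)) * (w \<bullet>\<^sub>2 \<psi> j)"]
      unfolding V_expand[OF that(1), symmetric] by simp
    have "u \<bullet>\<^sub>2 \<psi> j = v \<bullet>\<^sub>2 \<psi> j" if j: "j \<in> {1..M}" for j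
      using 1[OF u j] 1[OF v j] z[OF j] unfolding eq by simp
    then have "(\<Sum>j=1..M. cscale (u \<bullet>\<^sub>2 \<psi> j) (\<psi> j)) = (\<Sum>j=1..M. cscale (v \<bullet>\<^sub>2 \<psi> j) (\<psi> j))" by (intro sum.cong) auto
    then show "u = v" by (simp only: V_expand[OF u, symmetric] V_expand[OF v, symmetric])
  qed
  show "(\<Sum>j=1..M. cscale (c j * inverse (z - of_real (lam j))) (\<psi> j)) \<in> V" by (rule comb_V)
  show "cscale z (\<Sum>j=1..M. cscale (c j * inverse (z - of_real (lam j))) (\<psi> j)) -
      L_h \<Omega> \<T> a (\<Sum>j=1..M. cscale (c j * inverse (z - of_real (lam j))) (\<psi> j)) = (\<Sum>j=1..M. cscale (c j) (\<psi> j))"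
    unfolding app
  proof (intro sum.cong refl)
    fix j assume "j \<in> {1..M}"
    then have "z - of_real (lam j) \<noteq> 0" using z by simp
    then show "cscale ((z - of_real (lam j)) * (c j * inverse (z - of_real (lam j)))) (\<psi> j) = cscale (c j) (\<psi> j)" by simp
  qed
qed

text \<open>Both operators are diagonal in the eigenbasis and the norm is a weighted Euclidean norm of the
  coefficients, so any common bound of the scalar errors bounds the operator error for every exponent \<open>r\<close>.\<close>

lemma Hdot_error:
  fixes t \<gamma> \<beta> b k r \<epsilon> :: real and N :: nat
  assumes g: "g \<in> V" and z: "\<And>n j. j \<in> {1..M} \<Longrightarrow> sinc_contour b (of_int n * k) \<noteq> of_real (lam j)"
    and err: "\<And>j. j \<in> {1..M} \<Longrightarrow> cmod (mittag_leffler \<gamma> 1 (of_real (- (t powr \<gamma> * lam j powr \<beta>))) -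
       (- (of_real k / (2 * of_real pi * \<i>))) * (\<Sum>n\<in>{-int N..int N}.
          mittag_leffler \<gamma> 1 (- (of_real (t powr \<gamma>) * sinc_contour b (of_int n * k) powr of_real \<beta>)) *
          vector_derivative (sinc_contour b) (at (of_int n * k)) * inverse (sinc_contour b (of_int n * k) - of_real (lam j)))) \<le> \<epsilon>"
    and \<epsilon>: "0 \<le> \<epsilon>"
  shows "Hdot_norm \<Omega> \<T> \<psi> lam r (E_h \<Omega> \<T> \<psi> lam \<gamma> \<beta> t g - Q_hk \<Omega> \<T> a \<gamma> \<beta> b k N t g) \<le> \<epsilon> * Hdot_norm \<Omega> \<T> \<psi> lam r g"
proof -
  define e where "e = (\<lambda>j. mittag_leffler \<gamma> 1 (of_real (- (t powr \<gamma> * lam j powr \<beta>))))"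
  define m where "m = (\<lambda>n. mittag_leffler \<gamma> 1 (- (of_real (t powr \<gamma>) * sinc_contour b (of_int n * k) powr of_real \<beta>)) *
          vector_derivative (sinc_contour b) (at (of_int n * k)))"
  define \<kappa> where "\<kappa> = - (of_real k / (2 * of_real pi * \<i>))"
  define R where "R = (\<lambda>n j. inverse (sinc_contour b (of_int n * k) - of_real (lam j)))"
  define c where "c = (\<lambda>j. g \<bullet>\<^sub>2 \<psi> j)"
  define d where "d = (\<lambda>j. e j - \<kappa> * (\<Sum>n\<in>{-int N..int N}. m n * R n j))"
  have gc: "g = (\<Sum>j=1..M. cscale (c j) (\<psi> j))" unfolding c_def by (rule V_expand[OF g])
  have res: "resolvent_h \<Omega> \<T> a (sinc_contour b (of_int n * k)) g = (\<Sum>j=1..M. cscale (c j * R n j) (\<psi> j))" for n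
    unfolding R_def using resolvent_comb[OF z[of _ n], of c] gc by simp
  have Q: "Q_hk \<Omega> \<T> a \<gamma> \<beta> b k N t g = (\<Sum>j=1..M. cscale (\<kappa> * (\<Sum>n\<in>{-int N..int N}. m n * R n j) * c j) (\<psi> j))"
  proof -
    have "Q_hk \<Omega> \<T> a \<gamma> \<beta> b k N t g = cscale \<kappa> (\<Sum>n\<in>{-int N..int N}. cscale (m n) (\<Sum>j=1..M. cscale (c j * R n j) (\<psi> j)))"
      unfolding Q_hk_def Let_def res m_def \<kappa>_def ..
    also have "\<dots> = (\<Sum>n\<in>{-int N..int N}. \<Sum>j=1..M. cscale (\<kappa> * m n * R n j * c j) (\<psi> j))"
      by (simp only: cfun.scale_sum_right cfun.scale_scale mult_ac)
    also have "\<dots> = (\<Sum>j=1..M. \<Sum>n\<in>{-int N..int N}. cscale (\<kappa> * m n * R n j * c j) (\<psi> j))" by (rule sum.swap)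
    also have "\<dots> = (\<Sum>j=1..M. cscale (\<kappa> * (\<Sum>n\<in>{-int N..int N}. m n * R n j) * c j) (\<psi> j))"
      by (simp only: cfun.scale_sum_left[symmetric] sum_distrib_left sum_distrib_right mult.assoc)
    finally show ?thesis .
  qed
  have E: "E_h \<Omega> \<T> \<psi> lam \<gamma> \<beta> t g = (\<Sum>j=1..M. cscale (e j * c j) (\<psi> j))" by (simp only: E_h_def e_def c_def)
  have diff: "E_h \<Omega> \<T> \<psi> lam \<gamma> \<beta> t g - Q_hk \<Omega> \<T> a \<gamma> \<beta> b k N t g = (\<Sum>j=1..M. cscale (d j * c j) (\<psi> j))"
    unfolding E Q d_def by (simp only: sum_subtractf[symmetric] cfun.scale_left_diff_distrib[symmetric] left_diff_distrib)
  have dj: "cmod (d j) \<le> \<epsilon>" if "j \<in> {1..M}" for j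
    using err[OF that] unfolding d_def e_def m_def R_def \<kappa>_def .
  have "(\<Sum>j=1..M. lam j powr r * (cmod ((\<Sum>j=1..M. cscale (d j * c j) (\<psi> j)) \<bullet>\<^sub>2 \<psi> j))\<^sup>2) \<le> (\<Sum>j=1..M. \<epsilon>\<^sup>2 * (lam j powr r * (cmod (c j))\<^sup>2))"
  proof (rule sum_mono)
    fix j assume j: "j \<in> {1..M}"
    have "(cmod (d j * c j))\<^sup>2 \<le> \<epsilon>\<^sup>2 * (cmod (c j))\<^sup>2"
      unfolding norm_mult power_mult_distrib by (intro mult_right_mono power_mono dj j) auto
    then have "lam j powr r * (cmod (d j * c j))\<^sup>2 \<le> lam j powr r * (\<epsilon>\<^sup>2 * (cmod (c j))\<^sup>2)" by (intro mult_left_mono) auto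
    then show "lam j powr r * (cmod ((\<Sum>j=1..M. cscale (d j * c j) (\<psi> j)) \<bullet>\<^sub>2 \<psi> j))\<^sup>2 \<le> \<epsilon>\<^sup>2 * (lam j powr r * (cmod (c j))\<^sup>2)"
      unfolding comb_inner[OF j] by (simp only: mult.left_commute)
  qed
  also have "\<dots> = \<epsilon>\<^sup>2 * (\<Sum>j=1..M. lam j powr r * (cmod (c j))\<^sup>2)" by (simp only: sum_distrib_left)
  finally have "Hdot_norm \<Omega> \<T> \<psi> lam r (\<Sum>j=1..M. cscale (d j * c j) (\<psi> j)) \<le> sqrt (\<epsilon>\<^sup>2 * (\<Sum>j=1..M. lam j powr r * (cmod (c j))\<^sup>2))"
    unfolding Hdot_norm_def by (rule real_sqrt_le_mono)
  also have "\<dots> = \<epsilon> * Hdot_norm \<Omega> \<T> \<psi> lam r g" unfolding Hdot_norm_def c_def using \<epsilon> by (simp add: real_sqrt_mult)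
  finally show ?thesis unfolding diff .
qed

end

section \<open>The error estimate\<close>

text \<open>The contour meets the real axis at \<open>b\<close> only.\<close>

lemma sinc_contour_neq_real:
  assumes "0 < b" "b < l"
  shows "sinc_contour b y \<noteq> of_real l"
proof
  assume e: "sinc_contour b y = of_real l"
  have "b * sinh y = 0" using arg_cong[OF e, of Im] by (simp add: sinc_contour_def)
  then have "y = 0" using assms by simp
  then show False using arg_cong[OF e, of Re] assms by (simp add: sinc_contour_def)
qed

theorem theorem4p3:
  fixes \<Omega> :: "(real^'n::finite) set"
    and a :: "(real^'n \<Rightarrow> complex) \<Rightarrow> (real^'n \<Rightarrow> complex) \<Rightarrow> complex"
    and \<T> :: "real \<Rightarrow> (real^'n) set set"
    and \<psi> :: "real \<Rightarrow> nat \<Rightarrow> real^'n \<Rightarrow> complex"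
    and lam :: "real \<Rightarrow> nat \<Rightarrow> real"
    and lam1 \<gamma> \<beta> b s d :: real
  assumes "polygonal_lipschitz_domain \<Omega>"
    and "sesquilinear_on (H10 \<Omega>) a" and "hermitian_on (H10 \<Omega>) a"
    and "coercive_form \<Omega> a" and "bounded_form \<Omega> a"
    and "smallest_eigenvalue_L \<Omega> a lam1"
    and "regular_mesh_family \<Omega> \<T>"
    and "\<And>h. 0 < h \<Longrightarrow> orthonormal_eigenfunctions \<Omega> (\<T> h) a (\<psi> h) (lam h)"
    and "0 < \<gamma>" "\<gamma> < 1" and "0 < \<beta>" "\<beta> < 1"
    and "0 < b" "b < lam1 / sqrt 2"
    and "0 \<le> s" "s \<le> 1/2"
    and "0 < d" "d < pi/4"
  shows "\<exists>C. \<forall>(N::nat) k h t. 0 < N \<longrightarrow> k = sqrt (pi * d / (\<beta> * real N)) \<longrightarrow> 0 < h \<longrightarrow> 0 < t \<longrightarrow>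
           (\<forall>g \<in> fe_space \<Omega> (\<T> h).
              Hdot_norm \<Omega> (\<T> h) (\<psi> h) (lam h) (2 * s)
                (E_h \<Omega> (\<T> h) (\<psi> h) (lam h) \<gamma> \<beta> t g - Q_hk \<Omega> (\<T> h) a \<gamma> \<beta> b k N t g)
              \<le> C * t powr (- \<gamma>) * exp (- sqrt (pi * d * \<beta> * real N)) *
                Hdot_norm \<Omega> (\<T> h) (\<psi> h) (lam h) (2 * s) g)"
proof -
  have \<Omega>: "elliptic_form \<Omega> a"
    using assms(1-5) by unfold_locales (auto simp: polygonal_lipschitz_domain_def)
  have bl: "b < lam1"
  proof -
    have "b * 1 \<le> b * sqrt 2" using assms(13) by (intro mult_left_mono) auto
    also have "\<dots> < lam1" using assms(14) by (simp add: pos_less_divide_eq)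
    finally show ?thesis by simp
  qed
  obtain C where C: "0 \<le> C" and bound: "\<And>(l::real) (N::nat) k (t::real). lam1 \<le> l \<Longrightarrow> 0 < N \<Longrightarrow> k = sqrt (pi * d / (\<beta> * N)) \<Longrightarrow> 0 < t \<Longrightarrow>
     cmod (mittag_leffler \<gamma> 1 (of_real (- (t powr \<gamma> * l powr \<beta>))) -
       (- (of_real k / (2 * of_real pi * \<i>))) * (\<Sum>j\<in>{-int N..int N}.
          mittag_leffler \<gamma> 1 (- (of_real (t powr \<gamma>) * sinc_contour b (of_int j * k) powr of_real \<beta>)) *
          vector_derivative (sinc_contour b) (at (of_int j * k)) * inverse (sinc_contour b (of_int j * k) - of_real l)))
      \<le> C * t powr (- \<gamma>) * exp (- sqrt (pi * d * \<beta> * N))"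
    using scalar_quadrature_error[OF assms(9-14) assms(17,18)] by blast
  show ?thesis
  proof (intro exI[of _ C] allI impI ballI)
    fix N :: nat and k h t :: real and g
    assume N: "0 < N" and k: "k = sqrt (pi * d / (\<beta> * real N))" and h: "0 < h" and t: "0 < t" and g: "g \<in> fe_space \<Omega> (\<T> h)"
    let ?\<epsilon> = "C * t powr (- \<gamma>) * exp (- sqrt (pi * d * \<beta> * real N))"
    show "Hdot_norm \<Omega> (\<T> h) (\<psi> h) (lam h) (2 * s)
        (E_h \<Omega> (\<T> h) (\<psi> h) (lam h) \<gamma> \<beta> t g - Q_hk \<Omega> (\<T> h) a \<gamma> \<beta> b k N t g)
        \<le> ?\<epsilon> * Hdot_norm \<Omega> (\<T> h) (\<psi> h) (lam h) (2 * s) g"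
    \<comment> \<open>In dimension 0 both norms are empty sums.\<close>
    proof (cases "fe_dim \<Omega> (\<T> h) = 0")
      case True
      then show ?thesis by (simp add: Hdot_norm_def)
    next
      case False
      then have "discrete_spectrum \<Omega> a (\<T> h) (\<psi> h) (lam h)"
        using \<Omega> assms(8)[OF h] by (simp add: discrete_spectrum_def discrete_spectrum_axioms_def)
      then interpret discrete_spectrum \<Omega> a "\<T> h" "\<psi> h" "lam h" .
      show ?thesis
      proof (rule Hdot_error[OF g])
        fix n :: int and j assume j: "j \<in> {1..fe_dim \<Omega> (\<T> h)}"
        have "b < lam h j" using bl lam_ge[OF assms(6) j] by linarith
        then show "sinc_contour b (of_int n * k) \<noteq> of_real (lam h j)" by (rule sinc_contour_neq_real[OF assms(13)])
      next
        show "0 \<le> ?\<epsilon>" using C by simp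
      qed (rule bound[OF lam_ge[OF assms(6)] N k t])
    qed
  qed
qed

end
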